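(* Let $n\geqslant 1$, let $X$ be a finite connected $d$-regular graph, and let $\chi_{v,v'}\in\mathrm{Sp}_{2n}(\mathbb{Z})$ be assigned to the oriented edges $(v,v')$ of $X$ with $\chi_{v',v}=\chi_{v,v'}^{-1}$. For each positive even integer $N$ let $\Delta^N$ be the operator on $C(X,\mathcal{H}_N)$ given by $(\Delta^N u)(v)=\sum_{v'\sim v}M_{\chi_{v,v'},N}\,u(v')$, and let $(u_{N,i})_{1\leqslant i\leqslant |X|N^n}$ be an orthonormal basis of $L^2(X,\mathcal{H}_N)$ consisting of eigensections of $\Delta^N$. Assume: [BIV] for every nonidentity element $\gamma$ of the fundamental group of $X$ (at a fixed base vertex), the upper right $n\times n$ block $B_\gamma$ of $\chi(\gamma)=\begin{pmatrix}A_\gamma&B_\gamma\\C_\gamma&D_\gamma\end{pmatrix}$ satisfies $\det B_\gamma\neq0$; [ERG] every function in $L^2(\mathbb{T}^{2n})$ invariant under all $\chi(\gamma)$ is constant almost everywhere. Then for every $f\in C^\infty(X\times\mathbb{T}^{2n})$, $$\lim_{\substack{N\in2\mathbb{N}\\ N\to\infty}}\frac{1}{|X|\,N^n}\sum_i\left|\big\langle\mathrm{Op}_N(f)u_{N,i},u_{N,i}\big\rangle_{L^2(X,\mathcal{H}_N)}-\frac{1}{|X|}\sum_{v\in X}\int_{\mathbb{T}^{2n}}f(v,z)\,dz\right|^2=0,$$ where $(\mathrm{Op}_N(f)u)(v)=\mathrm{Op}_N(f(v,\cdot))u(v)$.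
   Context: Graph conventions. $X$ may have self-loops and multiple edges; sums over neighbors $v'\sim v$ are sums over oriented edges, distinct edges counted separately (a self-loop gives two mutually reverse oriented edges). $|X|$ is the number of vertices. The matrix assigned to the reverse of an oriented edge is the inverse of the matrix assigned to the edge. For a loop $\gamma=(v_k,\ldots,v_0)$ with $v_k=v_0$ the base vertex, $\chi(\gamma)=\chi_{v_k,v_{k-1}}\cdots\chi_{v_1,v_0}$; this depends only on the homotopy class of $\gamma$ (loops modulo insertion/removal of immediate backtracking) and defines a homomorphism from the fundamental group of $X$ to $\mathrm{Sp}_{2n}(\mathbb{Z})$, which acts on $\mathbb{T}^{2n}=\mathbb{R}^{2n}/\mathbb{Z}^{2n}$ by linear automorphisms. $\mathrm{Sp}_{2n}(\mathbb{Z})$ is the group of integer $2n\times 2n$ matrices preserving $\sigma((y,\eta),(y',\eta'))=\langle\eta,y'\rangle-\langle y,\eta'\rangle$. Quantum states. Let $N$ be a positive even integer, $h=(2\pi N)^{-1}$. For $\omega=(y,\eta)\in\mathbb{R}^{2n}$ let $U_\omega$ act on tempered distributions by $(U_\omega f)(x)=e^{\frac{\sqrt{-1}}{h}\langle y,x\rangle+\frac{\sqrt{-1}}{2h}\langle y,\eta\rangle}f(x+\eta)$. Let $\mathcal{H}_N=\{f\in\mathscr{S}'(\mathbb{R}^n)\mid U_\omega f=e^{N\pi\sqrt{-1}\langle y,\eta\rangle}f\ \forall\,\omega=(y,\eta)\in\mathbb{Z}^{2n}\}$. It has dimension $N^n$ with basis $e_j(x)=N^{-n/2}\sum_{k\in\mathbb{Z}^n}\delta(x-\tfrac{Nk+j}{N})$,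 $j\in\mathbb{Z}_N^n=(\mathbb{Z}/N)^n$, and carries the inner product making $\{e_j\}$ orthonormal. For $\omega=(y,\eta)\in\mathbb{Z}^{2n}$, $U_{\omega/N}$ preserves $\mathcal{H}_N$ and $U_{\omega/N}e_j=e^{\frac{2\pi\sqrt{-1}}{N}\langle y,j\rangle-\frac{\pi\sqrt{-1}}{N}\langle y,\eta\rangle}e_{j-\eta}$. Quantum observables. For $a\in C^\infty(\mathbb{T}^{2n})$, $\mathrm{Op}_N(a)$ is the restriction to $\mathcal{H}_N$ of the semiclassical Weyl quantization of $a$; explicitly $\mathrm{Op}_N(a)=\sum_{\omega\in\mathbb{Z}^{2n}}\widehat a(\omega)U_{\omega/N}$ with $\widehat a(\omega)=\int_{\mathbb{T}^{2n}}e^{-2\pi\sqrt{-1}\langle\omega,z\rangle}a(z)dz$. Quantum cat maps. For $E\in\mathrm{Sp}_{2n}(\mathbb{Z})$, $M_{E,N}$ is a unitary operator on $\mathcal{H}_N$ with $M_{E,N}^{-1}\mathrm{Op}_N(a)M_{E,N}=\mathrm{Op}_N(a\circ E)$ for all $a\in C^\infty(\mathbb{T}^{2n})$; it exists and is unique up to a unit complex scalar. The scalars for the edges of $X$ are chosen so that $M_{\chi_{v',v},N}=M_{\chi_{v,v'},N}^{-1}$ for reverse edges, so $\Delta^N$ is selfadjoint on $C(X,\mathcal{H}_N)$ (the $\mathcal{H}_N$-valued functions on vertices; $L^2(X,\mathcal{H}_N)$ has norm $\|u\|^2=\sum_{v}\|u(v)\|^2_{\mathcal{H}_N}$). *)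

theory Defs
  imports "HOL-Analysis.Analysis" "Graph_Theory.Graph_Theory"
begin

section \<open>Graphs with self-loops and multiple edges\<close>

text \<open>
  A graph is a \<^locale>\<open>bidirected_digraph\<close>: its arcs are the oriented edges, and reversal is an
  involution on the arcs without fixed points, so that a self-loop contributes two arcs. An arc
  with tail \<open>v\<close> and head \<open>w\<close> is the oriented edge \<open>(v, w)\<close>, hence the walk with arcs
  \<open>(v_k, v_(k-1)), ..., (v_1, v_0)\<close> is the path written \<open>(v_k, ..., v_0)\<close>.
\<close>

definition regular_graph :: "('v, 'e) pre_digraph \<Rightarrow> ('e \<Rightarrow> 'e) \<Rightarrow> nat \<Rightarrow> bool" where
  "regular_graph X rv d \<longleftrightarrow> fin_digraph X \<and> bidirected_digraph X rv \<and>
     Digraph_Component.connected X \<and> (\<forall>v\<in>verts X. out_degree X v = d)"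

definition loops_at :: "('v, 'e) pre_digraph \<Rightarrow> 'v \<Rightarrow> 'e list set" where
  "loops_at X b = {p. pre_digraph.awalk X b p b}"

definition backtrack_step :: "('v, 'e) pre_digraph \<Rightarrow> ('e \<Rightarrow> 'e) \<Rightarrow> 'v \<Rightarrow> 'e list \<Rightarrow> 'e list \<Rightarrow> bool" where
  "backtrack_step X rv b p q \<longleftrightarrow> p \<in> loops_at X b \<and> q \<in> loops_at X b \<and>
     (\<exists>r s e. p = r @ s \<and> q = r @ [e, rv e] @ s)"

definition loop_homotopy :: "('v, 'e) pre_digraph \<Rightarrow> ('e \<Rightarrow> 'e) \<Rightarrow> 'v \<Rightarrow> ('e list \<times> 'e list) set" where
  "loop_homotopy X rv b =
     {(p, q). p \<in> loops_at X b \<and> q \<in> loops_at X b \<and> equivclp (backtrack_step X rv b) p q}"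

definition fund_group :: "('v, 'e) pre_digraph \<Rightarrow> ('e \<Rightarrow> 'e) \<Rightarrow> 'v \<Rightarrow> 'e list set set" where
  "fund_group X rv b = loops_at X b // loop_homotopy X rv b"

definition fund_one :: "('v, 'e) pre_digraph \<Rightarrow> ('e \<Rightarrow> 'e) \<Rightarrow> 'v \<Rightarrow> 'e list set" where
  "fund_one X rv b = loop_homotopy X rv b `` {[]}"

section \<open>Integer symplectic matrices\<close>

text \<open>
  Coordinates on phase space are indexed by \<^typ>\<open>'n + 'n\<close>: a point \<open>(y, \<eta>)\<close> has
  \<open>y\<close> in the \<^const>\<open>Inl\<close> and \<open>\<eta>\<close> in the \<^const>\<open>Inr\<close> coordinates.
\<close>

definition fst_half :: "'a ^ ('n + 'n) \<Rightarrow> 'a ^ 'n" where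
  "fst_half z = (\<chi> i. z $ Inl i)"

definition snd_half :: "'a ^ ('n + 'n) \<Rightarrow> 'a ^ 'n" where
  "snd_half z = (\<chi> i. z $ Inr i)"

definition of_int_vec :: "int ^ 'k \<Rightarrow> real ^ 'k" where
  "of_int_vec k = (\<chi> i. of_int (k $ i))"

definition sympl_form :: "real ^ ('n::finite + 'n) \<Rightarrow> real ^ ('n + 'n) \<Rightarrow> real" where
  "sympl_form z w = snd_half z \<bullet> fst_half w - fst_half z \<bullet> snd_half w"

definition mat_act :: "int ^ 'k ^ 'k \<Rightarrow> real ^ 'k \<Rightarrow> real ^ 'k::finite" where
  "mat_act E z = map_matrix of_int E *v z"

definition Sp_int :: "(int ^ ('n::finite + 'n) ^ ('n + 'n)) set" where
  "Sp_int = {E. \<forall>z w. sympl_form (mat_act E z) (mat_act E w) = sympl_form z w}"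

definition upper_right :: "'a ^ ('n + 'n) ^ ('n + 'n) \<Rightarrow> 'a ^ 'n ^ 'n" where
  "upper_right E = (\<chi> i j. E $ Inl i $ Inr j)"

definition symplectic_weights ::
  "('v, 'e) pre_digraph \<Rightarrow> ('e \<Rightarrow> 'e) \<Rightarrow> ('e \<Rightarrow> int ^ ('n::finite + 'n) ^ ('n + 'n)) \<Rightarrow> bool" where
  "symplectic_weights X rv chi \<longleftrightarrow>
     (\<forall>e\<in>arcs X. chi e \<in> Sp_int \<and> chi (rv e) ** chi e = mat 1 \<and> chi e ** chi (rv e) = mat 1)"

definition walk_weight :: "('e \<Rightarrow> int ^ 'k ^ 'k) \<Rightarrow> 'e list \<Rightarrow> int ^ 'k ^ 'k::finite" where
  "walk_weight chi p = foldr (\<lambda>e A. chi e ** A) p (mat 1)"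

text \<open>
  For weights as above, \<^const>\<open>walk_weight\<close> is constant on each homotopy class, and
  \<open>class_weight\<close> is this constant value.
\<close>

definition class_weight :: "('e \<Rightarrow> int ^ 'k ^ 'k) \<Rightarrow> 'e list set \<Rightarrow> int ^ 'k ^ 'k::finite" where
  "class_weight chi \<gamma> = the_elem (walk_weight chi ` \<gamma>)"

section \<open>Smooth functions and functions on tori\<close>

primrec iter_deriv :: "'a::euclidean_space list \<Rightarrow> ('a \<Rightarrow> complex) \<Rightarrow> 'a \<Rightarrow> complex" where
  "iter_deriv [] f = f"
| "iter_deriv (b # bs) f = (\<lambda>x. frechet_derivative (iter_deriv bs f) (at x) b)"

definition smooth_fun :: "('a::euclidean_space \<Rightarrow> complex) \<Rightarrow> bool" where
  "smooth_fun f \<longleftrightarrow> (\<forall>bs x. set bs \<subseteq> Basis \<longrightarrow> iter_deriv bs f differentiable (at x))"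

text \<open>
  Functions on the torus \<open>\<real>^k / \<int>^k\<close> are \<open>\<int>^k\<close>-periodic functions on \<open>\<real>^k\<close>, integrated over
  the unit cube.
\<close>

definition torus_fun :: "(real ^ 'k \<Rightarrow> complex) \<Rightarrow> bool" where
  "torus_fun a \<longleftrightarrow> (\<forall>z k. a (z + of_int_vec k) = a z)"

definition torus_smooth :: "(real ^ 'k::finite \<Rightarrow> complex) set" where
  "torus_smooth = {a. torus_fun a \<and> smooth_fun a}"

definition torus_integral :: "(real ^ 'k::finite \<Rightarrow> complex) \<Rightarrow> complex" where
  "torus_integral a = (LINT z:cbox 0 One|lborel. a z)"

definition torus_L2 :: "(real ^ 'k::finite \<Rightarrow> complex) set" where
  "torus_L2 = {g. torus_fun g \<and> g \<in> borel_measurable lborel \<and>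
     set_integrable lborel (cbox 0 One) (\<lambda>z. (cmod (g z))\<^sup>2)}"

definition fourier_coeff :: "(real ^ 'k::finite \<Rightarrow> complex) \<Rightarrow> int ^ 'k \<Rightarrow> complex" where
  "fourier_coeff a \<omega> = torus_integral (\<lambda>z. cis (- 2 * pi * (of_int_vec \<omega> \<bullet> z)) * a z)"

section \<open>Tempered distributions\<close>

definition schwartz :: "('a::euclidean_space \<Rightarrow> complex) set" where
  "schwartz = {\<phi>. smooth_fun \<phi> \<and>
     (\<forall>k bs. set bs \<subseteq> Basis \<longrightarrow> bounded (range (\<lambda>x. (1 + norm x) ^ k * cmod (iter_deriv bs \<phi> x))))}"

definition schwartz_seminorm :: "nat \<Rightarrow> 'a::euclidean_space list \<Rightarrow> ('a \<Rightarrow> complex) \<Rightarrow> real" where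
  "schwartz_seminorm k bs \<phi> = (SUP x. (1 + norm x) ^ k * cmod (iter_deriv bs \<phi> x))"

type_synonym 'n distr = "(real ^ 'n \<Rightarrow> complex) \<Rightarrow> complex"

text \<open>
  The value 0 outside the Schwartz space makes equality of functionals coincide with equality of
  distributions.
\<close>

definition tempered :: "('n::finite) distr set" where
  "tempered = {T.
     (\<forall>\<phi>. \<phi> \<notin> schwartz \<longrightarrow> T \<phi> = 0) \<and>
     (\<forall>\<phi>\<in>schwartz. \<forall>\<psi>\<in>schwartz. T (\<lambda>x. \<phi> x + \<psi> x) = T \<phi> + T \<psi>) \<and>
     (\<forall>c. \<forall>\<phi>\<in>schwartz. T (\<lambda>x. c * \<phi> x) = c * T \<phi>) \<and>
     (\<exists>C k m. \<forall>\<phi>\<in>schwartz.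
        cmod (T \<phi>) \<le> C * (\<Sum>bs | set bs \<subseteq> Basis \<and> length bs \<le> m. schwartz_seminorm k bs \<phi>))}"

section \<open>Quantum states\<close>

definition planck :: "nat \<Rightarrow> real" where
  "planck N = 1 / (2 * pi * real N)"

text \<open>
  The transposed action on test functions: for a function \<open>f\<close>, substituting \<open>x - \<eta>\<close> for \<open>x\<close> in the
  integral of \<open>exp (i <y, x> / h + i <y, \<eta>> / (2 h)) f (x + \<eta>) \<phi> x\<close>
  moves the translation and the phase to \<open>\<phi>\<close>.
\<close>

definition U_op :: "nat \<Rightarrow> real ^ ('n::finite + 'n) \<Rightarrow> 'n distr \<Rightarrow> 'n distr" where
  "U_op N \<omega> T = (let y = fst_half \<omega>; \<eta> = snd_half \<omega> in
     (\<lambda>\<phi>. T (\<lambda>x. cis ((y \<bullet> (x - \<eta>)) / planck N + (y \<bullet> \<eta>) / (2 * planck N)) * \<phi> (x - \<eta>))))"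

definition H_space :: "nat \<Rightarrow> ('n::finite) distr set" where
  "H_space N = {T \<in> tempered. \<forall>\<omega> :: int ^ ('n + 'n).
     U_op N (of_int_vec \<omega>) T =
       (\<lambda>\<phi>. cis (real N * pi * (fst_half (of_int_vec \<omega>) \<bullet> snd_half (of_int_vec \<omega>))) * T \<phi>)}"

text \<open>The standard representatives of \<open>(\<int> / N)^n\<close>.\<close>

definition Z_mod :: "nat \<Rightarrow> (int ^ 'n::finite) set" where
  "Z_mod N = {j. \<forall>i. 0 \<le> j $ i \<and> j $ i < int N}"

definition e_basis :: "nat \<Rightarrow> int ^ 'n \<Rightarrow> ('n::finite) distr" where
  "e_basis N j = (\<lambda>\<phi>. if \<phi> \<in> schwartz
     then of_real (real N powr (- real CARD('n) / 2)) *
       (\<Sum>\<^sub>\<infinity>k :: int ^ 'n. \<phi> (\<chi> i. (real N * of_int (k $ i) + of_int (j $ i)) / real N))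
     else 0)"

definition H_coord :: "nat \<Rightarrow> ('n::finite) distr \<Rightarrow> int ^ 'n \<Rightarrow> complex" where
  "H_coord N T = (THE c. (\<forall>j. j \<notin> Z_mod N \<longrightarrow> c j = 0) \<and>
     T = (\<lambda>\<phi>. \<Sum>j\<in>Z_mod N. c j * e_basis N j \<phi>))"

definition H_inner :: "nat \<Rightarrow> ('n::finite) distr \<Rightarrow> 'n distr \<Rightarrow> complex" where
  "H_inner N S T = (\<Sum>j\<in>Z_mod N. H_coord N S j * cnj (H_coord N T j))"

section \<open>Quantum observables and quantum cat maps\<close>

definition Op :: "nat \<Rightarrow> (real ^ ('n::finite + 'n) \<Rightarrow> complex) \<Rightarrow> 'n distr \<Rightarrow> 'n distr" where
  "Op N a T = (\<lambda>\<phi>. \<Sum>\<^sub>\<infinity>\<omega>. fourier_coeff a \<omega> * U_op N ((1 / real N) *\<^sub>R of_int_vec \<omega>) T \<phi>)"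

definition H_unitary :: "nat \<Rightarrow> ('n::finite distr \<Rightarrow> 'n distr) \<Rightarrow> bool" where
  "H_unitary N M \<longleftrightarrow> bij_betw M (H_space N) (H_space N) \<and>
     (\<forall>S\<in>H_space N. \<forall>T\<in>H_space N. M (\<lambda>\<phi>. S \<phi> + T \<phi>) = (\<lambda>\<phi>. M S \<phi> + M T \<phi>)) \<and>
     (\<forall>c. \<forall>T\<in>H_space N. M (\<lambda>\<phi>. c * T \<phi>) = (\<lambda>\<phi>. c * M T \<phi>)) \<and>
     (\<forall>S\<in>H_space N. \<forall>T\<in>H_space N. H_inner N (M S) (M T) = H_inner N S T)"

definition is_cat_map ::
  "nat \<Rightarrow> int ^ ('n::finite + 'n) ^ ('n + 'n) \<Rightarrow> ('n distr \<Rightarrow> 'n distr) \<Rightarrow> bool" where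
  "is_cat_map N E M \<longleftrightarrow> H_unitary N M \<and>
     (\<forall>a\<in>torus_smooth. \<forall>T\<in>H_space N.
        inv_into (H_space N) M (Op N a (M T)) = Op N (a \<circ> mat_act E) T)"

text \<open>
  The scalars of the cat maps are chosen edge by edge, subject to the compatibility with edge
  reversal.
\<close>

definition cat_map_choice ::
  "('v, 'e) pre_digraph \<Rightarrow> ('e \<Rightarrow> 'e) \<Rightarrow> ('e \<Rightarrow> int ^ ('n::finite + 'n) ^ ('n + 'n)) \<Rightarrow> nat
    \<Rightarrow> ('e \<Rightarrow> 'n distr \<Rightarrow> 'n distr) \<Rightarrow> bool" where
  "cat_map_choice X rv chi N M \<longleftrightarrow>
     (\<forall>e\<in>arcs X. is_cat_map N (chi e) (M e) \<and>
        (\<forall>T\<in>H_space N. M (rv e) T = inv_into (H_space N) (M e) T))"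

section \<open>Sections over the graph\<close>

definition sections :: "('v, 'e) pre_digraph \<Rightarrow> nat \<Rightarrow> ('v \<Rightarrow> 'n::finite distr) set" where
  "sections X N = {u. \<forall>v\<in>verts X. u v \<in> H_space N}"

definition sec_inner ::
  "('v, 'e) pre_digraph \<Rightarrow> nat \<Rightarrow> ('v \<Rightarrow> 'n::finite distr) \<Rightarrow> ('v \<Rightarrow> 'n distr) \<Rightarrow> complex" where
  "sec_inner X N u w = (\<Sum>v\<in>verts X. H_inner N (u v) (w v))"

definition laplacian ::
  "('v, 'e) pre_digraph \<Rightarrow> ('e \<Rightarrow> 'n distr \<Rightarrow> 'n distr) \<Rightarrow> ('v \<Rightarrow> 'n distr) \<Rightarrow> 'v \<Rightarrow> 'n distr" where
  "laplacian X M u v = (\<lambda>\<phi>. \<Sum>e\<in>out_arcs X v. M e (u (head X e)) \<phi>)"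

definition eigensection ::
  "('v, 'e) pre_digraph \<Rightarrow> ('e \<Rightarrow> 'n distr \<Rightarrow> 'n distr) \<Rightarrow> ('v \<Rightarrow> 'n distr) \<Rightarrow> bool" where
  "eigensection X M u \<longleftrightarrow>
     (\<exists>\<mu> :: complex. \<forall>v\<in>verts X. laplacian X M u v = (\<lambda>\<phi>. \<mu> * u v \<phi>))"

definition sec_orthonormal_basis ::
  "('v, 'e) pre_digraph \<Rightarrow> nat \<Rightarrow> nat \<Rightarrow> (nat \<Rightarrow> 'v \<Rightarrow> 'n::finite distr) \<Rightarrow> bool" where
  "sec_orthonormal_basis X N m u \<longleftrightarrow>
     (\<forall>i\<in>{1..m}. u i \<in> sections X N) \<and>
     (\<forall>i\<in>{1..m}. \<forall>j\<in>{1..m}. sec_inner X N (u i) (u j) = (if i = j then 1 else 0)) \<and>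
     (\<forall>w\<in>sections X N. \<exists>c. \<forall>v\<in>verts X. w v = (\<lambda>\<phi>. \<Sum>i=1..m. c i * u i v \<phi>))"

definition Op_sec ::
  "nat \<Rightarrow> ('v \<Rightarrow> real ^ ('n::finite + 'n) \<Rightarrow> complex) \<Rightarrow> ('v \<Rightarrow> 'n distr) \<Rightarrow> 'v \<Rightarrow> 'n distr" where
  "Op_sec N f u v = Op N (f v) (u v)"

section \<open>Assumptions on the weights\<close>

definition BIV ::
  "('v, 'e) pre_digraph \<Rightarrow> ('e \<Rightarrow> 'e) \<Rightarrow> 'v \<Rightarrow> ('e \<Rightarrow> int ^ ('n::finite + 'n) ^ ('n + 'n)) \<Rightarrow> bool" where
  "BIV X rv b chi \<longleftrightarrow>
     (\<forall>\<gamma>\<in>fund_group X rv b - {fund_one X rv b}. det (upper_right (class_weight chi \<gamma>)) \<noteq> 0)"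

definition ERG ::
  "('v, 'e) pre_digraph \<Rightarrow> ('e \<Rightarrow> 'e) \<Rightarrow> 'v \<Rightarrow> ('e \<Rightarrow> int ^ ('n::finite + 'n) ^ ('n + 'n)) \<Rightarrow> bool" where
  "ERG X rv b chi \<longleftrightarrow>
     (\<forall>g\<in>torus_L2.
        (\<forall>\<gamma>\<in>fund_group X rv b. AE z in lborel. g (mat_act (class_weight chi \<gamma>) z) = g z)
        \<longrightarrow> (\<exists>c. AE z in lborel. g z = c))"

end

theory Submission
  imports Defs "HOL-Library.Function_Algebras"
begin

text \<open>
  For an eigensection \<open>u\<close>, a vertex \<open>v\<close> and a frequency \<open>w\<close> let \<open>a (v, w)\<close> be the coefficient
  \<open><U\<^bsub>w/N\<^esub> u (v), u (v)>\<close> (\<open>diag_coeff\<close>). The Fourier coefficients of a smooth observable are summable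
  and these coefficients are at most \<open>1\<close> in modulus, so it is enough to treat single frequencies: on
  average over the eigensections, \<open>a (v, w)\<close> has to be small for \<open>w \<noteq> 0\<close>, and \<open>a (v, 0)\<close> has to be close to
  \<open>1 / |X|\<close> (\<open>superposition_variance\<close>).

  The main step is that \<open>a\<close> is almost invariant under transport along an arc \<open>e\<close>: on average
  \<open>a (tail e, w)\<close> is close to \<open>a (head e, w v* chi e)\<close> (\<open>arc_variance\<close>). Let \<open>s (i, j)\<close> be the sum over
  all nonbacktracking walks with \<open>i\<close> arcs before \<open>e\<close> and \<open>j\<close> arcs after it, of the expectation value of the
  transport along the walk with \<open>U\<^bsub>w/N\<^esub>\<close> inserted in front of \<open>e\<close>. The eigenvalue equation may be applied at
  either end of a walk, which yields, with \<open>q = d - 1\<close> and the eigenvalue \<open>\<mu>\<close>, the recursions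
  \<open>s (i+1, j) + q s (i-1, j) = \<mu> s (i, j) = s (i, j+1) + q s (i, j-1)\<close>, where at the walk consisting of
  \<open>e\<close> alone the missing term is replaced by one of the two coefficients under comparison.
  Therefore the difference of these coefficients, times \<open>q ^ k\<close>, equals \<open>s (k, k+1) - s (k+1, k)\<close> for every
  \<open>k\<close> (\<open>walk_sum_difference\<close>). For \<open>q = 0\<close> the difference vanishes because there are no such walks; otherwise
  divide by \<open>q ^ k\<close> and average over \<open>k < L\<close>. By Bessel's inequality (\<open>block_bessel\<close>) the
  mean square over the eigensections is at most the squared Hilbert-Schmidt norm, normalized by the
  dimension, of the averaged operator. If the transports along distinct walks were orthogonal, this
  would be of order \<open>1 / L\<close>.

  They are asymptotically orthogonal. Two distinct nonbacktracking walks with the same ends form a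
  noncontractible loop, whose weight differs from the identity by \<open>BIV\<close>, because the upper
  right block of the identity is singular (\<open>nonbacktracking_weights_distinct\<close>). And the Hilbert-Schmidt
  product of two unitary operators that move Weyl translations along different matrices is
  \<open>o (N\<^sup>n)\<close> (\<open>hs_small\<close>): inserting translations shows that it equals, up to phases, the product in which one
  operator is multiplied by any of many pairwise orthogonal Weyl translations.

  Ergodicity enters through the frequencies. A nonzero \<open>w\<close> has an infinite orbit under the
  weights of loops (\<open>infinite_frequency_orbit\<close>). So \<open>a (v, w)\<close> is close to its average over \<open>L\<close> distinct
  frequencies, whose mean square is of order \<open>1 / L\<close>. For \<open>w = 0\<close> the coefficients are the squared norms
  of the values of the section; they add up to \<open>1\<close> and are almost independent of the vertex.

  All of this takes place in coordinates with respect to the states \<open>e\<^sub>j\<close>. These are shown to be a basis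
  by testing them against Gaussians, for independence, and by comparing dimensions with the given
  basis of eigensections (\<open>H_space_spanned\<close>).
\<close>

section \<open>Smooth functions on the torus and their Fourier coefficients\<close>

definition dir_deriv :: "'a::euclidean_space \<Rightarrow> ('a \<Rightarrow> complex) \<Rightarrow> 'a \<Rightarrow> complex" where
  "dir_deriv b f = (\<lambda>x. frechet_derivative f (at x) b)"

lemma dir_deriv_eqI:
  assumes "\<And>x. (f has_derivative D x) (at x)"
  shows "dir_deriv b f = (\<lambda>x. D x b)"
  unfolding dir_deriv_def using frechet_derivative_at[OF assms] by metis

lemma iter_deriv_Cons: "iter_deriv (b # bs) f = dir_deriv b (iter_deriv bs f)"
  by (simp add: dir_deriv_def)

lemma iter_deriv_append: "iter_deriv (bs @ bs') f = iter_deriv bs (iter_deriv bs' f)"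
  by (induction bs) simp_all

lemma iter_deriv_in_closed_set:
  assumes "f \<in> S" "\<And>f b. f \<in> S \<Longrightarrow> b \<in> Basis \<Longrightarrow> dir_deriv b f \<in> S" "set bs \<subseteq> Basis"
  shows "iter_deriv bs f \<in> S"
  using assms(3) by (induction bs) (simp_all only: iter_deriv_Cons iter_deriv.simps(1) set_simps insert_subset assms)

text \<open>
  Smoothness is proved by coinduction: it suffices to exhibit a family of differentiable functions
  that is closed under directional derivatives, and no iterated derivative has to be computed.
\<close>

lemma smooth_fun_coinduct:
  assumes "f \<in> S" "\<And>f x. f \<in> S \<Longrightarrow> f differentiable (at x)"
    "\<And>f b. f \<in> S \<Longrightarrow> b \<in> Basis \<Longrightarrow> dir_deriv b f \<in> S"
  shows "smooth_fun f"
  unfolding smooth_fun_def using iter_deriv_in_closed_set[of f S] assms by blast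

lemma smooth_fun_differentiable: "smooth_fun f \<Longrightarrow> f differentiable (at x)"
  unfolding smooth_fun_def by (metis empty_set empty_subsetI iter_deriv.simps(1))

lemma smooth_fun_has_derivative:
  "smooth_fun f \<Longrightarrow> (f has_derivative frechet_derivative f (at x)) (at x)"
  using smooth_fun_differentiable frechet_derivative_works by blast

lemma smooth_fun_dir_deriv: "smooth_fun f \<Longrightarrow> b \<in> Basis \<Longrightarrow> smooth_fun (dir_deriv b f)"
proof -
  assume f: "smooth_fun f" and b: "b \<in> Basis"
  have e: "dir_deriv b f = iter_deriv [b] f" by (simp add: dir_deriv_def)
  show ?thesis unfolding smooth_fun_def e iter_deriv_append[symmetric]
    using f b unfolding smooth_fun_def by auto
qed

lemma smooth_fun_continuous: "smooth_fun f \<Longrightarrow> continuous_on S f"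
  by (meson continuous_at_imp_continuous_on differentiable_imp_continuous_within smooth_fun_differentiable)

lemma dir_deriv_add:
  "smooth_fun f \<Longrightarrow> smooth_fun g \<Longrightarrow> dir_deriv b (\<lambda>x. f x + g x) = (\<lambda>x. dir_deriv b f x + dir_deriv b g x)"
  by (subst dir_deriv_eqI[OF has_derivative_add[OF smooth_fun_has_derivative smooth_fun_has_derivative]])
     (auto simp: dir_deriv_def)

lemma dir_deriv_cmult:
  fixes f :: "'a::euclidean_space \<Rightarrow> complex"
  assumes "smooth_fun f" shows "dir_deriv b (\<lambda>x. c * f x) = (\<lambda>x. c * dir_deriv b f x)"
  by (subst dir_deriv_eqI[OF has_derivative_mult_right[OF smooth_fun_has_derivative[OF assms]]])
     (auto simp: dir_deriv_def)

lemma smooth_fun_add: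
  fixes f :: "'a::euclidean_space \<Rightarrow> complex"
  assumes "smooth_fun f" "smooth_fun g" shows "smooth_fun (\<lambda>x. f x + g x)"
proof (rule smooth_fun_coinduct[of _ "{\<lambda>x. f x + g x |f g. smooth_fun f \<and> smooth_fun g}"])
  fix h :: "'a \<Rightarrow> complex" and b :: 'a assume "h \<in> {\<lambda>x. f x + g x |f g. smooth_fun f \<and> smooth_fun g}" "b \<in> Basis"
  thus "dir_deriv b h \<in> {\<lambda>x. f x + g x |f g. smooth_fun f \<and> smooth_fun g}"
    using dir_deriv_add smooth_fun_dir_deriv by blast
qed (use assms in \<open>auto intro!: derivative_intros simp: smooth_fun_differentiable\<close>)

lemma smooth_fun_cmult:
  fixes f :: "'a::euclidean_space \<Rightarrow> complex"
  assumes "smooth_fun f" shows "smooth_fun (\<lambda>x. c * f x)"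
proof (rule smooth_fun_coinduct[of _ "{\<lambda>x. c * f x |f. smooth_fun f}"])
  fix h :: "'a \<Rightarrow> complex" and b :: 'a assume "h \<in> {\<lambda>x. c * f x |f. smooth_fun f}" "b \<in> Basis"
  thus "dir_deriv b h \<in> {\<lambda>x. c * f x |f. smooth_fun f}"
    using dir_deriv_cmult smooth_fun_dir_deriv by blast
qed (use assms in \<open>auto intro!: derivative_intros simp: smooth_fun_differentiable\<close>)

lemma cis_linear_has_derivative:
  "((\<lambda>x. cis (c \<bullet> x + s)) has_derivative (\<lambda>h. \<i> * of_real (c \<bullet> h) * cis (c \<bullet> x + s))) (at (x::'a::euclidean_space))"
proof -
  have "((\<lambda>x. cis (c \<bullet> x + s)) has_derivative (\<lambda>h. (c \<bullet> h) *\<^sub>R (\<i> * cis (c \<bullet> x + s)))) (at x)"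
    by (auto intro!: derivative_eq_intros)
  thus ?thesis by (simp add: scaleR_conv_of_real mult_ac)
qed

text \<open>
  The derivative of a modulated function is again a modulated function, with the same modulation.
\<close>

lemma dir_deriv_cis:
  assumes f: "smooth_fun f"
  shows "dir_deriv b (\<lambda>x. cis (c \<bullet> x + s) * f x)
    = (\<lambda>x. cis (c \<bullet> x + s) * (dir_deriv b f x + \<i> * of_real (c \<bullet> b) * f x))"
  by (subst dir_deriv_eqI[OF has_derivative_mult[OF cis_linear_has_derivative smooth_fun_has_derivative[OF f]]])
     (auto simp: dir_deriv_def algebra_simps)

lemma smooth_fun_cis:
  fixes f :: "'a::euclidean_space \<Rightarrow> complex"
  assumes "smooth_fun f" shows "smooth_fun (\<lambda>x. cis (c \<bullet> x + s) * f x)"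
proof (rule smooth_fun_coinduct[of _ "{\<lambda>x. cis (c \<bullet> x + s) * f x |f. smooth_fun f}"])
  fix h :: "'a \<Rightarrow> complex" and b :: 'a assume "h \<in> {\<lambda>x. cis (c \<bullet> x + s) * f x |f. smooth_fun f}" and b: "b \<in> Basis"
  then obtain f where h: "h = (\<lambda>x. cis (c \<bullet> x + s) * f x)" and f: "smooth_fun f" by blast
  have "smooth_fun (\<lambda>x. dir_deriv b f x + \<i> * of_real (c \<bullet> b) * f x)"
    by (intro smooth_fun_add smooth_fun_cmult smooth_fun_dir_deriv f b)
  thus "dir_deriv b h \<in> {\<lambda>x. cis (c \<bullet> x + s) * f x |f. smooth_fun f}"
    unfolding h dir_deriv_cis[OF f] by (auto intro!: exI[of _ "\<lambda>x. dir_deriv b f x + \<i> * of_real (c \<bullet> b) * f x"])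
next
  fix h x assume "h \<in> {\<lambda>x. cis (c \<bullet> x + s) * f x |f. smooth_fun f}"
  then obtain f where "h = (\<lambda>x. cis (c \<bullet> x + s) * f x)" "smooth_fun f" by blast
  thus "h differentiable at x"
    using differentiable_mult[OF differentiableI[OF cis_linear_has_derivative] smooth_fun_differentiable]
    by blast
qed (use assms in blast)

lemma smooth_fun_const: "smooth_fun (\<lambda>x :: 'a::euclidean_space. c)"
proof (rule smooth_fun_coinduct[of _ "range (\<lambda>c x. c)"])
  fix h :: "'a \<Rightarrow> complex" and b :: 'a assume "h \<in> range (\<lambda>c x. c)"
  then obtain c where h: "h = (\<lambda>x. c)" by auto
  show "dir_deriv b h \<in> range (\<lambda>c x. c)"
    unfolding h by (subst dir_deriv_eqI[OF has_derivative_const]) auto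
qed auto

subsection \<open>Integer vectors and characters\<close>

lemma of_int_vec_diff: "of_int_vec (a - b) = of_int_vec a - of_int_vec b"
  and of_int_vec_uminus: "of_int_vec (- a) = - of_int_vec a"
  and of_int_vec_zero [simp]: "of_int_vec 0 = 0"
  by (simp_all add: of_int_vec_def vec_eq_iff)

lemma of_int_vec_nth [simp]: "of_int_vec k $ i = of_int (k $ i)"
  by (simp add: of_int_vec_def)

definition int_dot :: "int ^ 'k \<Rightarrow> int ^ 'k \<Rightarrow> int" where
  "int_dot a b = (\<Sum>i\<in>UNIV. a $ i * b $ i)"

lemma of_int_vec_inner: "of_int_vec a \<bullet> of_int_vec b = of_int (int_dot a b)"
  by (simp add: inner_vec_def int_dot_def)

lemma cis_two_pi_int: "cis (2 * pi * of_int k) = 1"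
  by (metis cis_multiple_2pi Ints_of_int)

definition character :: "int ^ 'k \<Rightarrow> real ^ 'k \<Rightarrow> complex" where
  "character w z = cis (2 * pi * (of_int_vec w \<bullet> z))"

lemma character_periodic: "torus_fun (character w)"
  unfolding torus_fun_def character_def
  by (simp add: inner_add_right of_int_vec_inner ring_distribs cis_two_pi_int flip: cis_mult)

lemma character_as_cis: "character w z = cis ((2 * pi) *\<^sub>R of_int_vec w \<bullet> z + 0) * 1"
  by (simp add: character_def)

lemma smooth_fun_character: "smooth_fun (character w)"
  unfolding character_as_cis[abs_def] by (rule smooth_fun_cis[OF smooth_fun_const])

lemma character_smooth: "character w \<in> torus_smooth"
  by (simp add: torus_smooth_def character_periodic smooth_fun_character)

text \<open>
  The matrix acts on frequencies by its transpose, written here as a product with a row vector.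
\<close>

lemma character_transpose: "character w (mat_act E z) = character (w v* E) z"
proof -
  have "of_int_vec w \<bullet> mat_act E z = of_int_vec (w v* E) \<bullet> z"
    unfolding inner_vec_def mat_act_def of_int_vec_def matrix_vector_mult_def vector_matrix_mult_def
    by (simp add: map_matrix_def sum_distrib_left sum_distrib_right mult_ac)
       (rule sum.swap)
  thus ?thesis by (simp add: character_def)
qed

lemma torus_smooth_char_mult:
  "a \<in> torus_smooth \<Longrightarrow> (\<lambda>z. cis (- 2 * pi * (of_int_vec w \<bullet> z)) * a z) \<in> torus_smooth"
  using smooth_fun_cis[of a "(- 2 * pi) *\<^sub>R of_int_vec w" 0] character_periodic[of "-w"]
  by (auto simp: torus_smooth_def torus_fun_def character_def of_int_vec_uminus)

lemma torus_smooth_add: "a \<in> torus_smooth \<Longrightarrow> a' \<in> torus_smooth \<Longrightarrow> (\<lambda>z. a z + a' z) \<in> torus_smooth"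
  by (simp add: torus_smooth_def torus_fun_def smooth_fun_add)

lemma torus_smooth_cmult: "a \<in> torus_smooth \<Longrightarrow> (\<lambda>z. c * a z) \<in> torus_smooth"
  by (simp add: torus_smooth_def torus_fun_def smooth_fun_cmult)

lemma torus_smooth_dir_deriv:
  assumes a: "a \<in> torus_smooth" and b: "b \<in> Basis"
  shows "dir_deriv b a \<in> torus_smooth"
proof -
  have s: "smooth_fun a" and p: "a (z + of_int_vec k) = a z" for z k
    using a by (auto simp: torus_smooth_def torus_fun_def)
  have "frechet_derivative a (at (z + of_int_vec k)) = frechet_derivative a (at z)" for z k
  proof (rule frechet_derivative_at)
    have "((\<lambda>z. a (z + of_int_vec k)) has_derivative (\<lambda>h. frechet_derivative a (at (z + of_int_vec k)) h)) (at z)"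
      by (rule has_derivative_compose[OF _ smooth_fun_has_derivative[OF s]]) (auto intro!: derivative_eq_intros)
    thus "(a has_derivative frechet_derivative a (at (z + of_int_vec k))) (at z)" by (simp add: p)
  qed
  thus ?thesis using smooth_fun_dir_deriv[OF s b] by (simp add: torus_smooth_def torus_fun_def dir_deriv_def)
qed

lemma sum_Basis_nth [simp]: "(\<Sum>b\<in>(Basis :: (real ^ 'k::finite) set). b $ i) = 1"
proof -
  have "(\<Sum>b\<in>(Basis :: (real ^ 'k) set). b $ i) = (One :: real ^ 'k) \<bullet> axis i 1"
    by (simp add: inner_axis)
  also have "\<dots> = 1" by (rule inner_sum_Basis) (simp add: axis_in_Basis_iff)
  finally show ?thesis .
qed

lemma torus_smooth_bounded:
  assumes a: "a \<in> torus_smooth" shows "\<exists>B. \<forall>z. cmod (a z) \<le> B"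
proof -
  have s: "smooth_fun a" and p: "a (z + of_int_vec k) = a z" for z k
    using a by (auto simp: torus_smooth_def torus_fun_def)
  have "compact (a ` cbox 0 One)"
    by (intro compact_continuous_image smooth_fun_continuous s compact_cbox)
  then obtain B where B: "\<And>z. z \<in> cbox 0 One \<Longrightarrow> cmod (a z) \<le> B"
    using compact_imp_bounded bounded_iff by (metis imageI)
  have "cmod (a z) \<le> B" for z
  proof -
    define k where "k = (\<chi> i. \<lfloor>z $ i\<rfloor>)"
    have "z - of_int_vec k \<in> cbox 0 One"
      by (auto simp: mem_box_cart k_def) linarith
    from B[OF this] show ?thesis using p[of "z - of_int_vec k" k] by simp
  qed
  thus ?thesis by blast
qed

subsection \<open>Integration over the torus\<close>

lemma torus_integral_eq_integral:
  assumes "continuous_on (cbox 0 One) a"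
  shows "torus_integral a = integral (cbox 0 One) a"
  unfolding torus_integral_def
  by (rule set_borel_integral_eq_integral) (simp add: set_integrable_def borel_integrable_compact assms)

lemma mem_cbox_axis:
  fixes x :: "real ^ 'k::finite"
  shows "x \<in> cbox (s *\<^sub>R axis i 1) (One + t *\<^sub>R axis i 1)
    \<longleftrightarrow> s \<le> x $ i \<and> x $ i \<le> 1 + t \<and> (\<forall>j. j \<noteq> i \<longrightarrow> 0 \<le> x $ j \<and> x $ j \<le> 1)"
  by (auto simp: mem_box_cart axis_def) 

text \<open>
  Shift the cube, cut the shifted cube at coordinate \<open>1\<close>, and move the overhanging slab back by one
  period: the two pieces then fill the original cube.
\<close>

lemma integral_translation_invariant:
  fixes a :: "real ^ 'k::finite \<Rightarrow> complex"
  assumes cont: "continuous_on UNIV a" and per: "torus_fun a" and t: "0 \<le> t" "t \<le> 1"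
  shows "integral (cbox 0 One) (\<lambda>z. a (z + t *\<^sub>R axis i 1)) = integral (cbox 0 One) a"
proof -
  let ?e = "axis i 1 :: real ^ 'k"
  have e: "?e \<in> Basis" by (simp add: axis_in_Basis_iff)
  have int: "a integrable_on cbox u v" for u v
    by (rule integrable_continuous) (rule continuous_on_subset[OF cont], simp)
  note C = mem_cbox_axis[of _ 0 i 0, simplified] mem_cbox_axis[of _ 0 i "t - 1", simplified]
    mem_cbox_axis[of _ 1 i t, simplified] mem_cbox_axis[of _ t i t]
  have 1: "cbox (t *\<^sub>R ?e) (One + t *\<^sub>R ?e) \<inter> {x. x \<bullet> ?e \<le> 1} = cbox 0 One \<inter> {x. x \<bullet> ?e \<ge> t}"
    using t by (auto simp: C inner_axis)
  have 2: "cbox (t *\<^sub>R ?e) (One + t *\<^sub>R ?e) \<inter> {x. x \<bullet> ?e \<ge> 1} = cbox (0 + ?e) (One + (t - 1) *\<^sub>R ?e + ?e)"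
    using t by (auto simp: C inner_axis scaleR_left_diff_distrib)
  have 3: "cbox 0 (One + (t - 1) *\<^sub>R ?e) = cbox 0 One \<inter> {x. x \<bullet> ?e \<le> t}"
    using t by (auto simp: C inner_axis)
  have "integral (cbox 0 One) (\<lambda>z. a (z + t *\<^sub>R ?e)) = integral (cbox (t *\<^sub>R ?e) (One + t *\<^sub>R ?e)) a"
    using integral_shift_cbox[of "t *\<^sub>R ?e" "t *\<^sub>R ?e" "One + t *\<^sub>R ?e" a]
    by (simp only: diff_self add_diff_cancel_right')
  also have "\<dots> = integral (cbox (t *\<^sub>R ?e) (One + t *\<^sub>R ?e) \<inter> {x. x \<bullet> ?e \<le> 1}) a
     + integral (cbox (t *\<^sub>R ?e) (One + t *\<^sub>R ?e) \<inter> {x. x \<bullet> ?e \<ge> 1}) a"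
    by (rule integral_split[OF int e])
  also note 1
  also note 2
  also have "integral (cbox (0 + ?e) (One + (t - 1) *\<^sub>R ?e + ?e)) a
     = integral (cbox 0 (One + (t - 1) *\<^sub>R ?e)) (\<lambda>z. a (z + ?e))"
    using integral_shift_cbox[of "0 + ?e" ?e "One + (t - 1) *\<^sub>R ?e + ?e" a]
    by (simp only: diff_self add_diff_cancel_right')
  also have "(\<lambda>z. a (z + ?e)) = a"
  proof -
    have "?e = of_int_vec (axis i 1)" by (simp add: vec_eq_iff axis_def)
    thus ?thesis using per by (simp add: torus_fun_def)
  qed
  also note 3
  also have "integral (cbox 0 One \<inter> {x. x \<bullet> ?e \<ge> t}) a + integral (cbox 0 One \<inter> {x. x \<bullet> ?e \<le> t}) a
    = integral (cbox 0 One) a"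
    using integral_split[OF int e, of 0 One t] by simp
  finally show ?thesis .
qed

text \<open>
  Integrals of translates do not depend on the translation; differentiate this under the integral.
\<close>

lemma torus_integral_dir_deriv:
  fixes a :: "real ^ 'k::finite \<Rightarrow> complex"
  assumes a: "a \<in> torus_smooth"
  shows "torus_integral (dir_deriv (axis i 1) a) = 0"
proof -
  let ?e = "axis i 1 :: real ^ 'k"
  have e: "?e \<in> Basis" by (simp add: axis_in_Basis_iff)
  have s: "smooth_fun a" and p: "torus_fun a" using a by (auto simp: torus_smooth_def)
  note s' = smooth_fun_dir_deriv[OF s e]
  let ?F = "\<lambda>t. integral (cbox 0 One) (\<lambda>z. a (z + t *\<^sub>R ?e))"
  have cc: "continuous_on A (\<lambda>z. a (z + t *\<^sub>R ?e))" for A t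
    by (rule continuous_on_compose2[OF smooth_fun_continuous[OF s, of UNIV]]) (auto intro!: continuous_intros)
  have "(?F has_vector_derivative integral (cbox 0 One) (\<lambda>z. dir_deriv ?e a (z + 0 *\<^sub>R ?e))) (at 0 within {0..1})"
  proof (rule leibniz_rule_vector_derivative)
    fix t z
    have "((\<lambda>t. a (z + t *\<^sub>R ?e)) has_derivative (\<lambda>h. frechet_derivative a (at (z + t *\<^sub>R ?e)) (h *\<^sub>R ?e))) (at t within {0..1})"
      by (rule has_derivative_compose[OF _ smooth_fun_has_derivative[OF s]]) (auto intro!: derivative_eq_intros)
    thus "((\<lambda>t. a (z + t *\<^sub>R ?e)) has_vector_derivative dir_deriv ?e a (z + t *\<^sub>R ?e)) (at t within {0..1})"
      unfolding has_vector_derivative_def dir_deriv_def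
      by (simp add: linear_cmul[OF linear_frechet_derivative[OF smooth_fun_differentiable[OF s]]])
  next
    show "(\<lambda>z. a (z + t *\<^sub>R ?e)) integrable_on cbox 0 One" for t
      by (intro integrable_continuous cc)
    have "continuous_on ({0..1} \<times> cbox 0 One) (\<lambda>x. dir_deriv ?e a (snd x + fst x *\<^sub>R ?e))"
      by (rule continuous_on_compose2[OF smooth_fun_continuous[OF s', of UNIV]]) (auto intro!: continuous_intros)
    thus "continuous_on ({0..1} \<times> cbox 0 One) (\<lambda>(t, z). dir_deriv ?e a (z + t *\<^sub>R ?e))"
      by (simp add: case_prod_beta)
  qed auto
  hence 1: "(?F has_vector_derivative torus_integral (dir_deriv ?e a)) (at 0 within {0..1})"
    by (simp add: torus_integral_eq_integral smooth_fun_continuous[OF s'])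
  have "(?F has_vector_derivative 0) (at 0 within {0..1})"
  proof (rule has_vector_derivative_transform[of _ _ _ "\<lambda>t. integral (cbox 0 One) a"])
    show "?F t = integral (cbox 0 One) a" if "t \<in> {0..1}" for t
      using integral_translation_invariant[OF smooth_fun_continuous[OF s] p] that by simp
  qed auto
  from vector_derivative_unique_within[OF _ 1 this] show ?thesis
    by (simp add: at_within_Icc_at_right)
qed

text \<open>
  Integration by parts: the derivative of the product with the character integrates to zero.
\<close>

lemma fourier_coeff_dir_deriv:
  assumes a: "a \<in> torus_smooth"
  shows "fourier_coeff (dir_deriv (axis i 1) a) w = 2 * pi * \<i> * of_int (w $ i) * fourier_coeff a w"
proof -
  let ?e = "axis i 1 :: real ^ 'a"
  have s: "smooth_fun a" using a by (auto simp: torus_smooth_def)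
  have e: "?e \<in> Basis" by (simp add: axis_in_Basis_iff)
  let ?c = "\<lambda>z. cis (- 2 * pi * (of_int_vec w \<bullet> z))"
  let ?m = "2 * pi * \<i> * of_int (w $ i)"
  have int: "set_integrable lborel (cbox 0 One) (\<lambda>z. ?c z * f z)" if "f \<in> torus_smooth" for f
    using torus_smooth_char_mult[OF that, of w]
    by (auto simp: set_integrable_def torus_smooth_def intro!: borel_integrable_compact smooth_fun_continuous)
  have "dir_deriv ?e (\<lambda>z. ?c z * a z) = (\<lambda>z. ?c z * dir_deriv ?e a z - ?m * (?c z * a z))"
    using dir_deriv_cis[OF s, of ?e "(- 2 * pi) *\<^sub>R of_int_vec w" 0]
    by (simp add: algebra_simps inner_axis fun_eq_iff)
  hence "0 = torus_integral (\<lambda>z. ?c z * dir_deriv ?e a z - ?m * (?c z * a z))"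
    using torus_integral_dir_deriv[OF torus_smooth_char_mult[OF a, of w], of i] by simp
  also have "\<dots> = fourier_coeff (dir_deriv ?e a) w - ?m * fourier_coeff a w"
    unfolding torus_integral_def fourier_coeff_def
    by (subst set_integral_diff(2)[OF int set_integrable_mult_right[OF int]])
       (simp_all only: set_integral_mult_right a torus_smooth_dir_deriv[OF a e])
  finally show ?thesis by simp
qed

text \<open>
  A nontrivial character is a nonzero multiple of one of its own derivatives.
\<close>

lemma torus_integral_character: "torus_integral (character w) = (if w = 0 then 1 else 0)"
proof (cases "w = 0")
  case True
  have "measure lborel (cbox 0 (One::real^'a)) = 1"
    by (simp add: content_cbox_cart)
  thus ?thesis using True
    by (simp add: torus_integral_def character_def set_integral_const)
next
  case False
  then obtain i where i: "w $ i \<noteq> 0" by (auto simp: vec_eq_iff)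
  let ?e = "axis i 1 :: real ^ 'a"
  have "dir_deriv ?e (character w) = (\<lambda>z. (2 * pi * \<i> * of_int (w $ i)) * character w z)"
    unfolding character_as_cis[abs_def] by (subst dir_deriv_cis[OF smooth_fun_const])
      (simp add: dir_deriv_def inner_axis fun_eq_iff)
  hence "0 = torus_integral (\<lambda>z. (2 * pi * \<i> * of_int (w $ i)) * character w z)"
    using torus_integral_dir_deriv[OF character_smooth, of i w] by simp
  also have "\<dots> = (2 * pi * \<i> * of_int (w $ i)) * torus_integral (character w)"
    unfolding torus_integral_def by simp
  finally show ?thesis using i False by simp
qed

lemma fourier_coeff_character: "fourier_coeff (character w) w' = (if w = w' then 1 else 0)"
proof -
  have "(\<lambda>z. cis (- 2 * pi * (of_int_vec w' \<bullet> z)) * character w z) = character (w - w')"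
    by (auto simp: character_def cis_mult of_int_vec_diff inner_diff_left algebra_simps)
  thus ?thesis by (simp add: fourier_coeff_def torus_integral_character)
qed

lemma fourier_coeff_zero: "fourier_coeff a 0 = torus_integral a"
  by (simp add: fourier_coeff_def)

subsection \<open>Summability of Fourier coefficients\<close>

text \<open>
  A finite partial sum is at most the sum over a box that contains its index set, and there the
  sum of products factorizes.
\<close>

lemma summable_on_prod_int_vec:
  fixes g :: "'n::finite \<Rightarrow> int \<Rightarrow> real"
  assumes g: "\<And>i. g i summable_on UNIV" and pos: "\<And>i k. g i k \<ge> 0"
  shows "(\<lambda>w :: int ^ 'n. \<Prod>i\<in>UNIV. g i (w $ i)) summable_on UNIV"
proof (rule nonneg_bdd_above_summable_on)
  show "0 \<le> (\<Prod>i\<in>UNIV. g i (w $ i))" for w by (intro prod_nonneg pos ballI)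
  show "bdd_above (sum (\<lambda>w :: int ^ 'n. \<Prod>i\<in>UNIV. g i (w $ i)) ` {F. F \<subseteq> UNIV \<and> finite F})"
  proof (rule bdd_aboveI2)
    fix F :: "(int ^ 'n) set" assume "F \<in> {F. F \<subseteq> UNIV \<and> finite F}"
    hence F: "finite F" by simp
    let ?B = "\<lambda>i. (\<lambda>w. w $ i) ` F"
    have "sum (\<lambda>w. \<Prod>i\<in>UNIV. g i (w $ i)) F = sum (\<lambda>h. \<Prod>i\<in>UNIV. g i (h i)) (vec_nth ` F)"
      by (subst sum.reindex) (auto simp: inj_on_def vec_nth_inject)
    also have "\<dots> \<le> sum (\<lambda>h. \<Prod>i\<in>UNIV. g i (h i)) (PiE UNIV ?B)"
      by (rule sum_mono2) (auto intro!: finite_PiE F prod_nonneg pos)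
    also have "\<dots> = (\<Prod>i\<in>UNIV. \<Sum>k\<in>?B i. g i k)"
      by (rule prod_sum_PiE[symmetric]) (auto simp: F)
    also have "\<dots> \<le> (\<Prod>i\<in>UNIV. infsum (g i) UNIV)"
      by (intro prod_mono conjI sum_nonneg pos finite_sum_le_infsum g) (auto simp: F pos)
    finally show "sum (\<lambda>w. \<Prod>i\<in>UNIV. g i (w $ i)) F \<le> (\<Prod>i\<in>UNIV. infsum (g i) UNIV)" .
  qed
qed

text \<open>
  The shift \<open>s\<close> is zero for Fourier coefficients and \<open>j / N\<close> for sums over the lattice points
  \<open>(N k + j) / N\<close>.
\<close>

lemma summable_on_int_inverse_square:
  fixes s :: real assumes s: "0 \<le> s" "s \<le> 1"
  shows "(\<lambda>k::int. 1 / (1 + \<bar>of_int k + s\<bar>)\<^sup>2) summable_on UNIV"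
proof -
  have A: "(\<lambda>n::nat. 1 / (1 + real n)\<^sup>2) summable_on UNIV"
  proof (rule summable_nonneg_imp_summable_on)
    have "summable (\<lambda>n. inverse (real (Suc n) ^ 2))"
      by (subst summable_Suc_iff) (rule inverse_power_summable, simp)
    thus "summable (\<lambda>n. 1 / (1 + real n)\<^sup>2)" by (simp add: field_simps)
  qed simp
  have P: "(\<lambda>k::int. 1 / (1 + \<bar>of_int k + s\<bar>)\<^sup>2) summable_on range int"
  proof (subst summable_on_reindex)
    show "(\<lambda>k::int. 1 / (1 + \<bar>of_int k + s\<bar>)\<^sup>2) \<circ> int summable_on UNIV"
      by (rule summable_on_comparison_test[OF A]) (use s in \<open>auto intro!: frac_le power_mono\<close>)
  qed (auto simp: inj_on_def)
  have M: "(\<lambda>k::int. 1 / (1 + \<bar>of_int k + s\<bar>)\<^sup>2) summable_on range (\<lambda>n. - 1 - int n)"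
  proof (subst summable_on_reindex)
    show "(\<lambda>k::int. 1 / (1 + \<bar>of_int k + s\<bar>)\<^sup>2) \<circ> (\<lambda>n. - 1 - int n) summable_on UNIV"
      by (rule summable_on_comparison_test[OF A]) (use s in \<open>auto intro!: frac_le power_mono\<close>)
  qed (auto simp: inj_on_def)
  have "(UNIV :: int set) = range int \<union> range (\<lambda>n. - 1 - int n)"
  proof -
    have "k \<in> range int \<union> range (\<lambda>n. - 1 - int n)" for k :: int
      by (cases k) (auto simp: image_iff algebra_simps)
    thus ?thesis by auto
  qed
  thus ?thesis by (metis summable_on_union[OF P M])
qed

lemma fourier_coeff_add:
  assumes "a \<in> torus_smooth" "a' \<in> torus_smooth"
  shows "fourier_coeff (\<lambda>z. a z + c * a' z) w = fourier_coeff a w + c * fourier_coeff a' w"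
proof -
  let ?c = "\<lambda>z. cis (- 2 * pi * (of_int_vec w \<bullet> z))"
  have int: "set_integrable lborel (cbox 0 One) (\<lambda>z. ?c z * f z)" if "f \<in> torus_smooth" for f
    using torus_smooth_char_mult[OF that, of w]
    by (auto simp: set_integrable_def torus_smooth_def intro!: borel_integrable_compact smooth_fun_continuous)
  have "(\<lambda>z. ?c z * (a z + c * a' z)) = (\<lambda>z. ?c z * a z + c * (?c z * a' z))"
    by (simp add: algebra_simps)
  thus ?thesis unfolding fourier_coeff_def torus_integral_def
    by (simp only:) (subst set_integral_add(2)[OF int set_integrable_mult_right[OF int]],
      simp_all only: set_integral_mult_right assms)
qed

lemma fourier_coeff_bounded:
  assumes a: "a \<in> torus_smooth" shows "\<exists>B. \<forall>w. cmod (fourier_coeff a w) \<le> B"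
proof -
  obtain B where B: "\<And>z. cmod (a z) \<le> B" using torus_smooth_bounded[OF a] by blast
  have "cmod (fourier_coeff a w) \<le> B" for w
  proof -
    let ?f = "\<lambda>z. cis (- 2 * pi * (of_int_vec w \<bullet> z)) * a z"
    have "continuous_on (cbox 0 One) ?f"
      using torus_smooth_char_mult[OF a, of w] by (auto simp: torus_smooth_def intro: smooth_fun_continuous)
    hence "fourier_coeff a w = integral (cbox 0 One) ?f" "?f integrable_on cbox 0 One"
      unfolding fourier_coeff_def by (auto simp: torus_integral_eq_integral intro: integrable_continuous)
    moreover have "norm (integral (cbox 0 One) ?f) \<le> B * measure lborel (cbox 0 (One :: real ^ 'a))"
      by (rule integrable_bound) (use B calculation in \<open>auto simp: norm_mult intro: order_trans[OF norm_ge_zero B]\<close>)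
    ultimately show ?thesis by (simp add: content_cbox_cart)
  qed
  thus ?thesis by blast
qed

text \<open>
  Applying \<open>1 - \<partial>\<^sub>i\<^sup>2\<close> for every coordinate \<open>i\<close> multiplies the coefficient at \<open>w\<close> by the product of the
  \<open>1 + (2 \<pi> w\<^sub>i)\<^sup>2\<close>, and the result is bounded because it is a Fourier coefficient of a smooth function.
  So the coefficients are dominated by a summable product.
\<close>

lemma fourier_coeff_summable:
  assumes a: "a \<in> torus_smooth"
  shows "(\<lambda>w :: int ^ 'k::finite. cmod (fourier_coeff a w)) summable_on UNIV"
proof -
  have "\<exists>a'\<in>torus_smooth. \<forall>w. fourier_coeff a' w = (\<Prod>i\<in>I. 1 + of_real ((2 * pi * of_int (w $ i))\<^sup>2)) * fourier_coeff a w"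
    if "finite I" for I :: "'k set"
    using that
  proof (induction I rule: finite_induct)
    case empty thus ?case using a by auto
  next
    case (insert i I)
    let ?e = "axis i 1 :: real ^ 'k"
    have e: "?e \<in> Basis" by (simp add: axis_in_Basis_iff)
    from insert obtain a' where a': "a' \<in> torus_smooth"
      and F: "\<And>w. fourier_coeff a' w = (\<Prod>i\<in>I. 1 + of_real ((2 * pi * of_int (w $ i))\<^sup>2)) * fourier_coeff a w" by blast
    define a2 where "a2 = dir_deriv ?e (dir_deriv ?e a')"
    have a2: "a2 \<in> torus_smooth" unfolding a2_def by (intro torus_smooth_dir_deriv a' e)
    show ?case
    proof (intro bexI allI)
      fix w
      have "fourier_coeff a2 w = (2 * pi * \<i> * of_int (w $ i)) * (2 * pi * \<i> * of_int (w $ i)) * fourier_coeff a' w"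
        unfolding a2_def by (simp add: fourier_coeff_dir_deriv torus_smooth_dir_deriv a' e)
      also have "(2 * pi * \<i> * of_int (w $ i)) * (2 * pi * \<i> * of_int (w $ i)) = - complex_of_real ((2 * pi * of_int (w $ i))\<^sup>2)"
        by (simp add: power2_eq_square algebra_simps)
      finally have "fourier_coeff (\<lambda>z. a' z + (-1) * a2 z) w
        = (1 + of_real ((2 * pi * of_int (w $ i))\<^sup>2)) * fourier_coeff a' w"
        by (subst fourier_coeff_add[OF a' a2]) (simp add: algebra_simps)
      thus "fourier_coeff (\<lambda>z. a' z + (-1) * a2 z) w = (\<Prod>i\<in>insert i I. 1 + of_real ((2 * pi * of_int (w $ i))\<^sup>2)) * fourier_coeff a w"
        by (simp only: F prod.insert[OF insert.hyps] mult.assoc)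
    qed (intro torus_smooth_add torus_smooth_cmult a' a2)
  qed
  from this[of UNIV] obtain a' where a': "a' \<in> torus_smooth"
    and F: "\<And>w. fourier_coeff a' w = (\<Prod>i\<in>UNIV. 1 + of_real ((2 * pi * of_int (w $ i))\<^sup>2)) * fourier_coeff a w" by auto
  obtain B where B: "\<And>w. cmod (fourier_coeff a' w) \<le> B" using fourier_coeff_bounded[OF a'] by blast
  let ?g = "\<lambda>k::int. 1 / (1 + \<bar>of_int k + 0\<bar>)\<^sup>2 :: real"
  have "(\<lambda>w :: int ^ 'k. \<Prod>i\<in>UNIV. ?g (w $ i)) summable_on UNIV"
    by (rule summable_on_prod_int_vec[OF summable_on_int_inverse_square]) auto
  hence "(\<lambda>w :: int ^ 'k. B * (\<Prod>i\<in>UNIV. ?g (w $ i))) summable_on UNIV"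
    by (rule summable_on_cmult_right)
  thus ?thesis
  proof (rule summable_on_comparison_test)
    fix w :: "int ^ 'k"
    let ?p = "\<Prod>i\<in>UNIV. 1 + (2 * pi * of_int (w $ i))\<^sup>2 :: real"
    have p: "?p > 0" by (intro prod_pos) (auto intro: add_pos_nonneg)
    have "cmod (fourier_coeff a' w) = ?p * cmod (fourier_coeff a w)"
    proof -
      have "(\<Prod>i\<in>UNIV. 1 + of_real ((2 * pi * of_int (w $ i))\<^sup>2) :: complex) = of_real ?p"
        by simp
      thus ?thesis using p by (simp only: F norm_mult norm_of_real abs_of_pos)
    qed
    hence "?p * cmod (fourier_coeff a w) \<le> B" using B[of w] by simp
    hence "cmod (fourier_coeff a w) \<le> B * (1 / ?p)" using p by (simp add: field_simps)
    also have "1 / ?p \<le> (\<Prod>i\<in>UNIV. ?g (w $ i))"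
    proof -
      \<comment> \<open>The absolute value of an integer is at most its square.\<close>
      have "(1 + \<bar>of_int k\<bar>)\<^sup>2 \<le> 1 + (2 * pi * of_int k)\<^sup>2" for k :: int
      proof -
        define x where "x = \<bar>real_of_int k\<bar>"
        have x: "x \<ge> 0" "x = 0 \<or> x \<ge> 1" unfolding x_def by auto
        have "2 * pi \<ge> 2" using pi_ge_two by simp
        hence "(2 * pi)\<^sup>2 \<ge> 2\<^sup>2" by (rule power_mono) simp
        hence "(2 * pi)\<^sup>2 * x\<^sup>2 \<ge> 4 * x\<^sup>2" by (intro mult_right_mono) auto
        moreover have "2 * x \<le> 2 * x\<^sup>2" using x by (auto simp: power2_eq_square)
        moreover from calculation have "(1 + x)\<^sup>2 \<le> 1 + 4 * x\<^sup>2"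
          using zero_le_power2[of x] unfolding power2_sum power_one mult_1_right by linarith
        ultimately have "(1 + x)\<^sup>2 \<le> 1 + (2 * pi)\<^sup>2 * x\<^sup>2" by linarith
        thus ?thesis by (simp add: x_def power_mult_distrib)
      qed
      hence "(\<Prod>i\<in>UNIV. (1 + \<bar>real_of_int (w $ i)\<bar>)\<^sup>2) \<le> ?p"
        by (intro prod_mono) auto
      moreover have "(\<Prod>i\<in>UNIV. (1 + \<bar>real_of_int (w $ i)\<bar>)\<^sup>2) > 0"
        by (intro prod_pos) auto
      ultimately show ?thesis using p by (simp add: prod_dividef frac_le)
    qed
    finally show "cmod (fourier_coeff a w) \<le> B * (\<Prod>i\<in>UNIV. ?g (w $ i))"
      using B[of 0] norm_ge_zero order_trans by (smt (verit) mult_left_mono)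
  qed auto
qed

section \<open>The finite Heisenberg representation in coordinates\<close>

subsection \<open>Residues modulo \<open>N\<close> and character sums\<close>

definition red :: "nat \<Rightarrow> int ^ 'k \<Rightarrow> int ^ 'k" where
  "red N j = (\<chi> i. j $ i mod int N)"

lemma finite_Z_mod [simp, intro]: "finite (Z_mod N :: (int ^ 'n::finite) set)"
  and card_Z_mod: "card (Z_mod N :: (int ^ 'n::finite) set) = N ^ CARD('n)"
proof -
  have e: "(Z_mod N :: (int ^ 'n) set) = vec_lambda ` (PiE UNIV (\<lambda>_. {0..<int N}))"
  proof (intro set_eqI iffI)
    fix j :: "int ^ 'n" assume "j \<in> Z_mod N"
    hence "vec_nth j \<in> PiE UNIV (\<lambda>_. {0..<int N})" by (auto simp: Z_mod_def)
    thus "j \<in> vec_lambda ` (PiE UNIV (\<lambda>_. {0..<int N}))" by (metis image_eqI vec_nth_inverse)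
  qed (auto simp: Z_mod_def PiE_iff)
  show "finite (Z_mod N :: (int ^ 'n::finite) set)"
    unfolding e by (intro finite_imageI finite_PiE) auto
  have "inj_on (vec_lambda :: _ \<Rightarrow> int ^ 'n) A" for A by (auto simp: inj_on_def vec_lambda_inject)
  thus "card (Z_mod N :: (int ^ 'n::finite) set) = N ^ CARD('n)"
    unfolding e by (subst card_image) (simp_all add: card_PiE)
qed

lemma red_in_Z_mod [simp]: "N > 0 \<Longrightarrow> red N j \<in> Z_mod N"
  by (simp add: red_def Z_mod_def)

lemma red_id: "j \<in> Z_mod N \<Longrightarrow> red N j = j"
  by (simp add: red_def Z_mod_def vec_eq_iff)

lemma red_add_left [simp]: "red N (red N j + k) = red N (j + k)"
  and red_diff_left [simp]: "red N (red N j - k) = red N (j - k)"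
  by (simp_all add: red_def vec_eq_iff mod_add_left_eq mod_diff_left_eq)

lemma red_eq_iff: "red N j = red N k \<longleftrightarrow> red N (j - k) = 0"
  by (simp add: red_def vec_eq_iff mod_eq_dvd_iff dvd_eq_mod_eq_0)

lemma red_decompose: "\<exists>k. j = red N j + (\<chi> i. int N * k i)"
  by (rule exI[of _ "\<lambda>i. j $ i div int N"]) (simp add: red_def vec_eq_iff)

lemma bij_betw_red_add:
  assumes "N > 0" shows "bij_betw (\<lambda>j. red N (j + k)) (Z_mod N) (Z_mod N)"
  by (rule bij_betw_byWitness[of _ "\<lambda>j. red N (j - k)"]) (auto simp: assms red_id)

lemma bij_betw_red_diff:
  assumes "N > 0" shows "bij_betw (\<lambda>j. red N (j - k)) (Z_mod N) (Z_mod N)"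
  by (rule bij_betw_byWitness[of _ "\<lambda>j. red N (j + k)"]) (auto simp: assms red_id)

lemma int_dot_add_left: "int_dot (a + b) c = int_dot a c + int_dot b c"
  and int_dot_add_right: "int_dot c (a + b) = int_dot c a + int_dot c b"
  and int_dot_diff_left: "int_dot (a - b) c = int_dot a c - int_dot b c"
  and int_dot_diff_right: "int_dot c (a - b) = int_dot c a - int_dot c b"
  by (simp_all add: int_dot_def algebra_simps sum.distrib sum_subtractf)

lemma int_dot_axis [simp]: "int_dot a (axis i 1) = a $ i"
  unfolding int_dot_def axis_def by (simp add: if_distrib cong: if_cong)

lemma int_dot_zero [simp]: "int_dot 0 a = 0" "int_dot a 0 = 0"
  by (simp_all add: int_dot_def)

lemma cis_add_2pi_int: "cis (x + 2 * pi * of_int k) = cis x"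
  by (simp add: cis_two_pi_int flip: cis_mult)

text \<open>
  The additive character of \<open>(\<int> / N)\<^sup>k\<close> with frequency \<open>y\<close>, evaluated at \<open>j\<close>.
\<close>

definition phase :: "nat \<Rightarrow> int ^ 'k \<Rightarrow> int ^ 'k \<Rightarrow> complex" where
  "phase N y j = cis (2 * pi / real N * of_int (int_dot y j))"

lemma phase_red:
  assumes "N > 0" shows "phase N y (red N j) = phase N y j"
proof -
  obtain k where k: "j = red N j + (\<chi> i. int N * k i)" using red_decompose by blast
  have "int_dot y j = int_dot y (red N j) + int N * (\<Sum>i\<in>UNIV. y $ i * k i)"
    by (subst k) (simp add: int_dot_add_right, simp add: int_dot_def sum_distrib_left mult_ac)
  hence "2 * pi / real N * of_int (int_dot y j)
    = 2 * pi / real N * of_int (int_dot y (red N j)) + 2 * pi * of_int (\<Sum>i\<in>UNIV. y $ i * k i)"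
    using assms by (simp add: field_simps)
  thus ?thesis unfolding phase_def by (simp only: cis_add_2pi_int)
qed

lemma phase_add: "phase N y (j + k) = phase N y j * phase N y k"
  by (simp add: phase_def int_dot_add_right ring_distribs cis_mult)

lemma cis_two_pi_frac_eq_1:
  assumes "N > 0" "cis (2 * pi / real N * of_int a) = 1" shows "int N dvd a"
proof -
  have "cos (2 * pi / real N * of_int a) = 1" using assms(2) by (metis Re_complex_of_real cis.sel(1) of_real_1)
  then obtain m :: int where "2 * pi / real N * of_int a = of_int m * 2 * pi"
    using cos_one_2pi_int by blast
  hence "real_of_int a = of_int (m * int N)" using assms(1) by (simp add: field_simps)
  hence "a = m * int N" by (simp only: of_int_eq_iff)
  thus ?thesis by simp
qed

text \<open>
  Translating \<open>j\<close> by a unit vector permutes the summands modulo \<open>N\<close> and multiplies the sum by a root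
  of unity, which is not \<open>1\<close> for a suitable unit vector.
\<close>

lemma phase_sum_zero:
  fixes y :: "int ^ 'n::finite"
  assumes N: "N > 0" and y: "red N y \<noteq> 0"
  shows "(\<Sum>j\<in>Z_mod N. phase N y j) = 0"
proof -
  obtain i where i: "\<not> int N dvd y $ i" using y by (auto simp: red_def vec_eq_iff dvd_eq_mod_eq_0)
  let ?e = "axis i 1 :: int ^ 'n"
  have "(\<Sum>j\<in>Z_mod N. phase N y j) = (\<Sum>j\<in>Z_mod N. phase N y (red N (j + ?e)))"
    by (rule sum.reindex_bij_betw[OF bij_betw_red_add[OF N], symmetric])
  also have "\<dots> = (\<Sum>j\<in>Z_mod N. phase N y j) * phase N y ?e"
    by (simp add: phase_red[OF N] phase_add sum_distrib_right)
  finally have "(1 - phase N y ?e) * (\<Sum>j\<in>Z_mod N. phase N y j) = 0" by (simp add: algebra_simps)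
  moreover have "phase N y ?e \<noteq> 1"
    using cis_two_pi_frac_eq_1[OF N, of "y $ i"] i by (auto simp: phase_def)
  ultimately show ?thesis by simp
qed

subsection \<open>Coordinate vectors, isometries and the Hilbert-Schmidt product\<close>

text \<open>
  A coordinate vector is extended by zero from the representatives modulo \<open>N\<close> to all integer vectors,
  so that equality of vectors is equality of functions and the type does not depend on \<open>N\<close>.
\<close>

definition coords :: "nat \<Rightarrow> (int ^ 'n::finite \<Rightarrow> complex) set" where
  "coords N = {c. \<forall>j. j \<notin> Z_mod N \<longrightarrow> c j = 0}"

definition cinner :: "nat \<Rightarrow> (int ^ 'n::finite \<Rightarrow> complex) \<Rightarrow> (int ^ 'n \<Rightarrow> complex) \<Rightarrow> complex" where
  "cinner N c c' = (\<Sum>j\<in>Z_mod N. c j * cnj (c' j))"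

definition delta :: "'a \<Rightarrow> 'a \<Rightarrow> complex" where
  "delta k = (\<lambda>j. if j = k then 1 else 0)"

type_synonym 'n cop = "(int ^ 'n \<Rightarrow> complex) \<Rightarrow> (int ^ 'n \<Rightarrow> complex)"

definition isometric_op :: "nat \<Rightarrow> 'n::finite cop \<Rightarrow> bool" where
  "isometric_op N A \<longleftrightarrow> (\<forall>c\<in>coords N. A c \<in> coords N) \<and>
     (\<forall>c\<in>coords N. \<forall>c'\<in>coords N. A (\<lambda>j. c j + c' j) = (\<lambda>j. A c j + A c' j)) \<and>
     (\<forall>z. \<forall>c\<in>coords N. A (\<lambda>j. z * c j) = (\<lambda>j. z * A c j)) \<and>
     (\<forall>c\<in>coords N. \<forall>c'\<in>coords N. cinner N (A c) (A c') = cinner N c c')"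

definition hs :: "nat \<Rightarrow> 'n::finite cop \<Rightarrow> 'n cop \<Rightarrow> complex" where
  "hs N A B = (\<Sum>k\<in>Z_mod N. cinner N (A (delta k)) (B (delta k)))"

lemma isometric_opD:
  assumes "isometric_op N A"
  shows "c \<in> coords N \<Longrightarrow> A c \<in> coords N"
    "c \<in> coords N \<Longrightarrow> c' \<in> coords N \<Longrightarrow> A (\<lambda>j. c j + c' j) = (\<lambda>j. A c j + A c' j)"
    "c \<in> coords N \<Longrightarrow> A (\<lambda>j. z * c j) = (\<lambda>j. z * A c j)"
    "c \<in> coords N \<Longrightarrow> c' \<in> coords N \<Longrightarrow> cinner N (A c) (A c') = cinner N c c'"
  using assms unfolding isometric_op_def by blast+

lemma coords_add: "c \<in> coords N \<Longrightarrow> c' \<in> coords N \<Longrightarrow> (\<lambda>j. c j + c' j) \<in> coords N"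
  and coords_cmult: "c \<in> coords N \<Longrightarrow> (\<lambda>j. y * c j) \<in> coords N"
  and coords_sum: "(\<And>s. s \<in> S \<Longrightarrow> f s \<in> coords N) \<Longrightarrow> (\<lambda>j. \<Sum>s\<in>S. z s * f s j) \<in> coords N"
  and coords_zero: "(\<lambda>j. 0) \<in> coords N"
  by (auto simp: coords_def)

lemma delta_coords [simp]: "k \<in> Z_mod N \<Longrightarrow> delta k \<in> coords N"
  by (auto simp: coords_def delta_def)

lemma isometric_op_comp: "isometric_op N A \<Longrightarrow> isometric_op N B \<Longrightarrow> isometric_op N (A \<circ> B)"
  unfolding isometric_op_def by (simp add: o_def)

lemma isometric_op_id: "isometric_op N id"
  by (simp add: isometric_op_def)

lemma isometric_op_sum:
  assumes A: "isometric_op N A" and "finite S" and f: "\<And>s. s \<in> S \<Longrightarrow> f s \<in> coords N"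
  shows "A (\<lambda>j. \<Sum>s\<in>S. z s * f s j) = (\<lambda>j. \<Sum>s\<in>S. z s * A (f s) j)"
  using assms(2) f
proof (induction S rule: finite_induct)
  case empty
  show ?case using isometric_opD(3)[OF A coords_zero, of 0] by simp
next
  case (insert s S)
  have "A (\<lambda>j. \<Sum>s\<in>insert s S. z s * f s j) = A (\<lambda>j. z s * f s j + (\<Sum>s\<in>S. z s * f s j))"
    using insert by simp
  also have "\<dots> = (\<lambda>j. A (\<lambda>j. z s * f s j) j + A (\<lambda>j. \<Sum>s\<in>S. z s * f s j) j)"
    by (rule isometric_opD(2)[OF A]) (auto intro!: coords_cmult coords_sum insert)
  finally show ?case using insert isometric_opD(3)[OF A] by simp
qed

lemma coords_expand: "c \<in> coords N \<Longrightarrow> c = (\<lambda>j. \<Sum>k\<in>Z_mod N. c k * delta k j)"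
  by (auto simp: fun_eq_iff delta_def coords_def if_distrib[of "(*) _"] cong: if_cong)

lemma isometric_op_expand:
  assumes "isometric_op N A" "c \<in> coords N"
  shows "A c = (\<lambda>j. \<Sum>k\<in>Z_mod N. c k * A (delta k) j)"
proof -
  have "A c = A (\<lambda>j. \<Sum>k\<in>Z_mod N. c k * delta k j)"
    by (rule arg_cong[where f = A]) (rule coords_expand[OF assms(2)])
  thus ?thesis by (simp add: isometric_op_sum[OF assms(1)])
qed

lemma cinner_cmult_left: "cinner N (\<lambda>j. z * c j) c' = z * cinner N c c'"
  and cinner_cmult_right: "cinner N c (\<lambda>j. z * c' j) = cnj z * cinner N c c'"
  and cinner_sum_left: "cinner N (\<lambda>j. \<Sum>s\<in>S. f s j) c' = (\<Sum>s\<in>S. cinner N (f s) c')"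
  and cinner_sum_right: "cinner N c' (\<lambda>j. \<Sum>s\<in>S. f s j) = (\<Sum>s\<in>S. cinner N c' (f s))"
  unfolding cinner_def
  by (simp_all add: sum_distrib_left sum_distrib_right sum.distrib algebra_simps)
     (rule sum.swap)+

lemma cinner_self: "cinner N c c = of_real (\<Sum>j\<in>Z_mod N. (cmod (c j))\<^sup>2)"
  unfolding cinner_def by (simp only: of_real_sum complex_norm_square)

lemma cinner_delta: "k \<in> Z_mod N \<Longrightarrow> cinner N (delta k) (delta l) = (if k = l then 1 else 0)"
proof -
  assume k: "k \<in> Z_mod N"
  have "delta k j * cnj (delta l j) = (if j = k then (if k = l then 1 else 0) else 0)" for j
    by (auto simp: delta_def)
  thus ?thesis using k by (simp add: cinner_def)
qed

lemma hs_self: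
  assumes "isometric_op N (A :: 'n::finite cop)"
  shows "hs N A A = of_nat (N ^ CARD('n))"
  unfolding hs_def using assms
  by (simp add: isometric_opD(4) cinner_delta card_Z_mod)

lemma cinner_bound:
  assumes "isometric_op N A" "c \<in> coords N"
  shows "cmod (cinner N (A c) c) \<le> Re (cinner N c c)"
proof -
  have "cmod (cinner N (A c) c) \<le> (\<Sum>j\<in>Z_mod N. cmod (A c j) * cmod (c j))"
    unfolding cinner_def by (rule order_trans[OF norm_sum]) (simp add: norm_mult)
  also have "\<dots> \<le> (\<Sum>j\<in>Z_mod N. ((cmod (A c j))\<^sup>2 + (cmod (c j))\<^sup>2) / 2)"
  proof (rule sum_mono)
    fix j show "cmod (A c j) * cmod (c j) \<le> ((cmod (A c j))\<^sup>2 + (cmod (c j))\<^sup>2) / 2"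
      using sum_squares_bound[of "cmod (A c j)" "cmod (c j)"] by simp
  qed
  also have "\<dots> = (Re (cinner N (A c) (A c)) + Re (cinner N c c)) / 2"
    by (simp add: cinner_self sum.distrib flip: sum_divide_distrib)
  also have "\<dots> = Re (cinner N c c)" using isometric_opD(4)[OF assms(1,2,2)] by simp
  finally show ?thesis .
qed

subsection \<open>Weyl translations\<close>

text \<open>
  The operator \<open>U\<^bsub>w/N\<^esub>\<close> in the basis \<open>e\<^sub>j\<close>, where the index \<open>j + \<eta>\<close> is reduced modulo \<open>N\<close>.
\<close>

definition weyl :: "nat \<Rightarrow> int ^ ('n::finite + 'n) \<Rightarrow> 'n cop" where
  "weyl N w c = (\<lambda>j. if j \<in> Z_mod N
     then phase N (fst_half w) j * cis (pi / real N * of_int (int_dot (fst_half w) (snd_half w)))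
            * c (red N (j + snd_half w))
     else 0)"

lemma half_add: "fst_half (a + b) = fst_half a + fst_half b" "snd_half (a + b) = snd_half a + snd_half b"
  and half_zero: "fst_half 0 = 0" "snd_half 0 = 0"
  by (simp_all add: fst_half_def snd_half_def vec_eq_iff)

lemma weyl_coords [simp]: "weyl N w c \<in> coords N"
  by (simp add: weyl_def coords_def)

lemma norm_phase [simp]: "cmod (phase N y j) = 1"
  by (simp add: phase_def)

lemma weyl_isometric:
  assumes N: "N > 0" shows "isometric_op N (weyl N w)"
  unfolding isometric_op_def
proof (intro conjI ballI allI)
  fix c c' :: "int ^ 'a \<Rightarrow> complex"
  let ?y = "fst_half w" and ?\<eta> = "snd_half w"
  have u: "phase N ?y j * cnj (phase N ?y j) = 1" for j
    by (simp add: complex_norm_square[symmetric])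
  have "cinner N (weyl N w c) (weyl N w c') = (\<Sum>j\<in>Z_mod N. c (red N (j + ?\<eta>)) * cnj (c' (red N (j + ?\<eta>))))"
    unfolding cinner_def
  proof (rule sum.cong)
    fix j :: "int ^ 'a" assume j: "j \<in> Z_mod N"
    let ?z = "phase N ?y j * cis (pi / real N * of_int (int_dot ?y ?\<eta>))"
    have "?z * cnj ?z = of_real ((cmod ?z)\<^sup>2)" by (simp only: complex_norm_square)
    hence "?z * cnj ?z = 1" by (simp add: norm_mult)
    thus "weyl N w c j * cnj (weyl N w c' j) = c (red N (j + ?\<eta>)) * cnj (c' (red N (j + ?\<eta>)))"
      using j by (simp add: weyl_def) (metis (no_types, lifting) mult.assoc mult.left_commute mult_1)
  qed simp
  also have "\<dots> = cinner N c c'"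
    unfolding cinner_def by (rule sum.reindex_bij_betw[OF bij_betw_red_add[OF N]])
  finally show "cinner N (weyl N w c) (weyl N w c') = cinner N c c'" .
qed (auto simp: weyl_def coords_def algebra_simps)

text \<open>
  Weyl translations form a projective representation; below only the modulus of the cocycle matters.
\<close>

lemma weyl_mult:
  assumes N: "N > 0"
  shows "\<exists>z. cmod z = 1 \<and> (\<forall>c. weyl N w (weyl N w' c) = (\<lambda>j. z * weyl N (w + w') c j))"
proof -
  let ?y = "fst_half w" and ?\<eta> = "snd_half w" and ?y' = "fst_half w'" and ?\<eta>' = "snd_half w'"
  let ?s = "\<lambda>a b. cis (pi / real N * of_int (int_dot a b))"
  define z where "z = ?s ?y ?\<eta> * phase N ?y' ?\<eta> * ?s ?y' ?\<eta>' * cnj (?s (?y + ?y') (?\<eta> + ?\<eta>'))"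
  have z1: "cnj (?s (?y + ?y') (?\<eta> + ?\<eta>')) * ?s (?y + ?y') (?\<eta> + ?\<eta>') = 1"
    by (simp add: cis_mult cis_cnj)
  have zz: "z * ?s (?y + ?y') (?\<eta> + ?\<eta>') = ?s ?y ?\<eta> * phase N ?y' ?\<eta> * ?s ?y' ?\<eta>'"
    unfolding z_def by (simp only: mult.assoc z1 mult_1_right)
  have "weyl N w (weyl N w' c) j = z * weyl N (w + w') c j" for c j
  proof (cases "j \<in> Z_mod N")
    case True
    have p: "phase N (?y + ?y') j = phase N ?y j * phase N ?y' j"
      by (simp add: phase_def int_dot_add_left ring_distribs cis_mult)
    have "weyl N w (weyl N w' c) j = phase N ?y j * ?s ?y ?\<eta> * (phase N ?y' (j + ?\<eta>) * ?s ?y' ?\<eta>' * c (red N (j + ?\<eta> + ?\<eta>')))"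
      using True N by (simp add: weyl_def phase_red)
    also have "\<dots> = phase N (?y + ?y') j * (?s ?y ?\<eta> * phase N ?y' ?\<eta> * ?s ?y' ?\<eta>') * c (red N (j + (?\<eta> + ?\<eta>')))"
      by (simp only: p phase_add mult_ac add.assoc)
    also have "\<dots> = phase N (?y + ?y') j * (z * ?s (?y + ?y') (?\<eta> + ?\<eta>')) * c (red N (j + (?\<eta> + ?\<eta>')))"
      by (simp only: zz)
    also have "\<dots> = z * weyl N (w + w') c j"
      using True by (simp add: weyl_def half_add)
    finally show ?thesis .
  qed (simp add: weyl_def)
  moreover have "cmod z = 1" by (simp add: z_def norm_mult)
  ultimately show ?thesis by blast
qed

lemma weyl_zero: "c \<in> coords N \<Longrightarrow> weyl N 0 c = c"
  by (auto simp: weyl_def half_zero phase_def fun_eq_iff red_id coords_def)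

lemma weyl_delta:
  assumes N: "N > 0" and k: "k \<in> Z_mod N"
  shows "weyl N w (delta k) = (\<lambda>j. (phase N (fst_half w) k * cis (- pi / real N * of_int (int_dot (fst_half w) (snd_half w))))
           * delta (red N (k - snd_half w)) j)"
proof
  fix j
  let ?y = "fst_half w" and ?\<eta> = "snd_half w"
  show "weyl N w (delta k) j = (phase N ?y k * cis (- pi / real N * of_int (int_dot ?y ?\<eta>))) * delta (red N (k - ?\<eta>)) j"
  proof (cases "j = red N (k - ?\<eta>)")
    case True
    have "phase N ?y j * cis (pi / real N * of_int (int_dot ?y ?\<eta>))
      = phase N ?y k * cis (- pi / real N * of_int (int_dot ?y ?\<eta>))"
      using N by (simp add: True phase_red) (simp add: phase_def cis_mult int_dot_diff_right algebra_simps diff_divide_distrib)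
    thus ?thesis using True N k by (simp add: weyl_def delta_def red_id)
  next
    case False
    hence "\<not> (j \<in> Z_mod N \<and> red N (j + ?\<eta>) = k)" by (auto simp: red_id)
    thus ?thesis using False by (auto simp: weyl_def delta_def)
  qed
qed

text \<open>
  A Weyl translation permutes the basis vectors up to phases, so the Hilbert-Schmidt product, a sum
  over the basis, does not change.
\<close>

lemma hs_weyl_right:
  fixes A B :: "'n::finite cop"
  assumes N: "N > 0" and A: "isometric_op N A" and B: "isometric_op N B"
  shows "hs N (A \<circ> weyl N w) (B \<circ> weyl N w) = hs N A B"
proof -
  have "hs N (A \<circ> weyl N w) (B \<circ> weyl N w)
    = (\<Sum>k\<in>Z_mod N. cinner N (A (delta (red N (k - snd_half w)))) (B (delta (red N (k - snd_half w)))))"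
    unfolding hs_def o_def
  proof (rule sum.cong)
    fix k :: "int ^ 'n" assume k: "k \<in> Z_mod N"
    let ?z = "phase N (fst_half w) k * cis (- pi / real N * of_int (int_dot (fst_half w) (snd_half w)))"
    have "?z * cnj ?z = of_real ((cmod ?z)\<^sup>2)" by (simp only: complex_norm_square)
    hence z: "?z * cnj ?z = 1" by (simp add: norm_mult)
    let ?d = "delta (red N (k - snd_half w))"
    have d: "?d \<in> coords N" using N by simp
    have "cinner N (A (weyl N w (delta k))) (B (weyl N w (delta k))) = (?z * cnj ?z) * cinner N (A ?d) (B ?d)"
      unfolding weyl_delta[OF N k] isometric_opD(3)[OF A d] isometric_opD(3)[OF B d] cinner_cmult_left cinner_cmult_right
      by (simp only: mult_ac)
    thus "cinner N (A (weyl N w (delta k))) (B (weyl N w (delta k))) = cinner N (A ?d) (B ?d)"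
      by (simp only: z mult_1)
  qed simp
  also have "\<dots> = hs N A B" unfolding hs_def
    by (rule sum.reindex_bij_betw[OF bij_betw_red_diff[OF N]])
  finally show ?thesis .
qed

text \<open>
  If the positions differ modulo \<open>N\<close>, every basis vector is moved to two orthogonal ones; if only the
  momenta differ, the sum over the basis is a vanishing character sum.
\<close>

lemma hs_weyl_orthogonal:
  fixes w w' :: "int ^ ('n::finite + 'n)"
  assumes N: "N > 0" and w: "red N (w - w') \<noteq> 0"
  shows "hs N (weyl N w) (weyl N w') = 0"
proof -
  let ?y = "fst_half w" and ?\<eta> = "snd_half w" and ?y' = "fst_half w'" and ?\<eta>' = "snd_half w'"
  let ?s = "\<lambda>a b. cis (- pi / real N * of_int (int_dot a b))"
  have t: "cinner N (weyl N w (delta k)) (weyl N w' (delta k))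
    = (if red N (?\<eta> - ?\<eta>') = 0 then (?s ?y ?\<eta> * cnj (?s ?y' ?\<eta>')) * phase N (?y - ?y') k else 0)"
    if k: "k \<in> Z_mod N" for k
  proof -
    have e: "red N (k - ?\<eta>) = red N (k - ?\<eta>') \<longleftrightarrow> red N (?\<eta> - ?\<eta>') = 0"
      by (subst red_eq_iff, subst red_eq_iff[of N "?\<eta>" "?\<eta>'", symmetric], subst eq_commute, subst red_eq_iff) simp
    have p: "phase N (?y - ?y') k = phase N ?y k * cnj (phase N ?y' k)"
      by (simp add: phase_def int_dot_diff_left cis_mult cis_cnj algebra_simps)
    show ?thesis
      unfolding weyl_delta[OF N k] cinner_cmult_left cinner_cmult_right cinner_delta[OF red_in_Z_mod[OF N]] e p
      by simp
  qed
  show ?thesis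
  proof (cases "red N (?\<eta> - ?\<eta>') = 0")
    case True
    have "red N (?y - ?y') \<noteq> 0"
    proof
      assume "red N (?y - ?y') = 0"
      have "red N (w - w') $ x = 0" for x
        using True \<open>red N (?y - ?y') = 0\<close>
        by (cases x) (auto simp: red_def fst_half_def snd_half_def vec_eq_iff)
      thus False using w by (simp add: vec_eq_iff)
    qed
    thus ?thesis unfolding hs_def
      by (simp add: t True phase_sum_zero[OF N] flip: sum_distrib_left)
  qed (simp add: hs_def t)
qed

subsection \<open>Operators that move Weyl translations along an integer matrix\<close>

text \<open>
  The exact Egorov property of a quantum cat map, up to phases. The phases make the property stable
  under multiplication of \<open>A\<close> by Weyl translations.
\<close>

definition intertwines :: "nat \<Rightarrow> 'n::finite cop \<Rightarrow> int ^ ('n + 'n) ^ ('n + 'n) \<Rightarrow> bool" where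
  "intertwines N A E \<longleftrightarrow> (\<forall>s. \<exists>z. cmod z = 1 \<and>
     (\<forall>c\<in>coords N. weyl N s (A c) = (\<lambda>j. z * A (weyl N (s v* E) c) j)))"

lemma sum_Cauchy_Schwarz_complex:
  fixes x y :: "'a \<Rightarrow> complex"
  shows "(cmod (\<Sum>s\<in>S. x s * cnj (y s)))\<^sup>2 \<le> (\<Sum>s\<in>S. (cmod (x s))\<^sup>2) * (\<Sum>s\<in>S. (cmod (y s))\<^sup>2)"
proof -
  have "cmod (\<Sum>s\<in>S. x s * cnj (y s)) \<le> (\<Sum>s\<in>S. cmod (x s) * cmod (y s))"
    by (rule order_trans[OF norm_sum]) (simp add: norm_mult)
  hence "(cmod (\<Sum>s\<in>S. x s * cnj (y s)))\<^sup>2 \<le> (\<Sum>s\<in>S. cmod (x s) * cmod (y s))\<^sup>2"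
    by (rule power_mono) simp
  also have "\<dots> \<le> (\<Sum>s\<in>S. (cmod (x s))\<^sup>2) * (\<Sum>s\<in>S. (cmod (y s))\<^sup>2)"
    by (rule Cauchy_Schwarz_ineq_sum)
  finally show ?thesis .
qed

text \<open>
  Multiplying \<open>A\<close> and \<open>A'\<close> on the left by the same isometry leaves the product alone. Moving the Weyl
  translation by \<open>s\<close> through \<open>A\<close> and through \<open>A'\<close> produces two different translations on the right,
  whose quotient remains.
\<close>

lemma hs_intertwined_shift:
  fixes A A' :: "'n::finite cop"
  assumes N: "N > 0" and A: "isometric_op N A" and A': "isometric_op N A'"
    and E: "intertwines N A E" and E': "intertwines N A' E'"
  shows "\<exists>z. cmod z = 1 \<and> hs N A A' = z * hs N (A \<circ> weyl N (s v* E - s v* E')) A'"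
proof -
  let ?a = "s v* E" and ?a' = "s v* E'"
  obtain z where z: "cmod z = 1" "\<And>c. c \<in> coords N \<Longrightarrow> weyl N s (A c) = (\<lambda>j. z * A (weyl N ?a c) j)"
    using E unfolding intertwines_def by blast
  obtain z' where z': "cmod z' = 1" "\<And>c. c \<in> coords N \<Longrightarrow> weyl N s (A' c) = (\<lambda>j. z' * A' (weyl N ?a' c) j)"
    using E' unfolding intertwines_def by blast
  obtain p where p: "cmod p = 1" "\<And>c. weyl N ?a (weyl N (- ?a') c) = (\<lambda>j. p * weyl N (?a - ?a') c j)"
    using weyl_mult[OF N, of ?a "- ?a'"] by auto
  obtain p' where p': "cmod p' = 1" "\<And>c. weyl N ?a' (weyl N (- ?a') c) = (\<lambda>j. p' * weyl N 0 c j)"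
    using weyl_mult[OF N, of ?a' "- ?a'"] by auto
  note W = weyl_isometric[OF N]
  have "hs N A A' = (\<Sum>k\<in>Z_mod N. cinner N (weyl N s (A (delta k))) (weyl N s (A' (delta k))))"
    unfolding hs_def
    by (intro sum.cong refl isometric_opD(4)[OF W, symmetric] isometric_opD(1)[OF A] isometric_opD(1)[OF A'] delta_coords)
  also have "\<dots> = z * cnj z' * hs N (A \<circ> weyl N ?a) (A' \<circ> weyl N ?a')"
    unfolding hs_def by (simp add: z z' cinner_cmult_left cinner_cmult_right sum_distrib_left mult_ac)
  also have "hs N (A \<circ> weyl N ?a) (A' \<circ> weyl N ?a')
    = hs N ((A \<circ> weyl N ?a) \<circ> weyl N (- ?a')) ((A' \<circ> weyl N ?a') \<circ> weyl N (- ?a'))"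
    by (intro hs_weyl_right[symmetric] N isometric_op_comp A A' W)
  also have "\<dots> = p * cnj p' * hs N (A \<circ> weyl N (?a - ?a')) A'"
    unfolding hs_def
    by (simp add: p p' weyl_zero isometric_opD(3)[OF A] isometric_opD(3)[OF A'] cinner_cmult_left
        cinner_cmult_right sum_distrib_left mult_ac)
  finally have "hs N A A' = (z * cnj z' * (p * cnj p')) * hs N (A \<circ> weyl N (?a - ?a')) A'" by (simp add: mult_ac)
  moreover have "cmod (z * cnj z' * (p * cnj p')) = 1" by (simp add: norm_mult z z' p p')
  ultimately show ?thesis by blast
qed

text \<open>
  The identity \<open>hs_intertwined_shift\<close> for \<open>s = t v\<close>, \<open>t < L\<close>, exhibits the product of \<open>A\<close> and \<open>A'\<close> as an
  average of products of \<open>A \<circ> weyl N (t w)\<close> with \<open>A'\<close>. These Weyl translations are pairwise orthogonal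
  for large \<open>N\<close>, so their average has Hilbert-Schmidt norm smaller by a factor \<open>sqrt L\<close>, and the
  Cauchy-Schwarz inequality gives the bound.
\<close>

lemma hs_small:
  fixes A A' :: "'n::finite cop"
  assumes N: "N > 0" and A: "isometric_op N A" and A': "isometric_op N A'"
    and E: "intertwines N A E" and E': "intertwines N A' E'"
    and w: "v v* E - v v* E' \<noteq> 0"
    and L: "L > 0" and big: "\<And>i. int L * \<bar>(v v* E - v v* E') $ i\<bar> < int N"
  shows "real L * (cmod (hs N A A'))\<^sup>2 \<le> (real N ^ CARD('n))\<^sup>2"
proof -
  define w where "w = v v* E - v v* E'"
  let ?tw = "\<lambda>t::nat. int t *s w"
  have "\<exists>z. cmod z = 1 \<and> hs N A A' = z * hs N (A \<circ> weyl N (?tw t)) A'" for t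
  proof -
    have "(int t *s v) v* E - (int t *s v) v* E' = ?tw t"
      by (simp add: w_def vec_eq_iff vector_matrix_mult_def sum_distrib_left mult_ac right_diff_distrib)
    thus ?thesis using hs_intertwined_shift[OF N A A' E E', of "int t *s v"] by simp
  qed
  then obtain z where z: "\<And>t. cmod (z t) = 1" "\<And>t. hs N A A' = z t * hs N (A \<circ> weyl N (?tw t)) A'" by metis
  note W = weyl_isometric[OF N]
  define V where "V = (\<lambda>k j. \<Sum>t<L. z t * weyl N (?tw t) (delta k) j)"
  have Vc: "V k \<in> coords N" for k unfolding V_def by (rule coords_sum) simp
  have orth: "hs N (weyl N (?tw t)) (weyl N (?tw t')) = (if t = t' then of_nat (N ^ CARD('n)) else 0)"
    if "t < L" "t' < L" for t t'
  proof (cases "t = t'")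
    case True thus ?thesis by (simp add: hs_self W)
  next
    case False
    obtain i where i: "w $ i \<noteq> 0" using assms(6) by (auto simp: w_def[symmetric] vec_eq_iff)
    let ?x = "(int t - int t') * w $ i"
    have "\<bar>?x\<bar> \<le> int L * \<bar>w $ i\<bar>" unfolding abs_mult by (rule mult_right_mono) (use that in auto)
    also have "\<dots> < int N" using big[of i] by (simp add: w_def)
    finally have "\<not> int N dvd ?x" using dvd_imp_le_int[of ?x "int N"] i False by auto
    hence "red N (?tw t - ?tw t') $ i \<noteq> 0" by (simp add: red_def left_diff_distrib dvd_eq_mod_eq_0)
    hence "red N (?tw t - ?tw t') \<noteq> 0" by auto
    thus ?thesis using False by (simp add: hs_weyl_orthogonal[OF N])
  qed
  have "of_nat L * hs N A A' = (\<Sum>t<L. z t * hs N (A \<circ> weyl N (?tw t)) A')"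
    using z(2) by simp
  also have "\<dots> = (\<Sum>k\<in>Z_mod N. cinner N (A (V k)) (A' (delta k)))"
    unfolding V_def isometric_op_sum[OF A finite_lessThan weyl_coords] hs_def cinner_sum_left cinner_cmult_left
      sum_distrib_left o_def by (rule sum.swap)
  also have "\<dots> = (\<Sum>(k, j)\<in>Z_mod N \<times> Z_mod N. A (V k) j * cnj (A' (delta k) j))"
    unfolding cinner_def by (simp add: sum.cartesian_product)
  finally have "(cmod (of_nat L * hs N A A'))\<^sup>2
    = (cmod (\<Sum>s\<in>Z_mod N \<times> Z_mod N. (\<lambda>(k, j). A (V k) j) s * cnj ((\<lambda>(k, j). A' (delta k) j) s)))\<^sup>2"
    by (simp add: case_prod_beta)
  also have "\<dots> \<le> (\<Sum>s\<in>Z_mod N \<times> Z_mod N. (cmod ((\<lambda>(k, j). A (V k) j) s))\<^sup>2)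
      * (\<Sum>s\<in>Z_mod N \<times> Z_mod N. (cmod ((\<lambda>(k, j). A' (delta k) j) s))\<^sup>2)"
    by (rule sum_Cauchy_Schwarz_complex)
  also have "(\<Sum>s\<in>Z_mod N \<times> Z_mod N. (cmod ((\<lambda>(k, j). A' (delta k) j) s))\<^sup>2) = Re (hs N A' A')"
    unfolding hs_def cinner_self by (simp add: case_prod_beta sum.cartesian_product)
  also have "\<dots> = real N ^ CARD('n)" by (simp add: hs_self[OF A'])
  also have "(\<Sum>s\<in>Z_mod N \<times> Z_mod N. (cmod ((\<lambda>(k, j). A (V k) j) s))\<^sup>2) = Re (\<Sum>k\<in>Z_mod N. cinner N (A (V k)) (A (V k)))"
    unfolding cinner_self by (simp add: case_prod_beta sum.cartesian_product)
  also have "(\<Sum>k\<in>Z_mod N. cinner N (A (V k)) (A (V k))) = (\<Sum>k\<in>Z_mod N. cinner N (V k) (V k))"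
    by (intro sum.cong refl isometric_opD(4)[OF A] Vc)
  also have "\<dots> = (\<Sum>k\<in>Z_mod N. \<Sum>t<L. \<Sum>t'<L. z t * cnj (z t') * cinner N (weyl N (?tw t) (delta k)) (weyl N (?tw t') (delta k)))"
    unfolding V_def cinner_sum_left cinner_sum_right cinner_cmult_left cinner_cmult_right
    by (simp add: sum_distrib_left mult_ac)
  also have "\<dots> = (\<Sum>t<L. \<Sum>t'<L. z t * cnj (z t') * hs N (weyl N (?tw t)) (weyl N (?tw t')))"
    unfolding hs_def sum_distrib_left by (subst sum.swap, intro sum.cong refl sum.swap)
  also have "\<dots> = (\<Sum>t<L. z t * cnj (z t) * of_nat (N ^ CARD('n)))"
    by (intro sum.cong refl) (simp add: orth if_distrib cong: if_cong)
  also have "\<dots> = (\<Sum>t<L. of_nat (N ^ CARD('n)))"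
    by (intro sum.cong refl) (simp add: complex_norm_square[symmetric] z(1))
  also have "Re \<dots> = real L * real N ^ CARD('n)" by simp
  finally have "(real L)\<^sup>2 * (cmod (hs N A A'))\<^sup>2 \<le> real L * (real N ^ CARD('n))\<^sup>2"
    by (simp add: norm_mult power_mult_distrib power2_eq_square mult_ac)
  hence "real L * (real L * (cmod (hs N A A'))\<^sup>2) \<le> real L * (real N ^ CARD('n))\<^sup>2"
    by (simp add: power2_eq_square mult_ac)
  thus ?thesis using L by simp
qed

subsection \<open>Bessel's inequality for block operators\<close>

lemma bessel_inequality:
  fixes w :: "'i \<Rightarrow> 's \<Rightarrow> complex"
  assumes I: "finite I"
    and orth: "\<And>i j. i \<in> I \<Longrightarrow> j \<in> I \<Longrightarrow> (\<Sum>s\<in>S. w i s * cnj (w j s)) = (if i = j then 1 else 0)"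
  shows "(\<Sum>i\<in>I. (cmod (\<Sum>s\<in>S. B s * cnj (w i s)))\<^sup>2) \<le> (\<Sum>s\<in>S. (cmod (B s))\<^sup>2)"
proof -
  define b where "b = (\<lambda>i. \<Sum>s\<in>S. B s * cnj (w i s))"
  define R where "R = (\<lambda>s. \<Sum>i\<in>I. b i * w i s)"
  have BR: "(\<Sum>s\<in>S. B s * cnj (R s)) = (\<Sum>i\<in>I. b i * cnj (b i))"
  proof -
    have "(\<Sum>s\<in>S. B s * cnj (R s)) = (\<Sum>s\<in>S. \<Sum>i\<in>I. cnj (b i) * (B s * cnj (w i s)))"
      by (simp add: R_def sum_distrib_left mult_ac)
    also have "\<dots> = (\<Sum>i\<in>I. cnj (b i) * (\<Sum>s\<in>S. B s * cnj (w i s)))"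
      by (subst sum.swap) (simp add: sum_distrib_left)
    finally show ?thesis by (simp only: b_def[THEN fun_cong, symmetric] mult.commute)
  qed
  have RR: "(\<Sum>s\<in>S. R s * cnj (R s)) = (\<Sum>i\<in>I. b i * cnj (b i))"
  proof -
    have "(\<Sum>s\<in>S. R s * cnj (R s)) = (\<Sum>s\<in>S. \<Sum>i\<in>I. \<Sum>j\<in>I. b i * cnj (b j) * (w i s * cnj (w j s)))"
      by (simp add: R_def sum_product mult_ac)
    also have "\<dots> = (\<Sum>i\<in>I. \<Sum>j\<in>I. b i * cnj (b j) * (\<Sum>s\<in>S. w i s * cnj (w j s)))"
      by (subst sum.swap, intro sum.cong refl, subst sum.swap) (simp add: sum_distrib_left)
    also have "\<dots> = (\<Sum>i\<in>I. b i * cnj (b i))"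
      by (intro sum.cong refl) (simp add: orth I if_distrib cong: if_cong)
    finally show ?thesis .
  qed
  have RB: "(\<Sum>s\<in>S. R s * cnj (B s)) = (\<Sum>i\<in>I. b i * cnj (b i))"
  proof -
    have "(\<Sum>s\<in>S. R s * cnj (B s)) = cnj (\<Sum>s\<in>S. B s * cnj (R s))" by (simp add: mult_ac)
    thus ?thesis by (simp add: BR mult_ac)
  qed
  have "complex_of_real (\<Sum>s\<in>S. (cmod (B s - R s))\<^sup>2) = (\<Sum>s\<in>S. (B s - R s) * cnj (B s - R s))"
    by (simp only: of_real_sum complex_norm_square)
  also have "\<dots> = (\<Sum>s\<in>S. B s * cnj (B s)) - (\<Sum>s\<in>S. B s * cnj (R s)) - (\<Sum>s\<in>S. R s * cnj (B s)) + (\<Sum>s\<in>S. R s * cnj (R s))"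
    by (simp add: algebra_simps sum.distrib sum_subtractf)
  also have "\<dots> = complex_of_real ((\<Sum>s\<in>S. (cmod (B s))\<^sup>2) - (\<Sum>i\<in>I. (cmod (b i))\<^sup>2))"
    unfolding BR RB RR by (simp only: of_real_diff of_real_sum complex_norm_square) simp
  finally have "(\<Sum>s\<in>S. (cmod (B s - R s))\<^sup>2) = (\<Sum>s\<in>S. (cmod (B s))\<^sup>2) - (\<Sum>i\<in>I. (cmod (b i))\<^sup>2)"
    by (simp only: of_real_eq_iff)
  moreover have "(\<Sum>s\<in>S. (cmod (B s - R s))\<^sup>2) \<ge> 0" by (intro sum_nonneg) auto
  ultimately show ?thesis by (simp add: b_def)
qed

lemma sum_Times: "sum f (A \<times> B) = (\<Sum>x\<in>A. \<Sum>y\<in>B. f (x, y))"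
  by (simp add: sum.cartesian_product)

text \<open>
  Expectation values in orthonormal sections \<open>u\<^sub>i\<close> are coefficients with respect to the tensors of \<open>u\<^sub>i\<close>
  with its conjugate. These tensors are orthonormal as well, hence by Bessel's inequality the sum of
  the squared expectation values of an operator is at most its squared Hilbert-Schmidt norm. Here the
  operator is a combination of blocks from the fibre over \<open>src p\<close> to the fibre over \<open>tgt p\<close>; blocks at
  different places are orthogonal.
\<close>

lemma block_bessel:
  fixes u :: "'i \<Rightarrow> 'v \<Rightarrow> int ^ 'n::finite \<Rightarrow> complex" and A :: "'p \<Rightarrow> 'n cop"
  assumes I: "finite I" and V: "finite V" and P: "finite P"
    and orth: "\<And>i j. i \<in> I \<Longrightarrow> j \<in> I \<Longrightarrow> (\<Sum>v\<in>V. cinner N (u i v) (u j v)) = (if i = j then 1 else 0)"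
    and u: "\<And>i v. i \<in> I \<Longrightarrow> v \<in> V \<Longrightarrow> u i v \<in> coords N"
    and A: "\<And>p. p \<in> P \<Longrightarrow> isometric_op N (A p)"
    and st: "\<And>p. p \<in> P \<Longrightarrow> src p \<in> V \<and> tgt p \<in> V"
  shows "(\<Sum>i\<in>I. (cmod (\<Sum>p\<in>P. c p * cinner N (A p (u i (src p))) (u i (tgt p))))\<^sup>2)
    \<le> (\<Sum>p\<in>P. \<Sum>q\<in>P. cmod (c p) * cmod (c q) *
          (if src p = src q \<and> tgt p = tgt q then cmod (hs N (A p) (A q)) else 0))"
proof -
  let ?K = "V \<times> Z_mod N"
  define W where "W = (\<lambda>i ((v, j), (w, k)). u i v j * cnj (u i w k))"
  define B where "B = (\<lambda>((v, j), (w, k)). \<Sum>p\<in>P. c p * (if v = tgt p \<and> w = src p then A p (delta k) j else 0))"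
  have fK: "finite ?K" using V by simp
  have one: "(\<Sum>s\<in>?K \<times> ?K. W i s * cnj (W j s)) = (if i = j then 1 else 0)" if "i \<in> I" "j \<in> I" for i j
  proof -
    have o: "(\<Sum>(v, l)\<in>?K. u i v l * cnj (u j v l)) = (if i = j then 1 else 0)"
      using orth[OF that] by (simp add: cinner_def sum.cartesian_product)
    have "(\<Sum>s\<in>?K \<times> ?K. W i s * cnj (W j s))
      = (\<Sum>x\<in>?K. \<Sum>y\<in>?K. (case x of (v, l) \<Rightarrow> u i v l * cnj (u j v l)) * cnj (case y of (v, l) \<Rightarrow> u i v l * cnj (u j v l)))"
      unfolding sum.cartesian_product by (intro sum.cong refl) (auto simp: W_def mult_ac)
    also have "\<dots> = (if i = j then 1 else 0) * cnj (if i = j then 1 else 0)"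
      unfolding sum_product[symmetric] cnj_sum[symmetric] by (simp only: o)
    finally show ?thesis by auto
  qed
  have two: "(\<Sum>s\<in>?K \<times> ?K. B s * cnj (W i s)) = (\<Sum>p\<in>P. c p * cinner N (A p (u i (src p))) (u i (tgt p)))"
    if i: "i \<in> I" for i
  proof -
    have "(\<Sum>s\<in>?K \<times> ?K. B s * cnj (W i s))
      = (\<Sum>s\<in>?K \<times> ?K. \<Sum>p\<in>P. c p * (case s of ((v, j), (w, k)) \<Rightarrow>
           (if v = tgt p \<and> w = src p then A p (delta k) j * u i w k * cnj (u i v j) else 0)))"
      by (intro sum.cong refl) (auto simp: B_def W_def sum_distrib_left sum_distrib_right mult_ac intro!: sum.cong)
    also have "\<dots> = (\<Sum>p\<in>P. c p * (\<Sum>s\<in>?K \<times> ?K. case s of ((v, j), (w, k)) \<Rightarrow>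
           (if v = tgt p \<and> w = src p then A p (delta k) j * u i w k * cnj (u i v j) else 0)))"
      by (subst sum.swap) (simp add: sum_distrib_left)
    also have "\<dots> = (\<Sum>p\<in>P. c p * cinner N (A p (u i (src p))) (u i (tgt p)))"
    proof (intro sum.cong refl arg_cong2[where f = "(*)"])
      fix p assume p: "p \<in> P"
      have "(\<Sum>s\<in>?K \<times> ?K. case s of ((v, j), (w, k)) \<Rightarrow>
           (if v = tgt p \<and> w = src p then A p (delta k) j * u i w k * cnj (u i v j) else 0))
        = (\<Sum>s\<in>({tgt p} \<times> Z_mod N) \<times> ({src p} \<times> Z_mod N). case s of ((v, j), (w, k)) \<Rightarrow> A p (delta k) j * u i w k * cnj (u i v j))"
        using st[OF p] by (intro sum.mono_neutral_cong_right) (auto simp: fK V split: if_splits)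
      also have "\<dots> = (\<Sum>j\<in>Z_mod N. \<Sum>k\<in>Z_mod N. A p (delta k) j * u i (src p) k * cnj (u i (tgt p) j))"
        by (simp add: sum_Times)
      also have "\<dots> = cinner N (A p (u i (src p))) (u i (tgt p))"
        using st[OF p] i by (subst isometric_op_expand[OF A[OF p] u]) (auto simp: cinner_def sum_distrib_left mult_ac)
      finally show "(\<Sum>s\<in>?K \<times> ?K. case s of ((v, j), (w, k)) \<Rightarrow>
           (if v = tgt p \<and> w = src p then A p (delta k) j * u i w k * cnj (u i v j) else 0))
        = cinner N (A p (u i (src p))) (u i (tgt p))" .
    qed
    finally show ?thesis .
  qed
  let ?h = "\<lambda>p q. if src p = src q \<and> tgt p = tgt q then hs N (A p) (A q) else 0"
  have three: "complex_of_real (\<Sum>s\<in>?K \<times> ?K. (cmod (B s))\<^sup>2) = (\<Sum>p\<in>P. \<Sum>q\<in>P. c p * cnj (c q) * ?h p q)"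
  proof -
    let ?f = "\<lambda>p s. case s of ((v, j), (w, k)) \<Rightarrow> (if v = tgt p \<and> w = src p then A p (delta k) j else 0)"
    have Bf: "B s = (\<Sum>p\<in>P. c p * ?f p s)" for s by (simp add: B_def case_prod_beta)
    have "complex_of_real (\<Sum>s\<in>?K \<times> ?K. (cmod (B s))\<^sup>2)
      = (\<Sum>s\<in>?K \<times> ?K. \<Sum>p\<in>P. \<Sum>q\<in>P. c p * cnj (c q) * (?f p s * cnj (?f q s)))"
      by (simp only: of_real_sum complex_norm_square Bf cnj_sum sum_product complex_cnj_mult mult_ac)
    also have "\<dots> = (\<Sum>p\<in>P. \<Sum>q\<in>P. c p * cnj (c q) * (\<Sum>s\<in>?K \<times> ?K. ?f p s * cnj (?f q s)))"
      by (subst sum.swap, intro sum.cong refl, subst sum.swap) (simp add: sum_distrib_left)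
    also have "\<dots> = (\<Sum>p\<in>P. \<Sum>q\<in>P. c p * cnj (c q) * ?h p q)"
    proof (intro sum.cong refl arg_cong2[where f = "(*)"])
      fix p q assume p: "p \<in> P" and q: "q \<in> P"
      show "(\<Sum>s\<in>?K \<times> ?K. ?f p s * cnj (?f q s)) = ?h p q"
      proof (cases "src p = src q \<and> tgt p = tgt q")
        case True
        have "(\<Sum>s\<in>?K \<times> ?K. ?f p s * cnj (?f q s))
          = (\<Sum>s\<in>({tgt p} \<times> Z_mod N) \<times> ({src p} \<times> Z_mod N). case s of ((v, j), (w, k)) \<Rightarrow> A p (delta k) j * cnj (A q (delta k) j))"
          using st[OF p] True by (intro sum.mono_neutral_cong_right) (auto simp: fK V split: if_splits)
        also have "\<dots> = (\<Sum>j\<in>Z_mod N. \<Sum>k\<in>Z_mod N. A p (delta k) j * cnj (A q (delta k) j))"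
          by (simp add: sum_Times)
        also have "\<dots> = hs N (A p) (A q)" unfolding hs_def cinner_def by (rule sum.swap)
        finally show ?thesis using True by simp
      next
        case False
        hence "?f p s * cnj (?f q s) = 0" for s by (auto split: prod.splits)
        thus ?thesis using False by (simp only: sum.neutral_const if_False)
      qed
    qed
    finally show ?thesis .
  qed
  have "(\<Sum>i\<in>I. (cmod (\<Sum>p\<in>P. c p * cinner N (A p (u i (src p))) (u i (tgt p))))\<^sup>2)
    = (\<Sum>i\<in>I. (cmod (\<Sum>s\<in>?K \<times> ?K. B s * cnj (W i s)))\<^sup>2)"
    by (simp add: two)
  also have "\<dots> \<le> (\<Sum>s\<in>?K \<times> ?K. (cmod (B s))\<^sup>2)"
    by (rule bessel_inequality[OF I one])
  also have "\<dots> = Re (complex_of_real (\<Sum>s\<in>?K \<times> ?K. (cmod (B s))\<^sup>2))" by simp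
  also have "\<dots> \<le> cmod (\<Sum>p\<in>P. \<Sum>q\<in>P. c p * cnj (c q) * ?h p q)"
    unfolding three by (rule complex_Re_le_cmod)
  also have "\<dots> \<le> (\<Sum>p\<in>P. \<Sum>q\<in>P. cmod (c p * cnj (c q) * ?h p q))"
    by (intro order_trans[OF norm_sum] sum_mono order_refl)
  also have "\<dots> = (\<Sum>p\<in>P. \<Sum>q\<in>P. cmod (c p) * cmod (c q) *
          (if src p = src q \<and> tgt p = tgt q then cmod (hs N (A p) (A q)) else 0))"
    by (intro sum.cong refl) (simp add: norm_mult)
  finally show ?thesis .
qed

section \<open>Walks, backtracking and the fundamental group\<close>

locale regular_bidirected = fin_digraph X + bidirected_digraph X rv
  for X :: "('v, 'e) pre_digraph" and rv :: "'e \<Rightarrow> 'e" +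
  fixes d :: nat
  assumes conn: "Digraph_Component.connected X" and out_deg: "\<And>v. v \<in> verts X \<Longrightarrow> out_degree X v = d"
begin

abbreviation step :: "'e \<Rightarrow> 'e \<Rightarrow> bool" where
  "step x y \<equiv> head X x = tail X y \<and> y \<noteq> rv x"

definition nonbacktracking :: "'e list \<Rightarrow> bool" where
  "nonbacktracking p \<longleftrightarrow> set p \<subseteq> arcs X \<and> successively step p"

definition reverse_walk :: "'e list \<Rightarrow> 'e list" where
  "reverse_walk p = map rv (rev p)"

lemma reverse_walk_simps [simp]:
  "reverse_walk [] = []" "reverse_walk (e # p) = reverse_walk p @ [rv e]"
  by (simp_all add: reverse_walk_def)

lemma awalk_reverse: "awalk u p v \<Longrightarrow> awalk v (reverse_walk p) u"
proof (induction p arbitrary: u)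
  case Nil thus ?case by (auto simp: awalk_Nil_iff)
next
  case (Cons e p)
  hence e: "e \<in> arcs X" "tail X e = u" and p: "awalk (head X e) p v" by (auto simp: awalk_Cons_iff)
  have "awalk (head X e) [rv e] u" using e by (auto simp: awalk_Cons_iff awalk_Nil_iff)
  thus ?case using Cons.IH[OF p] by (auto intro: awalk_appendI)
qed

lemma exists_awalk: "u \<in> verts X \<Longrightarrow> v \<in> verts X \<Longrightarrow> \<exists>p. awalk u p v"
proof -
  assume "u \<in> verts X" "v \<in> verts X"
  have "symmetric X" unfolding symmetric_conv by (metis arev_in_arcs head_arev tail_arev)
  hence "strongly_connected X" using conn by (rule symmetric_connected_imp_strongly_connected)
  thus ?thesis using \<open>u \<in> verts X\<close> \<open>v \<in> verts X\<close> reachable_awalk unfolding strongly_connected_def by blast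
qed

lemma nonbacktracking_awalk:
  assumes "nonbacktracking p" "p \<noteq> []"
  shows "awalk (tail X (hd p)) p (head X (last p))"
  using assms
proof (induction p)
  case (Cons e p)
  show ?case
  proof (cases "p = []")
    case True thus ?thesis using Cons.prems by (auto simp: nonbacktracking_def awalk_Cons_iff awalk_Nil_iff)
  next
    case False
    then obtain x q where p: "p = x # q" by (cases p) auto
    have "nonbacktracking p" using Cons.prems by (auto simp: nonbacktracking_def p)
    from Cons.IH[OF this False] show ?thesis using Cons.prems
      by (auto simp: awalk_Cons_iff nonbacktracking_def p)
  qed
qed simp

subsection \<open>The action of edges on reduced words\<close>

definition reduced :: "'e list \<Rightarrow> bool" where
  "reduced p \<longleftrightarrow> successively (\<lambda>x y. y \<noteq> rv x) p"

text \<open>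
  Left multiplication by the letter \<open>e\<close> in the group of reduced words.
\<close>

definition act :: "'e \<Rightarrow> 'e list \<Rightarrow> 'e list" where
  "act e w = (case w of [] \<Rightarrow> [e] | x # w' \<Rightarrow> if x = rv e then w' else e # w)"

lemma reduced_act: "reduced w \<Longrightarrow> reduced (act e w)"
  unfolding reduced_def act_def
  by (cases w rule: remdups_adj.cases) (auto split: list.splits)

lemma reduced_foldr_act: "reduced w \<Longrightarrow> reduced (foldr act p w)"
  by (induction p) (auto intro: reduced_act)

lemma act_rv_act: "reduced w \<Longrightarrow> act (rv e) (act e w) = w"
  unfolding reduced_def act_def
  by (cases w rule: remdups_adj.cases) (auto split: list.splits)

lemma act_act_rv: "reduced w \<Longrightarrow> act e (act (rv e) w) = w"
  using act_rv_act[of w "rv e"] by simp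

lemma act_reverse_walk: "reduced w \<Longrightarrow> foldr act (reverse_walk p) (foldr act p w) = w"
  by (induction p arbitrary: w) (auto simp: act_rv_act reduced_foldr_act)

lemma backtrack_step_act:
  "backtrack_step X rv b p q \<Longrightarrow> reduced w \<Longrightarrow> foldr act p w = foldr act q w"
  by (auto simp: backtrack_step_def act_act_rv reduced_foldr_act)

text \<open>
  Walks act on reduced words. As the two arcs of a backtrack act by mutually inverse maps, the action
  only sees the homotopy class. A nonbacktracking walk is recovered from its action on the empty
  word.
\<close>

lemma homotopic_act:
  assumes "equivclp (backtrack_step X rv b) p q" "reduced w"
  shows "foldr act p w = foldr act q w"
  using assms(1) by (induction rule: equivclp_induct) (auto dest: backtrack_step_act[OF _ assms(2)])

lemma act_nonbacktracking: "nonbacktracking p \<Longrightarrow> foldr act p [] = p"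
proof (induction p)
  case (Cons e p)
  hence "nonbacktracking p" by (cases p) (auto simp: nonbacktracking_def)
  with Cons show ?case by (cases p) (auto simp: act_def nonbacktracking_def)
qed simp

lemma loop_refl: "p \<in> loops_at X b \<Longrightarrow> (p, p) \<in> loop_homotopy X rv b"
  by (simp add: loop_homotopy_def)

lemma loop_class_in_fund_group:
  "p \<in> loops_at X b \<Longrightarrow> loop_homotopy X rv b `` {p} \<in> fund_group X rv b"
  unfolding fund_group_def by (rule quotientI)

lemma fund_groupE:
  assumes "\<gamma> \<in> fund_group X rv b"
  obtains p where "p \<in> loops_at X b" "\<gamma> = loop_homotopy X rv b `` {p}"
  using assms unfolding fund_group_def by (rule quotientE) auto

end

subsection \<open>Weights of walks\<close>

lemma walk_weight_simps [simp]:
  "walk_weight chi [] = mat 1" "walk_weight chi (e # p) = chi e ** walk_weight chi p"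
  by (simp_all add: walk_weight_def)

lemma walk_weight_append: "walk_weight chi (p @ q) = walk_weight chi p ** walk_weight chi q"
  by (induction p) (simp_all add: matrix_mul_assoc)

locale weighted_graph = regular_bidirected X rv d
  for X :: "('v, 'e) pre_digraph" and rv and d +
  fixes chi :: "'e \<Rightarrow> int ^ ('n::finite + 'n) ^ ('n + 'n)"
  assumes weights: "symplectic_weights X rv chi"
begin

lemma chi_rv: "e \<in> arcs X \<Longrightarrow> chi (rv e) ** chi e = mat 1" "e \<in> arcs X \<Longrightarrow> chi e ** chi (rv e) = mat 1"
  using weights by (auto simp: symplectic_weights_def)

lemma walk_weight_reverse:
  assumes "set p \<subseteq> arcs X"
  shows "walk_weight chi (reverse_walk p) ** walk_weight chi p = mat 1"
    and "walk_weight chi p ** walk_weight chi (reverse_walk p) = mat 1"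
  using assms
proof (induction p)
  case (Cons e p)
  {
    case 1
    have "walk_weight chi (reverse_walk (e # p)) ** walk_weight chi (e # p)
      = walk_weight chi (reverse_walk p) ** (chi (rv e) ** chi e) ** walk_weight chi p"
      by (simp add: walk_weight_append matrix_mul_assoc)
    thus ?case using 1 Cons by (simp add: chi_rv)
  next
    case 2
    have "walk_weight chi (e # p) ** walk_weight chi (reverse_walk (e # p))
      = chi e ** (walk_weight chi p ** walk_weight chi (reverse_walk p)) ** chi (rv e)"
      by (simp add: walk_weight_append matrix_mul_assoc)
    thus ?case using 2 Cons by (simp add: chi_rv)
  }
qed simp_all

lemma backtrack_step_weight:
  "backtrack_step X rv b p q \<Longrightarrow> walk_weight chi p = walk_weight chi q"
proof -
  assume "backtrack_step X rv b p q"
  then obtain r s e where "p = r @ s" "q = r @ [e, rv e] @ s" "q \<in> loops_at X b"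
    by (auto simp: backtrack_step_def)
  moreover have "e \<in> arcs X" using calculation by (auto simp: loops_at_def awalk_def)
  ultimately show ?thesis
    by (simp add: walk_weight_append matrix_mul_assoc chi_rv)
qed

lemma homotopic_weight:
  assumes "equivclp (backtrack_step X rv b) p q"
  shows "walk_weight chi p = walk_weight chi q"
  using assms by (induction rule: equivclp_induct) (auto dest: backtrack_step_weight)

lemma class_weight_loop:
  assumes "p \<in> loops_at X b"
  shows "class_weight chi (loop_homotopy X rv b `` {p}) = walk_weight chi p"
proof -
  have "walk_weight chi ` (loop_homotopy X rv b `` {p}) = {walk_weight chi p}"
    using loop_refl[OF assms] by (auto simp: loop_homotopy_def dest: homotopic_weight)
  thus ?thesis by (simp add: class_weight_def)
qed

text \<open>
  Join \<open>p\<close> and the reverse of \<open>p'\<close> to a loop at the base vertex. If the weights agreed, this loop would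
  have the identity as its weight. The upper right block of the identity is zero, so \<open>BIV\<close> would make
  the loop contractible; then it acts trivially on reduced words, which forces \<open>p = p'\<close>.
\<close>

lemma nonbacktracking_weights_distinct:
  assumes biv: "BIV X rv b chi" and b: "b \<in> verts X"
    and p: "nonbacktracking p" "p \<noteq> []" and p': "nonbacktracking p'" "p' \<noteq> []"
    and ends: "tail X (hd p) = tail X (hd p')" "head X (last p) = head X (last p')"
    and eq: "walk_weight chi p = walk_weight chi p'"
  shows "p = p'"
proof -
  note P = nonbacktracking_awalk[OF p] and P' = nonbacktracking_awalk[OF p']
  let ?v = "tail X (hd p)"
  have v: "?v \<in> verts X" using P by (rule awalk_hd_in_verts)
  obtain c where c: "awalk b c ?v" using exists_awalk[OF b v] by blast
  define l where "l = c @ p @ reverse_walk p' @ reverse_walk c"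
  have "awalk b l b" unfolding l_def
    using c P awalk_reverse[OF P'] awalk_reverse[OF c] ends by (auto intro!: awalk_appendI)
  hence l: "l \<in> loops_at X b" by (simp add: loops_at_def)
  have sets: "set c \<subseteq> arcs X" "set p' \<subseteq> arcs X" using c p' by (auto simp: awalk_def nonbacktracking_def)
  have "walk_weight chi l = walk_weight chi c ** (walk_weight chi p' ** walk_weight chi (reverse_walk p')) ** walk_weight chi (reverse_walk c)"
    by (simp add: l_def walk_weight_append eq matrix_mul_assoc)
  also have "\<dots> = mat 1" by (simp add: walk_weight_reverse sets)
  finally have one: "walk_weight chi l = mat 1" .
  have "upper_right (mat 1 :: int ^ ('n + 'n) ^ ('n + 'n)) = 0"
    by (simp add: upper_right_def mat_def vec_eq_iff)
  hence "det (upper_right (mat 1 :: int ^ ('n + 'n) ^ ('n + 'n))) = 0"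
    by (intro det_zero_row) (simp add: row_def vec_eq_iff)
  hence "loop_homotopy X rv b `` {l} = fund_one X rv b"
    using biv loop_class_in_fund_group[OF l] class_weight_loop[OF l] one unfolding BIV_def by force
  hence "([], l) \<in> loop_homotopy X rv b"
    using loop_refl[OF l] unfolding fund_one_def by blast
  hence "equivclp (backtrack_step X rv b) [] l" by (simp add: loop_homotopy_def)
  hence H: "foldr act l w = w" if "reduced w" for w
    using homotopic_act[of b "[]" l w] that by simp
  let ?c = "foldr act c" and ?c' = "foldr act (reverse_walk c)"
  have r: "reduced []" by (simp add: reduced_def)
  have "?c (foldr act p (foldr act (reverse_walk p') (?c' (?c (foldr act p' []))))) = ?c (foldr act p' [])"
    using H[of "?c (foldr act p' [])"] by (simp add: l_def reduced_foldr_act r)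
  hence "?c (foldr act p []) = ?c (foldr act p' [])"
    by (simp add: act_reverse_walk reduced_foldr_act r)
  hence "?c' (?c (foldr act p [])) = ?c' (?c (foldr act p' []))" by simp
  hence "foldr act p [] = foldr act p' []" by (simp add: act_reverse_walk reduced_foldr_act r)
  thus ?thesis by (simp add: act_nonbacktracking p p')
qed

subsection \<open>Ergodicity and orbits of frequencies\<close>

text \<open>
  Were the orbit finite, the sum of the characters over it would be an invariant function. Its Fourier
  coefficient at \<open>w\<close> is \<open>1\<close>, so it would not be constant, contradicting ergodicity.
\<close>

lemma infinite_frequency_orbit:
  assumes erg: "ERG X rv b chi" and b: "b \<in> verts X" and w: "w \<noteq> 0"
  shows "infinite ((\<lambda>p. w v* walk_weight chi p) ` loops_at X b)"
proof
  let ?O = "(\<lambda>p. w v* walk_weight chi p) ` loops_at X b"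
  assume fin: "finite ?O"
  define g where "g = (\<lambda>z. \<Sum>w'\<in>?O. character w' z)"
  have wO: "w \<in> ?O" using b by (force simp: loops_at_def awalk_Nil_iff intro!: image_eqI[of _ _ "[]"])
  have smooth: "g \<in> torus_smooth"
    using fin unfolding g_def
  proof (induction rule: finite_induct)
    case empty show ?case by (simp add: torus_smooth_def torus_fun_def smooth_fun_const)
  qed (simp add: torus_smooth_add character_smooth)
  have cont: "continuous_on A g" for A using smooth by (auto simp: torus_smooth_def intro: smooth_fun_continuous)
  have L2: "g \<in> torus_L2"
    unfolding torus_L2_def mem_Collect_eq set_integrable_def
  proof (intro conjI)
    show "g \<in> borel_measurable lborel"
      using cont[of UNIV] by (simp add: borel_measurable_continuous_onI)
    show "torus_fun g" using smooth by (simp add: torus_smooth_def)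
    show "integrable lborel (\<lambda>x. indicator (cbox 0 One) x *\<^sub>R (cmod (g x))\<^sup>2)"
      by (rule borel_integrable_compact) (auto intro!: continuous_intros cont)
  qed
  have inv: "g (mat_act (class_weight chi \<gamma>) z) = g z" if "\<gamma> \<in> fund_group X rv b" for \<gamma> z
  proof -
    from that obtain p where p: "p \<in> loops_at X b" and \<gamma>: "\<gamma> = loop_homotopy X rv b `` {p}" by (rule fund_groupE)
    let ?E = "walk_weight chi p"
    have pw: "awalk b p b" using p by (simp add: loops_at_def)
    hence sp: "set p \<subseteq> arcs X" by (auto simp: awalk_def)
    have inj: "inj_on (\<lambda>w'. w' v* ?E) ?O"
    proof (rule inj_onI)
      fix x y assume "x v* ?E = y v* ?E"
      hence "x v* ?E v* walk_weight chi (reverse_walk p) = y v* ?E v* walk_weight chi (reverse_walk p)" by simp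
      thus "x = y" by (simp add: vector_matrix_mul_assoc walk_weight_reverse[OF sp])
    qed
    have sub: "(\<lambda>w'. w' v* ?E) ` ?O \<subseteq> ?O"
    proof (intro subsetI, elim imageE, simp only:)
      fix q assume "q \<in> loops_at X b"
      hence "q @ p \<in> loops_at X b" using pw by (auto simp: loops_at_def intro: awalk_appendI)
      thus "w v* walk_weight chi q v* ?E \<in> ?O"
        by (intro image_eqI[of _ _ "q @ p"]) (simp_all add: walk_weight_append vector_matrix_mul_assoc)
    qed
    have im: "(\<lambda>w'. w' v* ?E) ` ?O = ?O"
      by (rule card_subset_eq[OF fin sub]) (rule card_image[OF inj])
    have "g (mat_act ?E z) = (\<Sum>w'\<in>?O. character (w' v* ?E) z)"
      by (simp add: g_def character_transpose)
    also have "\<dots> = (\<Sum>w'\<in>(\<lambda>w'. w' v* ?E) ` ?O. character w' z)"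
      by (simp add: sum.reindex[OF inj] o_def)
    finally show ?thesis by (simp only: im g_def \<gamma> class_weight_loop[OF p])
  qed
  have "\<forall>\<gamma>\<in>fund_group X rv b. AE z in lborel. g (mat_act (class_weight chi \<gamma>) z) = g z"
    by (simp add: inv)
  then obtain c where c: "AE z in lborel. g z = c"
    using erg L2 unfolding ERG_def by blast
  have zero: "fourier_coeff (\<lambda>z. 0) w = 0" by (simp add: fourier_coeff_def torus_integral_def)
  have "fourier_coeff g w = fourier_coeff (\<lambda>z. c) w"
    unfolding fourier_coeff_def torus_integral_def set_lebesgue_integral_def
  proof (rule integral_cong_AE)
    show "(\<lambda>z. indicator (cbox 0 One) z *\<^sub>R (cis (- 2 * pi * (of_int_vec w \<bullet> z)) * g z)) \<in> borel_measurable lborel"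
      by (intro borel_measurable_integrable borel_integrable_compact continuous_intros cont) auto
    show "(\<lambda>z. indicator (cbox 0 One) z *\<^sub>R (cis (- 2 * pi * (of_int_vec w \<bullet> z)) * c)) \<in> borel_measurable lborel"
      by (intro borel_measurable_integrable borel_integrable_compact continuous_intros) auto
  qed (use c in auto)
  also have "(\<lambda>z. c) = (\<lambda>z. 0 + c * character 0 z)" by (simp add: character_def)
  also have "fourier_coeff \<dots> w = 0"
    using w by (subst fourier_coeff_add[OF _ character_smooth])
       (simp_all add: torus_smooth_def torus_fun_def smooth_fun_const fourier_coeff_character zero)
  finally have "fourier_coeff g w = 0" .
  moreover have "fourier_coeff (\<lambda>z. \<Sum>w'\<in>S. character w' z) w = (if w \<in> S then 1 else 0)
      \<and> (\<lambda>z. \<Sum>w'\<in>S. character w' z) \<in> torus_smooth" if "finite S" for S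
    using that
  proof (induction rule: finite_induct)
    case empty show ?case
      by (simp add: torus_smooth_def torus_fun_def smooth_fun_const fourier_coeff_def torus_integral_def)
  next
    case (insert x S)
    have "fourier_coeff (\<lambda>z. character x z + 1 * (\<Sum>w'\<in>S. character w' z)) w
      = fourier_coeff (character x) w + 1 * fourier_coeff (\<lambda>z. \<Sum>w'\<in>S. character w' z) w"
      using insert by (intro fourier_coeff_add character_smooth) auto
    thus ?case using insert by (auto simp: fourier_coeff_character intro!: torus_smooth_add character_smooth)
  qed
  ultimately show False using fin wO unfolding g_def by fastforce
qed

end

section \<open>Sums over nonbacktracking walks through an edge\<close>

context regular_bidirected
begin

definition left_ext :: "'e \<Rightarrow> nat \<Rightarrow> 'e list set" where
  "left_ext e k = {r. length r = k \<and> nonbacktracking (r @ [e])}"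

definition right_ext :: "'e \<Rightarrow> nat \<Rightarrow> 'e list set" where
  "right_ext e k = {s. length s = k \<and> nonbacktracking (e # s)}"

lemma finite_left_ext [simp]: "finite (left_ext e k)"
  by (rule finite_subset[OF _ finite_lists_length_eq[of "arcs X" k]])
     (auto simp: left_ext_def nonbacktracking_def)

lemma finite_right_ext [simp]: "finite (right_ext e k)"
  by (rule finite_subset[OF _ finite_lists_length_eq[of "arcs X" k]])
     (auto simp: right_ext_def nonbacktracking_def)

definition prev_arcs :: "'e \<Rightarrow> 'e set" where "prev_arcs y = in_arcs X (tail X y) - {rv y}"
definition next_arcs :: "'e \<Rightarrow> 'e set" where "next_arcs y = out_arcs X (head X y) - {rv y}"

lemma in_arcs_decompose:
  assumes "y \<in> arcs X"
  shows "in_arcs X (tail X y) = insert (rv y) (prev_arcs y)" "finite (prev_arcs y)" "card (prev_arcs y) = d - 1"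
proof -
  have y: "rv y \<in> in_arcs X (tail X y)" using assms by simp
  show "in_arcs X (tail X y) = insert (rv y) (prev_arcs y)" using y by (auto simp: prev_arcs_def)
  show "finite (prev_arcs y)" by (auto simp: prev_arcs_def)
  have "card (in_arcs X (tail X y)) = d"
    using out_deg[of "tail X y"] assms by (simp add: in_arcs_eq card_image out_degree_def inj_on_arev)
  thus "card (prev_arcs y) = d - 1" using y by (simp add: prev_arcs_def)
qed

lemma out_arcs_decompose:
  assumes "y \<in> arcs X"
  shows "out_arcs X (head X y) = insert (rv y) (next_arcs y)" "finite (next_arcs y)" "card (next_arcs y) = d - 1"
proof -
  have y: "rv y \<in> out_arcs X (head X y)" using assms by simp
  show "out_arcs X (head X y) = insert (rv y) (next_arcs y)" using y by (auto simp: next_arcs_def)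
  show "finite (next_arcs y)" by (auto simp: next_arcs_def)
  have "card (out_arcs X (head X y)) = d"
    using out_deg[of "head X y"] assms by (simp add: out_degree_def)
  thus "card (next_arcs y) = d - 1" using y by (simp add: next_arcs_def)
qed

lemma nonbacktracking_Cons:
  "p \<noteq> [] \<Longrightarrow> nonbacktracking (x # p) \<longleftrightarrow> nonbacktracking p \<and> x \<in> prev_arcs (hd p)"
  by (cases p) (auto simp: nonbacktracking_def prev_arcs_def)

lemma nonbacktracking_snoc:
  "p \<noteq> [] \<Longrightarrow> nonbacktracking (p @ [x]) \<longleftrightarrow> nonbacktracking p \<and> x \<in> next_arcs (last p)"
  by (auto simp: nonbacktracking_def next_arcs_def successively_append_iff)

lemma left_ext_0: "e \<in> arcs X \<Longrightarrow> left_ext e 0 = {[]}"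
  and right_ext_0: "e \<in> arcs X \<Longrightarrow> right_ext e 0 = {[]}"
  by (auto simp: left_ext_def right_ext_def nonbacktracking_def)

lemma left_ext_Suc: "left_ext e (Suc k) = (\<lambda>(r, x). x # r) ` (SIGMA r:left_ext e k. prev_arcs (hd (r @ [e])))"
proof (intro set_eqI iffI)
  fix p assume "p \<in> left_ext e (Suc k)"
  then obtain x r where p: "p = x # r" "length r = k" "nonbacktracking (x # (r @ [e]))"
    by (cases p) (auto simp: left_ext_def)
  thus "p \<in> (\<lambda>(r, x). x # r) ` (SIGMA r:left_ext e k. prev_arcs (hd (r @ [e])))"
    by (subst (asm) nonbacktracking_Cons) (auto simp: left_ext_def)
next
  fix p assume "p \<in> (\<lambda>(r, x). x # r) ` (SIGMA r:left_ext e k. prev_arcs (hd (r @ [e])))"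
  then obtain x r where p: "p = x # r" "r \<in> left_ext e k" "x \<in> prev_arcs (hd (r @ [e]))" by auto
  hence "nonbacktracking (x # (r @ [e]))" by (subst nonbacktracking_Cons) (auto simp: left_ext_def)
  thus "p \<in> left_ext e (Suc k)" using p by (auto simp: left_ext_def)
qed

lemma right_ext_Suc: "right_ext e (Suc k) = (\<lambda>(s, x). s @ [x]) ` (SIGMA s:right_ext e k. next_arcs (last (e # s)))"
proof (intro set_eqI iffI)
  fix p assume "p \<in> right_ext e (Suc k)"
  then obtain x s where p: "p = s @ [x]" "length s = k" "nonbacktracking ((e # s) @ [x])"
    by (cases p rule: rev_cases) (auto simp: right_ext_def)
  thus "p \<in> (\<lambda>(s, x). s @ [x]) ` (SIGMA s:right_ext e k. next_arcs (last (e # s)))"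
    by (subst (asm) nonbacktracking_snoc) (auto simp: right_ext_def)
next
  fix p assume "p \<in> (\<lambda>(s, x). s @ [x]) ` (SIGMA s:right_ext e k. next_arcs (last (e # s)))"
  then obtain x s where p: "p = s @ [x]" "s \<in> right_ext e k" "x \<in> next_arcs (last (e # s))" by auto
  hence "nonbacktracking ((e # s) @ [x])" by (subst nonbacktracking_snoc) (auto simp: right_ext_def)
  thus "p \<in> right_ext e (Suc k)" using p by (auto simp: right_ext_def)
qed

lemma hd_left_ext: "r \<in> left_ext e k \<Longrightarrow> hd (r @ [e]) \<in> arcs X"
  by (cases r) (auto simp: left_ext_def nonbacktracking_def)

lemma last_right_ext: "s \<in> right_ext e k \<Longrightarrow> last (e # s) \<in> arcs X"
  by (cases s rule: rev_cases) (auto simp: right_ext_def nonbacktracking_def)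

lemma sum_left_ext_Suc:
  "sum g (left_ext e (Suc k)) = (\<Sum>r\<in>left_ext e k. \<Sum>x\<in>prev_arcs (hd (r @ [e])). g (x # r))"
  unfolding left_ext_Suc
  by (subst sum.reindex, force simp: inj_on_def)
     (subst sum.Sigma, auto intro: in_arcs_decompose hd_left_ext simp: case_prod_beta)

lemma sum_right_ext_Suc:
  "sum g (right_ext e (Suc k)) = (\<Sum>s\<in>right_ext e k. \<Sum>x\<in>next_arcs (last (e # s)). g (s @ [x]))"
  unfolding right_ext_Suc
  by (subst sum.reindex, force simp: inj_on_def)
     (subst sum.Sigma, auto intro: out_arcs_decompose last_right_ext simp: case_prod_beta simp del: last.simps)

lemma card_left_ext: "e \<in> arcs X \<Longrightarrow> card (left_ext e k) = (d - 1) ^ k"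
proof (induction k)
  case (Suc k)
  have "card (left_ext e (Suc k)) = sum (\<lambda>_. 1) (left_ext e (Suc k))" by simp
  also have "\<dots> = (\<Sum>r\<in>left_ext e k. d - 1)"
    unfolding sum_left_ext_Suc by (intro sum.cong refl) (simp add: in_arcs_decompose(3) hd_left_ext)
  finally show ?case using Suc by simp
qed (simp add: left_ext_0)

lemma card_right_ext: "e \<in> arcs X \<Longrightarrow> card (right_ext e k) = (d - 1) ^ k"
proof (induction k)
  case (Suc k)
  have "card (right_ext e (Suc k)) = sum (\<lambda>_. 1) (right_ext e (Suc k))" by simp
  also have "\<dots> = (\<Sum>r\<in>right_ext e k. d - 1)"
    unfolding sum_right_ext_Suc by (intro sum.cong refl) (simp add: out_arcs_decompose(3) last_right_ext del: last.simps)
  finally show ?case using Suc by simp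
qed (simp add: right_ext_0)

lemma nonbacktracking_join:
  assumes "r \<in> left_ext e a" "s \<in> right_ext e b"
  shows "nonbacktracking (r @ e # s)"
proof -
  have "nonbacktracking (r @ [e])" "nonbacktracking (e # s)" using assms by (auto simp: left_ext_def right_ext_def)
  thus ?thesis by (auto simp: nonbacktracking_def successively_append_iff)
qed

end

locale quantum_graph = weighted_graph X rv d chi
  for X :: "('v, 'e) pre_digraph" and rv and d and chi :: "'e \<Rightarrow> int ^ ('n::finite + 'n) ^ ('n + 'n)" +
  fixes N :: nat and M :: "'e \<Rightarrow> 'n cop"
  assumes N: "N > 0"
    and M_isometric: "e \<in> arcs X \<Longrightarrow> isometric_op N (M e)"
    and M_rv: "e \<in> arcs X \<Longrightarrow> c \<in> coords N \<Longrightarrow> M (rv e) (M e c) = c"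
    and egorov: "e \<in> arcs X \<Longrightarrow> c \<in> coords N \<Longrightarrow> weyl N w (M e c) = M e (weyl N (w v* chi e) c)"
begin

primrec transport :: "'e list \<Rightarrow> 'n cop" where
  "transport [] = id"
| "transport (e # p) = M e \<circ> transport p"

lemma transport_append: "transport (p @ q) = transport p \<circ> transport q"
  by (induction p) (simp_all add: o_assoc)

lemma transport_isometric: "set p \<subseteq> arcs X \<Longrightarrow> isometric_op N (transport p)"
  by (induction p) (auto intro!: isometric_op_comp isometric_op_id M_isometric)

lemma transport_coords: "set p \<subseteq> arcs X \<Longrightarrow> c \<in> coords N \<Longrightarrow> transport p c \<in> coords N"
  by (rule isometric_opD(1)[OF transport_isometric])

lemma transport_egorov:
  "set p \<subseteq> arcs X \<Longrightarrow> c \<in> coords N \<Longrightarrow>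
    weyl N w (transport p c) = transport p (weyl N (w v* walk_weight chi p) c)"
  by (induction p arbitrary: w) (simp_all add: egorov transport_coords vector_matrix_mul_assoc)

definition marked_transport :: "int ^ ('n + 'n) \<Rightarrow> 'e list \<Rightarrow> 'e list \<Rightarrow> 'n cop" where
  "marked_transport w r s = transport r \<circ> weyl N w \<circ> transport s"

lemma marked_transport_isometric:
  "set r \<subseteq> arcs X \<Longrightarrow> set s \<subseteq> arcs X \<Longrightarrow> isometric_op N (marked_transport w r s)"
  unfolding marked_transport_def by (intro isometric_op_comp transport_isometric weyl_isometric N)

lemma weyl_commute: "\<exists>z. cmod z = 1 \<and> (\<forall>c. weyl N a (weyl N b c) = (\<lambda>j. z * weyl N b (weyl N a c) j))"
proof -
  obtain z where z: "cmod z = 1" "\<And>c. weyl N a (weyl N b c) = (\<lambda>j. z * weyl N (a + b) c j)"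
    using weyl_mult[OF N] by metis
  obtain z' where z': "cmod z' = 1" "\<And>c. weyl N b (weyl N a c) = (\<lambda>j. z' * weyl N (b + a) c j)"
    using weyl_mult[OF N] by metis
  have "cnj z' * z' = 1" using complex_norm_square[of z'] by (simp add: z' mult.commute)
  hence "weyl N a (weyl N b c) j = (z * cnj z') * weyl N b (weyl N a c) j" for c j
    unfolding z z' by (simp add: add.commute[of b a])
  moreover have "cmod (z * cnj z') = 1" by (simp add: norm_mult z z')
  ultimately show ?thesis by blast
qed

text \<open>
  Inserting a Weyl translation into the transport along a walk does not change which translations are
  moved where, it only contributes a phase.
\<close>

lemma marked_transport_intertwines:
  assumes r: "set r \<subseteq> arcs X" and s: "set s \<subseteq> arcs X"
  shows "intertwines N (marked_transport w r s) (walk_weight chi (r @ s))"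
  unfolding intertwines_def
proof
  fix t
  let ?R = "walk_weight chi r" and ?S = "walk_weight chi s"
  obtain z where z: "cmod z = 1"
    "\<And>c. weyl N (t v* ?R) (weyl N w c) = (\<lambda>j. z * weyl N w (weyl N (t v* ?R) c) j)"
    using weyl_commute by metis
  have "weyl N t (marked_transport w r s c) = (\<lambda>j. z * marked_transport w r s (weyl N (t v* walk_weight chi (r @ s)) c) j)"
    if c: "c \<in> coords N" for c
  proof -
    have tc: "transport s c \<in> coords N" by (rule transport_coords[OF s c])
    have "weyl N t (marked_transport w r s c) = transport r (weyl N (t v* ?R) (weyl N w (transport s c)))"
      unfolding marked_transport_def o_def by (rule transport_egorov[OF r weyl_coords])
    also have "\<dots> = (\<lambda>j. z * transport r (weyl N w (weyl N (t v* ?R) (transport s c))) j)"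
      unfolding z(2) by (rule isometric_opD(3)[OF transport_isometric[OF r] weyl_coords])
    also have "weyl N (t v* ?R) (transport s c) = transport s (weyl N (t v* ?R v* ?S) c)"
      by (rule transport_egorov[OF s c])
    finally show ?thesis
      by (simp add: marked_transport_def walk_weight_append vector_matrix_mul_assoc)
  qed
  thus "\<exists>z. cmod z = 1 \<and> (\<forall>c\<in>coords N. weyl N t (marked_transport w r s c)
      = (\<lambda>j. z * marked_transport w r s (weyl N (t v* walk_weight chi (r @ s)) c) j))"
    using z(1) by blast
qed

end

subsection \<open>The recursion for an eigensection\<close>

locale quantum_eigensection = quantum_graph X rv d chi N M
  for X :: "('v, 'e) pre_digraph" and rv and d and chi :: "'e \<Rightarrow> int ^ ('n::finite + 'n) ^ ('n + 'n)"
    and N and M +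
  fixes u :: "'v \<Rightarrow> int ^ 'n \<Rightarrow> complex" and \<mu> :: complex
  assumes u_coords: "v \<in> verts X \<Longrightarrow> u v \<in> coords N"
    and eigen: "v \<in> verts X \<Longrightarrow> (\<lambda>j. \<Sum>e\<in>out_arcs X v. M e (u (head X e)) j) = (\<lambda>j. \<mu> * u v j)"
    and unit: "(\<Sum>v\<in>verts X. cinner N (u v) (u v)) = 1"
begin

text \<open>
  The eigenvalue equation in the second argument. Transport along \<open>x\<close> is moved to the other side, where
  it becomes transport along the reversed arc.
\<close>

lemma eigen_left:
  assumes v: "v \<in> verts X" and c: "c \<in> coords N"
  shows "(\<Sum>x\<in>in_arcs X v. cinner N (M x c) (u (tail X x))) = cnj \<mu> * cinner N c (u v)"
proof -
  have "(\<Sum>x\<in>in_arcs X v. cinner N (M x c) (u (tail X x)))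
    = (\<Sum>y\<in>out_arcs X v. cinner N (M (rv y) c) (u (tail X (rv y))))"
    unfolding in_arcs_eq by (subst sum.reindex[OF inj_on_arev]) simp
  also have "\<dots> = (\<Sum>y\<in>out_arcs X v. cinner N c (M y (u (head X y))))"
  proof (intro sum.cong refl)
    fix y assume y: "y \<in> out_arcs X v"
    have "cinner N (M (rv y) c) (u (head X y)) = cinner N (M y (M (rv y) c)) (M y (u (head X y)))"
      using y c by (intro isometric_opD(4)[symmetric] M_isometric isometric_opD(1)[OF M_isometric] u_coords) auto
    thus "cinner N (M (rv y) c) (u (tail X (rv y))) = cinner N c (M y (u (head X y)))"
      using y c M_rv[of "rv y" c] by simp
  qed
  also have "\<dots> = cinner N c (\<lambda>j. \<mu> * u v j)"
    unfolding eigen[OF v, symmetric] cinner_sum_right ..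
  finally show ?thesis by (simp add: cinner_cmult_right)
qed

lemma eigen_right:
  assumes v: "v \<in> verts X" and B: "isometric_op N B"
  shows "(\<Sum>x\<in>out_arcs X v. cinner N (B (M x (u (head X x)))) c') = \<mu> * cinner N (B (u v)) c'"
proof -
  have "B (\<lambda>j. \<Sum>x\<in>out_arcs X v. 1 * M x (u (head X x)) j) = (\<lambda>j. \<Sum>x\<in>out_arcs X v. 1 * B (M x (u (head X x))) j)"
    by (rule isometric_op_sum[OF B]) (auto intro!: isometric_opD(1)[OF M_isometric] u_coords)
  hence "(\<lambda>j. \<Sum>x\<in>out_arcs X v. B (M x (u (head X x))) j) = B (\<lambda>j. \<mu> * u v j)"
    by (simp add: eigen[OF v])
  also have "\<dots> = (\<lambda>j. \<mu> * B (u v) j)" by (rule isometric_opD(3)[OF B u_coords[OF v]])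
  finally have "cinner N (\<lambda>j. \<Sum>x\<in>out_arcs X v. B (M x (u (head X x))) j) c' = cinner N (\<lambda>j. \<mu> * B (u v) j) c'" by simp
  thus ?thesis by (simp add: cinner_sum_left cinner_cmult_left)
qed

text \<open>
  The Laplacian is symmetric because reversal of arcs is a bijection that inverts the transports.
\<close>

lemma eigenvalue_real: "cnj \<mu> = \<mu>"
proof -
  let ?h = "\<lambda>x. cinner N (M x (u (head X x))) (u (tail X x))"
  have "cnj \<mu> = (\<Sum>v\<in>verts X. cnj \<mu> * cinner N (u v) (u v))"
    by (simp add: unit flip: sum_distrib_left)
  also have "\<dots> = (\<Sum>v\<in>verts X. \<Sum>x\<in>in_arcs X v. cinner N (M x (u v)) (u (tail X x)))"
    by (simp add: eigen_left u_coords)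
  also have "\<dots> = (\<Sum>v\<in>verts X. \<Sum>x\<in>{x \<in> arcs X. head X x = v}. ?h x)"
    by (intro sum.cong) (auto simp: in_arcs_def)
  also have "\<dots> = sum ?h (arcs X)" by (rule sum.group) auto
  also have "\<dots> = (\<Sum>v\<in>verts X. \<Sum>x\<in>{x \<in> arcs X. tail X x = v}. ?h x)" by (rule sum.group[symmetric]) auto
  also have "\<dots> = (\<Sum>v\<in>verts X. \<Sum>x\<in>out_arcs X v. cinner N (id (M x (u (head X x)))) (u v))"
    by (intro sum.cong) (auto simp: out_arcs_def)
  also have "\<dots> = (\<Sum>v\<in>verts X. \<mu> * cinner N (id (u v)) (u v))"
    by (intro sum.cong refl eigen_right isometric_op_id)
  also have "\<dots> = \<mu>" by (simp add: unit flip: sum_distrib_left)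
  finally show ?thesis .
qed

lemma left_recursion_step:
  assumes e: "e \<in> arcs X" and c: "c \<in> coords N" and r: "r \<in> left_ext e k"
  defines "y \<equiv> hd (r @ [e])"
  shows "(\<Sum>x\<in>prev_arcs y. cinner N (transport (x # r) c) (u (tail X x)))
     + cinner N (M (rv y) (transport r c)) (u (head X y)) = cnj \<mu> * cinner N (transport r c) (u (tail X y))"
proof -
  have y: "y \<in> arcs X" unfolding y_def by (rule hd_left_ext[OF r])
  have "set r \<subseteq> arcs X" using r by (auto simp: left_ext_def nonbacktracking_def)
  hence t: "transport r c \<in> coords N" using c by (rule transport_coords)
  have "rv y \<notin> prev_arcs y" by (simp add: prev_arcs_def)
  thus ?thesis using eigen_left[OF _ t, of "tail X y"] y in_arcs_decompose[OF y]
    by (simp add: add.commute)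
qed

text \<open>
  Apply the eigenvalue equation at the initial vertex of each walk. The arcs that end there are the
  \<open>d - 1\<close> nonbacktracking prolongations and the reverse of the first arc, which cancels that arc. Every
  shortened walk arises from \<open>d - 1\<close> walks. A walk that consists of \<open>e\<close> alone cannot be shortened, and
  leaves the boundary term.
\<close>

lemma left_recursion:
  assumes e: "e \<in> arcs X" and c: "c \<in> coords N"
  defines "\<psi> \<equiv> \<lambda>r. cinner N (transport r c) (u (tail X (hd (r @ [e]))))"
  shows "sum \<psi> (left_ext e 1) + cinner N (M (rv e) c) (u (head X e)) = cnj \<mu> * sum \<psi> (left_ext e 0)"
    and "sum \<psi> (left_ext e (Suc (Suc k))) + of_nat (d - 1) * sum \<psi> (left_ext e k) = cnj \<mu> * sum \<psi> (left_ext e (Suc k))"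
proof -
  have step: "sum \<psi> (left_ext e (Suc m)) + (\<Sum>r\<in>left_ext e m. cinner N (M (rv (hd (r @ [e]))) (transport r c)) (u (head X (hd (r @ [e])))))
    = cnj \<mu> * sum \<psi> (left_ext e m)" for m
    unfolding sum_left_ext_Suc sum_distrib_left sum.distrib[symmetric] \<psi>_def
    using left_recursion_step[OF e c] by (intro sum.cong refl) simp
  show "sum \<psi> (left_ext e 1) + cinner N (M (rv e) c) (u (head X e)) = cnj \<mu> * sum \<psi> (left_ext e 0)"
    using step[of 0] by (simp add: left_ext_0[OF e])
  have "(\<Sum>r\<in>left_ext e (Suc k). cinner N (M (rv (hd (r @ [e]))) (transport r c)) (u (head X (hd (r @ [e])))))
    = (\<Sum>r\<in>left_ext e k. \<Sum>x\<in>prev_arcs (hd (r @ [e])). \<psi> r)"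
    unfolding sum_left_ext_Suc
  proof (intro sum.cong refl)
    fix r x assume r: "r \<in> left_ext e k" and x: "x \<in> prev_arcs (hd (r @ [e]))"
    have "set r \<subseteq> arcs X" using r by (auto simp: left_ext_def nonbacktracking_def)
    hence t: "transport r c \<in> coords N" using c by (rule transport_coords)
    have "x \<in> arcs X" "head X x = tail X (hd (r @ [e]))" using x by (auto simp: prev_arcs_def)
    thus "cinner N (M (rv (hd ((x # r) @ [e]))) (transport (x # r) c)) (u (head X (hd ((x # r) @ [e])))) = \<psi> r"
      by (simp add: M_rv t \<psi>_def)
  qed
  also have "\<dots> = of_nat (d - 1) * sum \<psi> (left_ext e k)"
    unfolding sum_distrib_left by (intro sum.cong refl) (simp add: in_arcs_decompose(3) hd_left_ext)
  finally show "sum \<psi> (left_ext e (Suc (Suc k))) + of_nat (d - 1) * sum \<psi> (left_ext e k) = cnj \<mu> * sum \<psi> (left_ext e (Suc k))"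
    using step[of "Suc k"] by simp
qed

lemma right_recursion:
  fixes c' :: "int ^ 'n \<Rightarrow> complex"
  assumes e: "e \<in> arcs X" and B: "isometric_op N B"
  defines "\<psi> \<equiv> \<lambda>s. cinner N (B (transport (e # s) (u (head X (last (e # s)))))) c'"
  shows "sum \<psi> (right_ext e 1) + cinner N (B (u (tail X e))) c' = \<mu> * sum \<psi> (right_ext e 0)"
    and "sum \<psi> (right_ext e (Suc (Suc k))) + of_nat (d - 1) * sum \<psi> (right_ext e k) = \<mu> * sum \<psi> (right_ext e (Suc k))"
proof -
  let ?b = "\<lambda>s. cinner N (B (transport (e # s) (M (rv (last (e # s))) (u (tail X (last (e # s))))))) c'"
  have step1: "(\<Sum>x\<in>next_arcs (last (e # s)). \<psi> (s @ [x])) + ?b s = \<mu> * \<psi> s" if s: "s \<in> right_ext e m" for s m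
  proof -
    let ?y = "last (e # s)"
    have y: "?y \<in> arcs X" by (rule last_right_ext[OF s])
    have "set (e # s) \<subseteq> arcs X" using s by (auto simp: right_ext_def nonbacktracking_def)
    hence Bt: "isometric_op N (B \<circ> transport (e # s))" by (intro isometric_op_comp B transport_isometric)
    have a: "\<psi> (s @ [x]) = cinner N ((B \<circ> transport (e # s)) (M x (u (head X x)))) c'" for x
      by (simp add: \<psi>_def transport_append)
    have n: "rv ?y \<notin> next_arcs ?y" by (simp add: next_arcs_def)
    have "(\<Sum>x\<in>out_arcs X (head X ?y). cinner N ((B \<circ> transport (e # s)) (M x (u (head X x)))) c')
       = \<mu> * cinner N ((B \<circ> transport (e # s)) (u (head X ?y))) c'"
      using y by (intro eigen_right Bt) auto
    thus ?thesis unfolding a out_arcs_decompose(1)[OF y]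
      using n y out_arcs_decompose(2)[OF y] by (simp add: \<psi>_def add.commute del: last.simps transport.simps)
  qed
  have step: "sum \<psi> (right_ext e (Suc m)) + (\<Sum>s\<in>right_ext e m. ?b s) = \<mu> * sum \<psi> (right_ext e m)" for m
    unfolding sum_right_ext_Suc sum_distrib_left sum.distrib[symmetric]
    using step1 by (intro sum.cong refl)
  show "sum \<psi> (right_ext e 1) + cinner N (B (u (tail X e))) c' = \<mu> * sum \<psi> (right_ext e 0)"
    using step[of 0] e M_rv[of "rv e" "u (tail X e)"] by (simp add: right_ext_0 u_coords)
  have "(\<Sum>s\<in>right_ext e (Suc k). ?b s) = (\<Sum>s\<in>right_ext e k. \<Sum>x\<in>next_arcs (last (e # s)). \<psi> s)"
    unfolding sum_right_ext_Suc
  proof (intro sum.cong refl)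
    fix s x assume s: "s \<in> right_ext e k" and x: "x \<in> next_arcs (last (e # s))"
    have x': "x \<in> arcs X" "tail X x = head X (last (e # s))" using x by (auto simp: next_arcs_def)
    have "u (tail X x) \<in> coords N" by (rule u_coords[OF tail_in_verts[OF x'(1)]])
    hence "M x (M (rv x) (u (tail X x))) = u (tail X x)"
      using M_rv[of "rv x" "u (tail X x)"] x'(1) by simp
    moreover have "last (e # s @ [x]) = x" by simp
    ultimately show "?b (s @ [x]) = \<psi> s"
      using x' by (simp add: \<psi>_def transport_append del: last.simps)
  qed
  also have "\<dots> = of_nat (d - 1) * sum \<psi> (right_ext e k)"
    unfolding sum_distrib_left by (intro sum.cong refl) (simp add: out_arcs_decompose(3) last_right_ext del: last.simps)
  finally show "sum \<psi> (right_ext e (Suc (Suc k))) + of_nat (d - 1) * sum \<psi> (right_ext e k) = \<mu> * sum \<psi> (right_ext e (Suc k))"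
    using step[of "Suc k"] by simp
qed

definition walk_sum :: "int ^ ('n + 'n) \<Rightarrow> 'e \<Rightarrow> nat \<Rightarrow> nat \<Rightarrow> complex" where
  "walk_sum w e a b = (\<Sum>r\<in>left_ext e a. \<Sum>s\<in>right_ext e b.
     cinner N (marked_transport w r (e # s) (u (head X (last (e # s))))) (u (tail X (hd (r @ [e])))))"

text \<open>
  Both recursions express a multiple of the same sum, one by the real number \<open>\<mu>\<close> and one by its
  conjugate. For walks with equally many arcs on the two sides of \<open>e\<close> they can be equated, and the
  eigenvalue drops out: the difference on the left is multiplied by \<open>d - 1\<close> when \<open>k\<close> increases. The two
  boundary terms provide its value for \<open>k = 0\<close>. In operator terms this writes the difference of two
  observables, up to a small remainder, as a commutator with the Laplacian.
\<close>

lemma walk_sum_difference: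
  assumes e: "e \<in> arcs X"
  shows "walk_sum w e k (Suc k) - walk_sum w e (Suc k) k = of_nat (d - 1) ^ k *
     (cinner N (weyl N (w v* chi e) (u (head X e))) (u (head X e)) - cinner N (weyl N w (u (tail X e))) (u (tail X e)))"
proof -
  have uh: "u (head X e) \<in> coords N" "u (tail X e) \<in> coords N" using e by (auto intro: u_coords)
  have left: "walk_sum w e (Suc (Suc a)) b + of_nat (d - 1) * walk_sum w e a b = cnj \<mu> * walk_sum w e (Suc a) b"
    and left0: "walk_sum w e 1 0 + cinner N (weyl N (w v* chi e) (u (head X e))) (u (head X e)) = cnj \<mu> * walk_sum w e 0 0"
    for a b
  proof -
    have W: "walk_sum w e a b = (\<Sum>s\<in>right_ext e b. \<Sum>r\<in>left_ext e a.
        cinner N (transport r (weyl N w (transport (e # s) (u (head X (last (e # s))))))) (u (tail X (hd (r @ [e])))))" for a b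
      unfolding walk_sum_def marked_transport_def o_def by (rule sum.swap)
    show "walk_sum w e (Suc (Suc a)) b + of_nat (d - 1) * walk_sum w e a b = cnj \<mu> * walk_sum w e (Suc a) b"
      unfolding W sum_distrib_left[of _ _ "right_ext e b"] sum.distrib[symmetric]
      by (intro sum.cong refl left_recursion(2)[OF e weyl_coords])
    have "M (rv e) (weyl N w (M e (u (head X e)))) = weyl N (w v* chi e) (u (head X e))"
      using e by (simp add: egorov uh M_rv)
    thus "walk_sum w e 1 0 + cinner N (weyl N (w v* chi e) (u (head X e))) (u (head X e)) = cnj \<mu> * walk_sum w e 0 0"
      unfolding W using left_recursion(1)[OF e weyl_coords, of w "M e (u (head X e))"] by (simp add: right_ext_0[OF e])
  qed
  have right: "walk_sum w e a (Suc (Suc b)) + of_nat (d - 1) * walk_sum w e a b = \<mu> * walk_sum w e a (Suc b)"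
    and right0: "walk_sum w e 0 1 + cinner N (weyl N w (u (tail X e))) (u (tail X e)) = \<mu> * walk_sum w e 0 0"
    for a b
  proof -
    have W: "walk_sum w e a b = (\<Sum>r\<in>left_ext e a. \<Sum>s\<in>right_ext e b.
        cinner N ((transport r \<circ> weyl N w) (transport (e # s) (u (head X (last (e # s)))))) (u (tail X (hd (r @ [e])))))" for a b
      unfolding walk_sum_def marked_transport_def o_def ..
    have iso: "isometric_op N (transport r \<circ> weyl N w)" if "r \<in> left_ext e a" for r a
      using that by (intro isometric_op_comp transport_isometric weyl_isometric N) (auto simp: left_ext_def nonbacktracking_def)
    show "walk_sum w e a (Suc (Suc b)) + of_nat (d - 1) * walk_sum w e a b = \<mu> * walk_sum w e a (Suc b)"
      unfolding W sum_distrib_left[of _ _ "left_ext e a"] sum.distrib[symmetric]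
      by (intro sum.cong refl right_recursion(2)[OF e iso])
    show "walk_sum w e 0 1 + cinner N (weyl N w (u (tail X e))) (u (tail X e)) = \<mu> * walk_sum w e 0 0"
      unfolding W using right_recursion(1)[OF e weyl_isometric[OF N], of w "u (tail X e)"] by (simp add: left_ext_0[OF e] del: One_nat_def)
  qed
  show ?thesis
  proof (induction k)
    case 0
    show ?case using left0 right0 by (simp add: eigenvalue_real algebra_simps)
  next
    case (Suc k)
    have "walk_sum w e (Suc k) (Suc (Suc k)) + of_nat (d - 1) * walk_sum w e (Suc k) k
      = walk_sum w e (Suc (Suc k)) (Suc k) + of_nat (d - 1) * walk_sum w e k (Suc k)"
      using left[of k "Suc k"] right[of "Suc k" k] by (simp only: eigenvalue_real)
    hence "walk_sum w e (Suc k) (Suc (Suc k)) - walk_sum w e (Suc (Suc k)) (Suc k)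
      = of_nat (d - 1) * (walk_sum w e k (Suc k) - walk_sum w e (Suc k) k)"
      by (simp add: algebra_simps)
    thus ?case using Suc by simp
  qed
qed

end

section \<open>Vanishing quantum variance of the Fourier modes\<close>

lemma hs_asymptotically_small:
  fixes E E' :: "int ^ ('n::finite + 'n) ^ ('n + 'n)"
  assumes E: "E \<noteq> E'" and \<epsilon>: "\<epsilon> > 0"
  shows "\<exists>N0. \<forall>N\<ge>N0. \<forall>A A'. isometric_op N A \<longrightarrow> isometric_op N A' \<longrightarrow> intertwines N A E \<longrightarrow>
     intertwines N A' E' \<longrightarrow> cmod (hs N A A') \<le> \<epsilon> * real N ^ CARD('n)"
proof -
  \<comment> \<open>A unit vector that \<open>E\<close> and \<open>E'\<close> move differently.\<close>
  obtain i j where ij: "E $ i $ j \<noteq> E' $ i $ j" using E by (auto simp: vec_eq_iff)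
  define v :: "int ^ ('n + 'n)" where "v = axis i 1"
  let ?w = "v v* E - v v* E'"
  have vm: "(v v* B) $ j = B $ i $ j" for B :: "int ^ ('n + 'n) ^ ('n + 'n)"
  proof -
    have "(v v* B) $ j = (\<Sum>k\<in>UNIV. if k = i then B $ k $ j else 0)"
      unfolding v_def vector_matrix_mult_def axis_def vec_lambda_beta by (intro sum.cong refl) auto
    thus ?thesis by simp
  qed
  have "?w $ j = E $ i $ j - E' $ i $ j" by (simp add: vm)
  hence w: "?w \<noteq> 0" using ij by (metis eq_iff_diff_eq_0 zero_index)
  define L where "L = Suc (nat \<lceil>1 / \<epsilon>\<^sup>2\<rceil>)"
  have L: "L > 0" "1 / \<epsilon>\<^sup>2 \<le> real L" unfolding L_def by linarith+
  \<comment> \<open>Beyond this threshold the multiples of \<open>?w\<close> by \<open>0, ..., L - 1\<close> are distinct modulo \<open>N\<close>.\<close>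
  define N0 where "N0 = Suc (nat (\<Sum>k\<in>UNIV. int L * \<bar>?w $ k\<bar>))"
  show ?thesis
  proof (intro exI[of _ N0] allI impI)
    fix N and A A' :: "'n cop"
    assume N: "N \<ge> N0" and A: "isometric_op N A" "isometric_op N A'" "intertwines N A E" "intertwines N A' E'"
    have "int L * \<bar>?w $ k\<bar> < int N" for k
    proof -
      have "int L * \<bar>?w $ k\<bar> \<le> (\<Sum>k\<in>UNIV. int L * \<bar>?w $ k\<bar>)" by (rule member_le_sum) auto
      also have "\<dots> < int N" using N by (simp add: N0_def)
      finally show ?thesis .
    qed
    moreover have "N > 0" using N by (simp add: N0_def)
    ultimately have "real L * (cmod (hs N A A'))\<^sup>2 \<le> (real N ^ CARD('n))\<^sup>2"
      using hs_small[of N A A' E E' v L] A w L(1) by simp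
    moreover have "1 / \<epsilon>\<^sup>2 * (cmod (hs N A A'))\<^sup>2 \<le> real L * (cmod (hs N A A'))\<^sup>2"
      using L(2) by (rule mult_right_mono) simp
    ultimately have "1 / \<epsilon>\<^sup>2 * (cmod (hs N A A'))\<^sup>2 \<le> (real N ^ CARD('n))\<^sup>2" by (rule order_trans[rotated])
    hence "\<epsilon>\<^sup>2 * (1 / \<epsilon>\<^sup>2 * (cmod (hs N A A'))\<^sup>2) \<le> \<epsilon>\<^sup>2 * (real N ^ CARD('n))\<^sup>2"
      by (rule mult_left_mono) simp
    moreover have "\<epsilon>\<^sup>2 * (1 / \<epsilon>\<^sup>2 * (cmod (hs N A A'))\<^sup>2) = (cmod (hs N A A'))\<^sup>2" using \<epsilon> by simp
    ultimately have "(cmod (hs N A A'))\<^sup>2 \<le> (\<epsilon> * real N ^ CARD('n))\<^sup>2" by (simp only: power_mult_distrib)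
    thus "cmod (hs N A A') \<le> \<epsilon> * real N ^ CARD('n)"
      by (rule power2_le_imp_le[OF _ mult_nonneg_nonneg[OF less_imp_le[OF \<epsilon>] zero_le_power[OF of_nat_0_le_iff]]])
  qed
qed

context weighted_graph
begin

definition eigensystem :: "nat \<Rightarrow> ('e \<Rightarrow> 'n cop) \<Rightarrow> nat set \<Rightarrow> (nat \<Rightarrow> 'v \<Rightarrow> int ^ 'n \<Rightarrow> complex) \<Rightarrow> bool" where
  "eigensystem N M I u \<longleftrightarrow> finite I \<and> card I \<le> card (verts X) * N ^ CARD('n) \<and>
     quantum_graph X rv d chi N M \<and>
     (\<forall>i\<in>I. \<exists>\<mu>. quantum_eigensection X rv d chi N M (u i) \<mu>) \<and>
     (\<forall>i\<in>I. \<forall>j\<in>I. (\<Sum>v\<in>verts X. cinner N (u i v) (u j v)) = (if i = j then 1 else 0))"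

lemma eigensystem_coords:
  assumes "eigensystem N M I u" "i \<in> I" "v \<in> verts X" shows "u i v \<in> coords N"
proof -
  obtain \<mu> where "quantum_eigensection X rv d chi N M (u i) \<mu>" using assms unfolding eigensystem_def by blast
  then interpret quantum_eigensection X rv d chi N M "u i" \<mu> .
  show ?thesis using assms(3) by (rule u_coords)
qed

text \<open>
  An eigensystem has at most \<open>card (verts X) * N ^ n\<close> members, so the normalization by \<open>N ^ n\<close> turns
  the sum into a mean square, up to a constant. The threshold for \<open>N\<close> must not
  depend on the eigensystem, since nothing relates the eigensections for different \<open>N\<close>.
\<close>

definition variance_bound ::
  "(nat \<Rightarrow> ('e \<Rightarrow> 'n cop) \<Rightarrow> ('v \<Rightarrow> int ^ 'n \<Rightarrow> complex) \<Rightarrow> complex) \<Rightarrow> real \<Rightarrow> bool" where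
  "variance_bound Z C \<longleftrightarrow> (\<exists>N0. \<forall>N\<ge>N0. \<forall>M I u. eigensystem N M I u \<longrightarrow>
     (\<Sum>i\<in>I. (cmod (Z N M (u i)))\<^sup>2) \<le> C * real N ^ CARD('n))"

definition negligible_variance :: "(nat \<Rightarrow> ('v \<Rightarrow> int ^ 'n \<Rightarrow> complex) \<Rightarrow> complex) \<Rightarrow> bool" where
  "negligible_variance Z \<longleftrightarrow> (\<forall>\<epsilon>>0. variance_bound (\<lambda>N M u. Z N u) \<epsilon>)"

lemma variance_bound_mono:
  assumes "variance_bound Z C" "C \<le> C'" shows "variance_bound Z C'"
proof -
  obtain N0 where N0: "\<And>N M I u. N \<ge> N0 \<Longrightarrow> eigensystem N M I u \<Longrightarrow> (\<Sum>i\<in>I. (cmod (Z N M (u i)))\<^sup>2) \<le> C * real N ^ CARD('n)"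
    using assms(1) unfolding variance_bound_def by blast
  have C: "C * real N ^ CARD('n) \<le> C' * real N ^ CARD('n)" for N using assms(2) by (intro mult_right_mono) auto
  show ?thesis unfolding variance_bound_def using order_trans[OF N0 C] by blast
qed

lemma variance_bound_cong:
  assumes "variance_bound Z C"
    and eq: "\<And>N M u \<mu>. quantum_eigensection X rv d chi N M u \<mu> \<Longrightarrow> Z' N M u = Z N M u"
  shows "variance_bound Z' C"
proof -
  have "(\<Sum>i\<in>I. (cmod (Z' N M (u i)))\<^sup>2) = (\<Sum>i\<in>I. (cmod (Z N M (u i)))\<^sup>2)" if u: "eigensystem N M I u" for N M I u
  proof (intro sum.cong refl)
    fix i assume "i \<in> I"
    with u obtain \<mu> where "quantum_eigensection X rv d chi N M (u i) \<mu>" unfolding eigensystem_def by blast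
    thus "(cmod (Z' N M (u i)))\<^sup>2 = (cmod (Z N M (u i)))\<^sup>2" using eq by simp
  qed
  thus ?thesis using assms(1) unfolding variance_bound_def by simp
qed

lemma variance_bound_add:
  assumes "variance_bound Z C" "variance_bound Z' C'"
  shows "variance_bound (\<lambda>N M u. Z N M u + Z' N M u) (2 * C + 2 * C')"
proof -
  obtain N0 N1 where N0: "\<And>N M I u. N \<ge> N0 \<Longrightarrow> eigensystem N M I u \<Longrightarrow> (\<Sum>i\<in>I. (cmod (Z N M (u i)))\<^sup>2) \<le> C * real N ^ CARD('n)"
    and N1: "\<And>N M I u. N \<ge> N1 \<Longrightarrow> eigensystem N M I u \<Longrightarrow> (\<Sum>i\<in>I. (cmod (Z' N M (u i)))\<^sup>2) \<le> C' * real N ^ CARD('n)"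
    using assms unfolding variance_bound_def by blast
  show ?thesis
    unfolding variance_bound_def
  proof (intro exI[of _ "max N0 N1"] allI impI)
    fix N M I u assume N: "N \<ge> max N0 N1" and u: "eigensystem N M I u"
    have square: "(cmod (x + y))\<^sup>2 \<le> 2 * (cmod x)\<^sup>2 + 2 * (cmod y)\<^sup>2" for x y
    proof -
      have "(cmod (x + y))\<^sup>2 \<le> (cmod x + cmod y)\<^sup>2" by (intro power_mono norm_triangle_ineq) simp
      also have "\<dots> \<le> 2 * (cmod x)\<^sup>2 + 2 * (cmod y)\<^sup>2"
        using sum_squares_bound[of "cmod x" "cmod y"] unfolding power2_sum by linarith
      finally show ?thesis .
    qed
    have "(\<Sum>i\<in>I. (cmod (Z N M (u i) + Z' N M (u i)))\<^sup>2)
      \<le> 2 * (\<Sum>i\<in>I. (cmod (Z N M (u i)))\<^sup>2) + 2 * (\<Sum>i\<in>I. (cmod (Z' N M (u i)))\<^sup>2)"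
      unfolding sum_distrib_left sum.distrib[symmetric] by (intro sum_mono square)
    also have "\<dots> \<le> (2 * C + 2 * C') * real N ^ CARD('n)"
      using N0[OF _ u] N1[OF _ u] N by (simp add: ring_distribs)
    finally show "(\<Sum>i\<in>I. (cmod (Z N M (u i) + Z' N M (u i)))\<^sup>2) \<le> (2 * C + 2 * C') * real N ^ CARD('n)" .
  qed
qed

lemma variance_bound_cmult:
  assumes "variance_bound Z C" shows "variance_bound (\<lambda>N M u. c * Z N M u) ((cmod c)\<^sup>2 * C)"
proof -
  have "(\<Sum>i\<in>I. (cmod (c * Z N M (u i)))\<^sup>2) = (cmod c)\<^sup>2 * (\<Sum>i\<in>I. (cmod (Z N M (u i)))\<^sup>2)" for N M I u
    by (simp add: norm_mult power_mult_distrib sum_distrib_left)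
  thus ?thesis using assms mult_left_mono[of _ _ "(cmod c)\<^sup>2"]
    unfolding variance_bound_def mult.assoc by (metis zero_le_power2)
qed

lemma negligible_variance_zero: "negligible_variance (\<lambda>N u. 0)"
  by (auto simp: negligible_variance_def variance_bound_def intro!: mult_nonneg_nonneg)

lemma negligible_variance_cong:
  assumes "negligible_variance Z"
    and "\<And>N M u \<mu>. quantum_eigensection X rv d chi N M u \<mu> \<Longrightarrow> Z' N u = Z N u"
  shows "negligible_variance Z'"
  unfolding negligible_variance_def
proof (intro allI impI)
  fix \<epsilon> :: real assume "\<epsilon> > 0"
  hence "variance_bound (\<lambda>N M u. Z N u) \<epsilon>" using assms(1) by (simp add: negligible_variance_def)
  thus "variance_bound (\<lambda>N M u. Z' N u) \<epsilon>" by (rule variance_bound_cong) (rule assms(2))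
qed

lemma negligible_varianceI_approx:
  assumes "\<And>\<epsilon>. \<epsilon> > 0 \<Longrightarrow> \<exists>Z. variance_bound (\<lambda>N M u. Z N u) \<epsilon> \<and> negligible_variance (\<lambda>N u. Y N u - Z N u)"
  shows "negligible_variance Y"
  unfolding negligible_variance_def
proof (intro allI impI)
  fix \<epsilon> :: real assume "\<epsilon> > 0"
  hence e: "\<epsilon> / 4 > 0" by simp
  obtain Z where Z: "variance_bound (\<lambda>N M u. Z N u) (\<epsilon> / 4)" "negligible_variance (\<lambda>N u. Y N u - Z N u)"
    using assms[OF e] by blast
  have "variance_bound (\<lambda>N M u. Y N u - Z N u) (\<epsilon> / 4)" using Z(2) e unfolding negligible_variance_def by blast
  from variance_bound_add[OF this Z(1)] show "variance_bound (\<lambda>N M u. Y N u) \<epsilon>" by simp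
qed

lemma negligible_variance_add:
  assumes "negligible_variance Z" "negligible_variance Z'"
  shows "negligible_variance (\<lambda>N u. Z N u + Z' N u)"
proof (rule negligible_varianceI_approx)
  fix \<epsilon> :: real assume "\<epsilon> > 0"
  thus "\<exists>Z''. variance_bound (\<lambda>N M u. Z'' N u) \<epsilon> \<and> negligible_variance (\<lambda>N u. Z N u + Z' N u - Z'' N u)"
    using assms by (intro exI[of _ Z']) (simp add: negligible_variance_def)
qed

lemma negligible_variance_cmult:
  assumes "negligible_variance Z" shows "negligible_variance (\<lambda>N u. c * Z N u)"
  unfolding negligible_variance_def
proof (intro allI impI)
  fix \<epsilon> :: real assume e: "\<epsilon> > 0"
  have c: "(cmod c)\<^sup>2 + 1 > 0" by (rule add_nonneg_pos) auto
  hence "variance_bound (\<lambda>N M u. Z N u) (\<epsilon> / ((cmod c)\<^sup>2 + 1))"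
    using assms e unfolding negligible_variance_def by (meson divide_pos_pos)
  from variance_bound_cmult[OF this, of c] show "variance_bound (\<lambda>N M u. c * Z N u) \<epsilon>"
    by (rule variance_bound_mono) (use e c in \<open>simp add: field_simps\<close>)
qed

lemma negligible_variance_sum:
  assumes "finite S" "\<And>s. s \<in> S \<Longrightarrow> negligible_variance (Z s)"
  shows "negligible_variance (\<lambda>N u. \<Sum>s\<in>S. Z s N u)"
  using assms
  by (induction S rule: finite_induct) (auto intro: negligible_variance_zero negligible_variance_add)

subsection \<open>Families of nonbacktracking walks\<close>

text \<open>
  By \<open>block_bessel\<close> the sum is bounded by the pairwise Hilbert-Schmidt products. Distinct walks with the
  same ends have distinct weights, so their products are negligible and only the diagonal terms
  \<open>(cmod (c p))\<^sup>2\<close> survive.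
\<close>

lemma walk_family_variance:
  fixes c :: "'e list \<times> 'e list \<Rightarrow> complex"
  assumes biv: "BIV X rv b chi" and b: "b \<in> verts X" and P: "finite P"
    and walks: "\<And>r s. (r, s) \<in> P \<Longrightarrow> nonbacktracking (r @ e # s)"
    and inj: "inj_on (\<lambda>(r, s). r @ e # s) P" and \<epsilon>: "\<epsilon> > 0"
  shows "variance_bound (\<lambda>N M u. \<Sum>p\<in>P. c p * cinner N (quantum_graph.marked_transport N M w (fst p) (e # snd p)
       (u (head X (last (e # snd p))))) (u (tail X (hd (fst p @ [e]))))) ((\<Sum>p\<in>P. (cmod (c p))\<^sup>2) + \<epsilon>)"
proof -
  let ?src = "\<lambda>p. head X (last (e # snd p))" and ?tgt = "\<lambda>p. tail X (hd (fst p @ [e]))"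
  let ?C = "\<Sum>p\<in>P. \<Sum>q\<in>P. cmod (c p) * cmod (c q)"
  let ?walk = "\<lambda>p. fst p @ e # snd p"
  have C: "?C + 1 > 0" by (intro add_nonneg_pos sum_nonneg) auto
  \<comment> \<open>The products of distinct walks enter with coefficients of total size \<open>?C\<close>.\<close>
  define \<delta> where "\<delta> = \<epsilon> / (?C + 1)"
  have \<delta>: "\<delta> > 0" using \<epsilon> C by (simp add: \<delta>_def)
  have walks': "nonbacktracking (?walk p)" if "p \<in> P" for p using walks[of "fst p" "snd p"] that by simp
  have "\<exists>N0. \<forall>N\<ge>N0. \<forall>A A'. isometric_op N A \<longrightarrow> isometric_op N A' \<longrightarrow> intertwines N A (walk_weight chi (?walk p)) \<longrightarrow>
     intertwines N A' (walk_weight chi (?walk q)) \<longrightarrow> cmod (hs N A A') \<le> \<delta> * real N ^ CARD('n)"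
    if "p \<in> P" "q \<in> P" "p \<noteq> q" "?src p = ?src q" "?tgt p = ?tgt q" for p q
  proof (rule hs_asymptotically_small[OF _ \<delta>])
    have "?walk p \<noteq> ?walk q" using inj that(1-3) by (auto simp: inj_on_def case_prod_beta)
    moreover have "tail X (hd (?walk p)) = tail X (hd (?walk q))" using that(5) by (cases "fst p"; cases "fst q") auto
    moreover have "head X (last (?walk p)) = head X (last (?walk q))" using that(4) by simp
    ultimately show "walk_weight chi (?walk p) \<noteq> walk_weight chi (?walk q)"
      using nonbacktracking_weights_distinct[OF biv b walks'[OF that(1)] _ walks'[OF that(2)]] by blast
  qed
  then obtain K where K: "\<And>p q N A A'. p \<in> P \<Longrightarrow> q \<in> P \<Longrightarrow> p \<noteq> q \<Longrightarrow> ?src p = ?src q \<Longrightarrow> ?tgt p = ?tgt q \<Longrightarrow> N \<ge> K p q \<Longrightarrow>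
     isometric_op N A \<Longrightarrow> isometric_op N A' \<Longrightarrow> intertwines N A (walk_weight chi (?walk p)) \<Longrightarrow>
     intertwines N A' (walk_weight chi (?walk q)) \<Longrightarrow> cmod (hs N A A') \<le> \<delta> * real N ^ CARD('n)"
    by metis
  define N0 where "N0 = (\<Sum>p\<in>P. \<Sum>q\<in>P. K p q)"
  have N0: "K p q \<le> N0" if "p \<in> P" "q \<in> P" for p q
  proof -
    have "K p q \<le> (\<Sum>q\<in>P. K p q)" using that P by (intro member_le_sum) auto
    also have "\<dots> \<le> N0" unfolding N0_def using that P by (intro member_le_sum[where f = "\<lambda>p. \<Sum>q\<in>P. K p q"]) auto
    finally show ?thesis .
  qed
  show ?thesis
    unfolding variance_bound_def
  proof (intro exI[of _ N0] allI impI)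
    fix N M I u assume NN: "N \<ge> N0" and u: "eigensystem N M I u"
    interpret quantum_graph X rv d chi N M using u by (simp add: eigensystem_def)
    define A where "A = (\<lambda>p. marked_transport w (fst p) (e # snd p))"
    have sets: "set (fst p) \<subseteq> arcs X" "set (e # snd p) \<subseteq> arcs X" if "p \<in> P" for p
      using walks'[OF that] by (auto simp: nonbacktracking_def)
    have A: "isometric_op N (A p)" "intertwines N (A p) (walk_weight chi (?walk p))" if "p \<in> P" for p
      unfolding A_def
      by (rule marked_transport_isometric[OF sets[OF that]], rule marked_transport_intertwines[OF sets[OF that]])
    have st: "?src p \<in> verts X \<and> ?tgt p \<in> verts X" if "p \<in> P" for p
    proof -
      have "last (e # snd p) \<in> arcs X" "hd (fst p @ [e]) \<in> arcs X"
        using sets[OF that] last_in_set[of "e # snd p"] hd_in_set[of "fst p @ [e]"] by (auto simp del: last.simps)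
      thus ?thesis by (metis head_in_verts tail_in_verts)
    qed
    have "(\<Sum>i\<in>I. (cmod (\<Sum>p\<in>P. c p * cinner N (A p (u i (?src p))) (u i (?tgt p))))\<^sup>2)
      \<le> (\<Sum>p\<in>P. \<Sum>q\<in>P. cmod (c p) * cmod (c q) *
            (if ?src p = ?src q \<and> ?tgt p = ?tgt q then cmod (hs N (A p) (A q)) else 0))"
      by (rule block_bessel[where V = "verts X"])
         (use u P A st in \<open>auto simp: eigensystem_def intro: eigensystem_coords[OF u]\<close>)
    also have "\<dots> \<le> (\<Sum>p\<in>P. \<Sum>q\<in>P. cmod (c p) * cmod (c q) * ((if p = q then 1 else 0) + \<delta>) * real N ^ CARD('n))"
    proof (intro sum_mono)
      fix p q assume p: "p \<in> P" and q: "q \<in> P"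
      have "(if ?src p = ?src q \<and> ?tgt p = ?tgt q then cmod (hs N (A p) (A q)) else 0) \<le> ((if p = q then 1 else 0) + \<delta>) * real N ^ CARD('n)"
      proof (cases "p = q")
        case True
        have "cmod (hs N (A p) (A q)) = real N ^ CARD('n)" by (simp add: True hs_self A q norm_power)
        thus ?thesis using True \<delta> by (simp add: ring_distribs)
      next
        case False
        show ?thesis
        proof (cases "?src p = ?src q \<and> ?tgt p = ?tgt q")
          case True
          hence "cmod (hs N (A p) (A q)) \<le> \<delta> * real N ^ CARD('n)"
            by (intro K[OF p q False conjunct1[OF True] conjunct2[OF True] order_trans[OF N0[OF p q] NN]] A p q)
          thus ?thesis using False True by simp
        next
          case F: False
          thus ?thesis using False \<delta> by (simp only: if_False) simp
        qed
      qed
      thus "cmod (c p) * cmod (c q) * (if ?src p = ?src q \<and> ?tgt p = ?tgt q then cmod (hs N (A p) (A q)) else 0)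
        \<le> cmod (c p) * cmod (c q) * ((if p = q then 1 else 0) + \<delta>) * real N ^ CARD('n)"
        unfolding mult.assoc by (intro mult_left_mono) auto
    qed
    also have "\<dots> = ((\<Sum>p\<in>P. (cmod (c p))\<^sup>2) + \<delta> * ?C) * real N ^ CARD('n)"
    proof -
      have "(\<Sum>q\<in>P. cmod (c p) * cmod (c q) * ((if p = q then 1 else 0) + \<delta>)) = (cmod (c p))\<^sup>2 + \<delta> * (\<Sum>q\<in>P. cmod (c p) * cmod (c q))"
        if p: "p \<in> P" for p
      proof -
        have "(\<Sum>q\<in>P. cmod (c p) * cmod (c q) * ((if p = q then 1 else 0) + \<delta>))
          = (\<Sum>q\<in>P. (if p = q then (cmod (c p))\<^sup>2 else 0) + \<delta> * (cmod (c p) * cmod (c q)))"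
          by (intro sum.cong refl) (auto simp: algebra_simps power2_eq_square)
        also have "\<dots> = (cmod (c p))\<^sup>2 + \<delta> * (\<Sum>q\<in>P. cmod (c p) * cmod (c q))"
          using P p by (simp add: sum.distrib sum_distrib_left)
        finally show ?thesis .
      qed
      thus ?thesis by (simp add: sum_distrib_right[symmetric] sum.distrib sum_distrib_left[symmetric])
    qed
    also have "\<dots> \<le> ((\<Sum>p\<in>P. (cmod (c p))\<^sup>2) + \<epsilon>) * real N ^ CARD('n)"
    proof -
      have "\<delta> * ?C \<le> \<delta> * (?C + 1)" using \<delta> by simp
      also have "\<dots> = \<epsilon>" using C by (simp add: \<delta>_def)
      finally show ?thesis by (intro mult_right_mono add_left_mono) auto
    qed
    finally show "(\<Sum>i\<in>I. (cmod (\<Sum>p\<in>P. c p * cinner N (marked_transport w (fst p) (e # snd p)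
          (u i (?src p))) (u i (?tgt p))))\<^sup>2) \<le> ((\<Sum>p\<in>P. (cmod (c p))\<^sup>2) + \<epsilon>) * real N ^ CARD('n)"
      by (simp only: A_def)
  qed
qed

definition diag_coeff :: "'v \<Rightarrow> int ^ ('n + 'n) \<Rightarrow> nat \<Rightarrow> ('v \<Rightarrow> int ^ 'n \<Rightarrow> complex) \<Rightarrow> complex" where
  "diag_coeff v w N u = cinner N (weyl N w (u v)) (u v)"

lemma weighted_walk_sum:
  fixes L :: nat
  assumes F: "\<And>k. k < L \<Longrightarrow> F k = left_ext e (a k) \<times> right_ext e (b' k)"
    and disj: "\<And>k l. k < L \<Longrightarrow> l < L \<Longrightarrow> k \<noteq> l \<Longrightarrow> a k \<noteq> a l"
  shows "(\<Sum>p\<in>(\<Union>k<L. F k). g p) = (\<Sum>k<L. \<Sum>r\<in>left_ext e (a k). \<Sum>s\<in>right_ext e (b' k). g (r, s))"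
proof -
  have "(\<Sum>p\<in>(\<Union>k<L. F k). g p) = (\<Sum>k<L. \<Sum>p\<in>F k. g p)"
  proof (rule sum.UNION_disjoint)
    show "\<forall>k\<in>{..<L}. finite (F k)" by (simp add: F)
    show "\<forall>k\<in>{..<L}. \<forall>l\<in>{..<L}. k \<noteq> l \<longrightarrow> F k \<inter> F l = {}"
    proof (intro ballI impI)
      fix k l assume "k \<in> {..<L}" "l \<in> {..<L}" "k \<noteq> l"
      thus "F k \<inter> F l = {}" using disj[of k l] by (auto simp: F left_ext_def)
    qed
  qed simp
  also have "\<dots> = (\<Sum>k<L. \<Sum>r\<in>left_ext e (a k). \<Sum>s\<in>right_ext e (b' k). g (r, s))"
    by (intro sum.cong refl) (simp add: F sum_Times)
  finally show ?thesis .
qed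

text \<open>
  The condition on \<open>a\<close> and \<open>b'\<close> describes the two terms of \<open>walk_sum_difference\<close>, which are treated
  separately: the same walk can occur in both, with \<open>e\<close> marked at two consecutive places. For each \<open>k\<close>
  there are \<open>(d - 1) ^ (2 k + 1)\<close> walks with coefficient \<open>(d - 1) ^ (- k)\<close>, which contribute \<open>d - 1\<close>.
\<close>

lemma averaged_walk_sum_variance:
  assumes biv: "BIV X rv b chi" and b: "b \<in> verts X" and e: "e \<in> arcs X" and q: "d - 1 \<ge> 1"
    and ab: "(\<forall>k. a k = k \<and> b' k = Suc k) \<or> (\<forall>k. a k = Suc k \<and> b' k = k)"
  shows "variance_bound (\<lambda>N M u. \<Sum>k<L. quantum_eigensection.walk_sum X rv N M u w e (a k) (b' k) / of_nat (d - 1) ^ k)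
       (real (d - 1) * real L + 1)"
proof -
  define F where "F = (\<lambda>k. left_ext e (a k) \<times> right_ext e (b' k))"
  define P where "P = (\<Union>k<L. F k)"
  define c :: "'e list \<times> 'e list \<Rightarrow> complex" where "c = (\<lambda>p. 1 / of_nat (d - 1) ^ (min (length (fst p)) (length (snd p))))"
  have ainj: "a k \<noteq> a l" if "k \<noteq> l" for k l using ab that by auto
  have cval: "c (r, s) = 1 / of_nat (d - 1) ^ k" if "r \<in> left_ext e (a k)" "s \<in> right_ext e (b' k)" for r s k
    using that ab by (auto simp: c_def left_ext_def right_ext_def)
  have P: "finite P" by (simp add: P_def F_def)
  have sumP: "(\<Sum>p\<in>P. g p) = (\<Sum>k<L. \<Sum>r\<in>left_ext e (a k). \<Sum>s\<in>right_ext e (b' k). g (r, s))" for g :: "_ \<Rightarrow> 'x::comm_monoid_add"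
    unfolding P_def by (rule weighted_walk_sum) (auto simp: F_def ainj)
  have walks: "nonbacktracking (r @ e # s)" if "(r, s) \<in> P" for r s
    using that by (auto simp: P_def F_def intro: nonbacktracking_join)
  have inj: "inj_on (\<lambda>(r, s). r @ e # s) P"
  proof (rule inj_onI, clarify)
    fix r s r' s' assume rs: "(r, s) \<in> P" "(r', s') \<in> P" and eq: "r @ e # s = r' @ e # s'"
    from rs obtain k l where kl: "length r = a k" "length s = b' k" "length r' = a l" "length s' = b' l"
      by (auto simp: P_def F_def left_ext_def right_ext_def)
    have "length (r @ e # s) = length (r' @ e # s')" by (simp only: eq)
    hence "k = l" using ab kl by auto
    thus "r = r' \<and> s = s'" using eq kl by simp
  qed
  have csum: "(\<Sum>p\<in>P. (cmod (c p))\<^sup>2) = real (d - 1) * real L"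
  proof -
    let ?q = "real (d - 1)"
    have "(\<Sum>p\<in>P. (cmod (c p))\<^sup>2) = (\<Sum>k<L. \<Sum>r\<in>left_ext e (a k). \<Sum>s\<in>right_ext e (b' k). (1 / ?q ^ k)\<^sup>2)"
      unfolding sumP by (intro sum.cong refl) (simp add: cval norm_divide norm_power)
    also have "\<dots> = (\<Sum>k<L. ?q ^ a k * ?q ^ b' k * (1 / ?q ^ k)\<^sup>2)"
      by (simp add: card_left_ext card_right_ext e mult_ac)
    also have "\<dots> = (\<Sum>k<L. ?q)"
    proof (intro sum.cong refl)
      fix k
      have "?q ^ a k * ?q ^ b' k = ?q * (?q ^ k)\<^sup>2" using ab by (auto simp: power2_eq_square)
      thus "?q ^ a k * ?q ^ b' k * (1 / ?q ^ k)\<^sup>2 = ?q" using q by (simp add: power_divide)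
    qed
    finally show ?thesis by simp
  qed
  show ?thesis
  proof (rule variance_bound_cong[OF walk_family_variance[OF biv b P walks inj zero_less_one, of c w, unfolded csum]])
    fix N M u \<mu> assume "quantum_eigensection X rv d chi N M u \<mu>"
    then interpret quantum_eigensection X rv d chi N M u \<mu> .
    show "(\<Sum>k<L. walk_sum w e (a k) (b' k) / of_nat (d - 1) ^ k) = (\<Sum>p\<in>P. c p * cinner N (marked_transport w (fst p) (e # snd p)
       (u (head X (last (e # snd p))))) (u (tail X (hd (fst p @ [e])))))"
      unfolding sumP walk_sum_def sum_divide_distrib by (intro sum.cong refl) (simp add: cval del: last.simps)
  qed
qed

text \<open>
  The right hand side of \<open>walk_sum_difference\<close>, divided by \<open>(d - 1) ^ k\<close>, does not depend on \<open>k\<close>. It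
  is averaged over \<open>k < L\<close>. Walks of different lengths are asymptotically orthogonal, so the average has
  variance of order \<open>1 / L\<close>.
\<close>

lemma arc_variance:
  assumes biv: "BIV X rv b chi" and b: "b \<in> verts X" and e: "e \<in> arcs X"
  shows "negligible_variance (\<lambda>N u. diag_coeff (head X e) (w v* chi e) N u - diag_coeff (tail X e) w N u)"
proof (cases "d - 1 = 0")
  case True
  \<comment> \<open>No nonbacktracking walk extends \<open>e\<close>, so the walk sums for \<open>k = 0\<close> are empty.\<close>
  show ?thesis
  proof (rule negligible_variance_cong[OF negligible_variance_zero])
    fix N M u \<mu> assume "quantum_eigensection X rv d chi N M u \<mu>"
    then interpret quantum_eigensection X rv d chi N M u \<mu> .
    have "right_ext e 1 = {}" "left_ext e 1 = {}"
      using card_left_ext[OF e, of 1] card_right_ext[OF e, of 1] True by (simp_all del: One_nat_def)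
    thus "diag_coeff (head X e) (w v* chi e) N u - diag_coeff (tail X e) w N u = 0"
      using walk_sum_difference[OF e, of w 0] by (simp add: diag_coeff_def walk_sum_def)
  qed
next
  case False
  hence q: "d - 1 \<ge> 1" by simp
  let ?q = "real (d - 1)"
  let ?x = "\<lambda>N u. diag_coeff (head X e) (w v* chi e) N u - diag_coeff (tail X e) w N u"
  let ?A = "\<lambda>L N M u. \<Sum>k<L. quantum_eigensection.walk_sum X rv N M u w e k (Suc k) / of_nat (d - 1) ^ k"
  let ?B = "\<lambda>L N M u. \<Sum>k<L. quantum_eigensection.walk_sum X rv N M u w e (Suc k) k / of_nat (d - 1) ^ k"
  show ?thesis
    unfolding negligible_variance_def
  proof (intro allI impI)
    fix \<epsilon> :: real assume \<epsilon>: "\<epsilon> > 0"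
    define L where "L = Suc (nat \<lceil>4 * (?q + 1) / \<epsilon>\<rceil>)"
    have L: "L > 0" "4 * (?q + 1) / \<epsilon> \<le> real L" unfolding L_def by linarith+
    let ?C = "?q * real L + 1" and ?l = "1 / of_nat L :: complex"
    have "variance_bound (?A L) ?C" "variance_bound (?B L) ?C"
      using averaged_walk_sum_variance[OF biv b e q, of "\<lambda>k. k" Suc w L]
        averaged_walk_sum_variance[OF biv b e q, of Suc "\<lambda>k. k" w L] by simp_all
    from variance_bound_cmult[OF variance_bound_add[OF this(1) variance_bound_cmult[OF this(2), of "- 1"]], of ?l]
    have "variance_bound (\<lambda>N M u. ?l * (?A L N M u + - 1 * ?B L N M u)) ((cmod ?l)\<^sup>2 * (4 * ?C))"
      by (simp add: mult.commute)
    hence "variance_bound (\<lambda>N M u. ?x N u) ((cmod ?l)\<^sup>2 * (4 * ?C))"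
    proof (rule variance_bound_cong)
      fix N M u \<mu> assume "quantum_eigensection X rv d chi N M u \<mu>"
      then interpret quantum_eigensection X rv d chi N M u \<mu> .
      have "?A L N M u + - 1 * ?B L N M u = (\<Sum>k<L. (walk_sum w e k (Suc k) - walk_sum w e (Suc k) k) / of_nat (d - 1) ^ k)"
        by (simp add: sum_subtractf diff_divide_distrib)
      also have "\<dots> = (\<Sum>k<L. ?x N u)"
        unfolding walk_sum_difference[OF e] using q by (simp add: diag_coeff_def)
      finally show "?x N u = ?l * (?A L N M u + - 1 * ?B L N M u)" using L(1) by simp
    qed
    moreover have "(cmod ?l)\<^sup>2 * (4 * ?C) \<le> \<epsilon>"
    proof -
      have "4 * ?C \<le> 4 * (?q + 1) * real L" using L(1) by (simp add: algebra_simps)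
      also have "\<dots> \<le> \<epsilon> * real L * real L" using L \<epsilon> by (intro mult_right_mono) (auto simp: field_simps)
      finally show ?thesis using L(1) by (simp add: norm_divide power2_eq_square field_simps)
    qed
    ultimately show "variance_bound (\<lambda>N M u. ?x N u) \<epsilon>" by (rule variance_bound_mono)
  qed
qed

lemma walk_variance:
  assumes biv: "BIV X rv b chi" and b: "b \<in> verts X" and p: "awalk v p v'"
  shows "negligible_variance (\<lambda>N u. diag_coeff v' (w v* walk_weight chi p) N u - diag_coeff v w N u)"
  using p
proof (induction p arbitrary: v w)
  case Nil
  thus ?case by (simp add: awalk_Nil_iff negligible_variance_zero)
next
  case (Cons e p)
  hence e: "e \<in> arcs X" "tail X e = v" and p: "awalk (head X e) p v'" by (auto simp: awalk_Cons_iff)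
  have "negligible_variance (\<lambda>N u. (diag_coeff v' (w v* chi e v* walk_weight chi p) N u - diag_coeff (head X e) (w v* chi e) N u)
    + (diag_coeff (head X e) (w v* chi e) N u - diag_coeff (tail X e) w N u))"
    by (intro negligible_variance_add Cons.IH[OF p] arc_variance[OF biv b e(1)])
  thus ?case by (simp add: e vector_matrix_mul_assoc)
qed

lemma distinct_frequencies_variance:
  assumes S: "finite S" and v: "v \<in> verts X"
  shows "variance_bound (\<lambda>N M u. \<Sum>w\<in>S. diag_coeff v w N u) (card S)"
proof -
  \<comment> \<open>Beyond this threshold the elements of \<open>S\<close> are distinct modulo \<open>N\<close>.\<close>
  define N0 where "N0 = Suc (nat (\<Sum>w\<in>S. \<Sum>w'\<in>S. \<Sum>k\<in>UNIV. \<bar>(w - w') $ k\<bar>))"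
  have big: "\<bar>(w - w') $ k\<bar> < int N" if "w \<in> S" "w' \<in> S" "N \<ge> N0" for w w' k N
  proof -
    have "\<bar>(w - w') $ k\<bar> \<le> (\<Sum>k\<in>UNIV. \<bar>(w - w') $ k\<bar>)" by (rule member_le_sum) auto
    also have "\<dots> \<le> (\<Sum>w'\<in>S. \<Sum>k\<in>UNIV. \<bar>(w - w') $ k\<bar>)"
      using that S by (intro member_le_sum[where f = "\<lambda>w'. \<Sum>k\<in>UNIV. \<bar>(w - w') $ k\<bar>"]) (auto intro: sum_nonneg)
    also have "\<dots> \<le> (\<Sum>w\<in>S. \<Sum>w'\<in>S. \<Sum>k\<in>UNIV. \<bar>(w - w') $ k\<bar>)"
      using that S by (intro member_le_sum[where f = "\<lambda>w. \<Sum>w'\<in>S. \<Sum>k\<in>UNIV. \<bar>(w - w') $ k\<bar>"]) (auto intro!: sum_nonneg)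
    also have "\<dots> < int N" using that(3) by (simp add: N0_def)
    finally show ?thesis .
  qed
  show ?thesis
    unfolding variance_bound_def
  proof (intro exI[of _ N0] allI impI)
    fix N M I u assume N: "N \<ge> N0" and u: "eigensystem N M I u"
    have N_pos: "N > 0" using N by (simp add: N0_def)
    note W = weyl_isometric[OF N_pos]
    have orth: "cmod (hs N (weyl N w) (weyl N w')) = (if w = w' then real N ^ CARD('n) else 0)" if "w \<in> S" "w' \<in> S" for w w' :: "int ^ ('n + 'n)"
    proof (cases "w = w'")
      case True thus ?thesis by (simp add: hs_self W norm_power)
    next
      case False
      then obtain k where k: "(w - w') $ k \<noteq> 0" by (auto simp: vec_eq_iff)
      hence "\<not> int N dvd (w - w') $ k" using big[OF that N, of k] dvd_imp_le_int[of "(w - w') $ k" "int N"] by auto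
      hence "red N (w - w') $ k \<noteq> 0" by (simp add: red_def dvd_eq_mod_eq_0)
      hence "red N (w - w') \<noteq> 0" by auto
      thus ?thesis using False by (simp add: hs_weyl_orthogonal[OF N_pos])
    qed
    have "(\<Sum>i\<in>I. (cmod (\<Sum>w\<in>S. 1 * diag_coeff v w N (u i)))\<^sup>2)
      \<le> (\<Sum>w\<in>S. \<Sum>w'\<in>S. cmod 1 * cmod 1 * (if v = v \<and> v = v then cmod (hs N (weyl N w) (weyl N w')) else 0))"
      unfolding diag_coeff_def
      by (rule block_bessel[where V = "verts X"])
         (use u S W v in \<open>auto simp: eigensystem_def intro: eigensystem_coords[OF u]\<close>)
    also have "\<dots> = (\<Sum>w\<in>S. \<Sum>w'\<in>S. if w = w' then real N ^ CARD('n) else 0)"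
      by (intro sum.cong refl) (auto simp: orth)
    also have "\<dots> = card S * real N ^ CARD('n)" using S by simp
    finally show "(\<Sum>i\<in>I. (cmod (\<Sum>w\<in>S. diag_coeff v w N (u i)))\<^sup>2) \<le> card S * real N ^ CARD('n)" by simp
  qed
qed

text \<open>
  By \<open>walk_variance\<close> the coefficient at \<open>w\<close> may be replaced by its average over \<open>L\<close> frequencies of the
  orbit of \<open>w\<close>. Distinct frequencies are orthogonal, so the average has variance \<open>1 / L\<close>.
\<close>

lemma base_frequency_variance:
  assumes biv: "BIV X rv b chi" and b: "b \<in> verts X" and erg: "ERG X rv b chi" and w: "w \<noteq> 0"
  shows "negligible_variance (diag_coeff b w)"
proof (rule negligible_varianceI_approx)
  fix \<epsilon> :: real assume \<epsilon>: "\<epsilon> > 0"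
  define L where "L = Suc (nat \<lceil>1 / \<epsilon>\<rceil>)"
  have L: "L > 0" "1 / \<epsilon> \<le> real L" unfolding L_def by linarith+
  obtain S where S: "finite S" "card S = L" "S \<subseteq> (\<lambda>p. w v* walk_weight chi p) ` loops_at X b"
    using infinite_arbitrarily_large[OF infinite_frequency_orbit[OF erg b w]] by blast
  let ?c = "1 / of_nat L :: complex"
  let ?Z = "\<lambda>N u. ?c * (\<Sum>w'\<in>S. diag_coeff b w' N u)"
  have "(cmod ?c)\<^sup>2 * real (card S) \<le> \<epsilon>"
    using L \<epsilon> by (simp add: S(2) norm_divide power2_eq_square field_simps)
  hence 1: "variance_bound (\<lambda>N M u. ?Z N u) \<epsilon>"
    by (rule variance_bound_mono[OF variance_bound_cmult[OF distinct_frequencies_variance[OF S(1) b]]])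
  have "negligible_variance (\<lambda>N u. \<Sum>w'\<in>S. (- ?c) * (diag_coeff b w' N u - diag_coeff b w N u))"
  proof (intro negligible_variance_sum S negligible_variance_cmult)
    fix w' assume "w' \<in> S"
    then obtain p where "awalk b p b" "w' = w v* walk_weight chi p" using S(3) by (auto simp: loops_at_def)
    thus "negligible_variance (\<lambda>N u. diag_coeff b w' N u - diag_coeff b w N u)"
      using walk_variance[OF biv b] by simp
  qed
  moreover have "(\<Sum>w'\<in>S. (- ?c) * (diag_coeff b w' N u - diag_coeff b w N u)) = diag_coeff b w N u - ?Z N u" for N u
    using L(1) S(2) by (simp add: right_diff_distrib sum_subtractf sum_negf sum_divide_distrib)
  ultimately have "negligible_variance (\<lambda>N u. diag_coeff b w N u - ?Z N u)" by simp
  with 1 show "\<exists>Z. variance_bound (\<lambda>N M u. Z N u) \<epsilon> \<and> negligible_variance (\<lambda>N u. diag_coeff b w N u - Z N u)"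
    by (intro exI[of _ ?Z] conjI)
qed

lemma frequency_variance:
  assumes biv: "BIV X rv b chi" and b: "b \<in> verts X" and erg: "ERG X rv b chi" and w: "w \<noteq> 0" and v: "v \<in> verts X"
  shows "negligible_variance (diag_coeff v w)"
proof -
  obtain p where p: "awalk v p b" using exists_awalk[OF v b] by blast
  hence sp: "set p \<subseteq> arcs X" by (auto simp: awalk_def)
  let ?w = "w v* walk_weight chi p"
  have "?w v* walk_weight chi (reverse_walk p) = w"
    by (simp add: vector_matrix_mul_assoc walk_weight_reverse[OF sp])
  hence "?w \<noteq> 0" using w by (metis vector_matrix_mult_0)
  from negligible_variance_add[OF base_frequency_variance[OF biv b erg this] negligible_variance_cmult[OF walk_variance[OF biv b p, of w], of "- 1"]]
  have "negligible_variance (\<lambda>N u. diag_coeff v w N u)" by simp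
  thus ?thesis by simp
qed

text \<open>
  At frequency zero the coefficient is the squared norm of the section at \<open>v\<close>. Asymptotically it does
  not depend on \<open>v\<close>, and the sum over all \<open>v\<close> is \<open>1\<close>.
\<close>

lemma zero_frequency_variance:
  assumes biv: "BIV X rv b chi" and b: "b \<in> verts X" and v: "v \<in> verts X"
  shows "negligible_variance (\<lambda>N u. diag_coeff v 0 N u - 1 / of_nat (card (verts X)))"
proof -
  let ?c = "1 / of_nat (card (verts X)) :: complex"
  have card: "card (verts X) \<noteq> 0" using v by auto
  have "negligible_variance (\<lambda>N u. \<Sum>v'\<in>verts X. ?c * (diag_coeff v 0 N u - diag_coeff v' 0 N u))"
  proof (intro negligible_variance_sum negligible_variance_cmult finite_verts)
    fix v' assume "v' \<in> verts X"
    then obtain p where p: "awalk v' p v" using exists_awalk v by blast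
    show "negligible_variance (\<lambda>N u. diag_coeff v 0 N u - diag_coeff v' 0 N u)"
      using walk_variance[OF biv b p, of 0] by simp
  qed
  thus ?thesis
  proof (rule negligible_variance_cong)
    fix N M u \<mu> assume "quantum_eigensection X rv d chi N M u \<mu>"
    then interpret quantum_eigensection X rv d chi N M u \<mu> .
    have "(\<Sum>v'\<in>verts X. diag_coeff v' 0 N u) = (\<Sum>v'\<in>verts X. cinner N (u v') (u v'))"
      by (intro sum.cong refl) (simp add: diag_coeff_def weyl_zero u_coords)
    also note unit
    finally have s: "(\<Sum>v'\<in>verts X. diag_coeff v' 0 N u) = 1" .
    have "(\<Sum>v'\<in>verts X. ?c * (diag_coeff v 0 N u - diag_coeff v' 0 N u))
      = of_nat (card (verts X)) * (?c * diag_coeff v 0 N u) - ?c * (\<Sum>v'\<in>verts X. diag_coeff v' 0 N u)"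
      by (simp only: right_diff_distrib sum_subtractf sum_constant sum_distrib_left)
    also have "\<dots> = diag_coeff v 0 N u - ?c" unfolding s using card by simp
    finally show "diag_coeff v 0 N u - ?c = (\<Sum>v'\<in>verts X. ?c * (diag_coeff v 0 N u - diag_coeff v' 0 N u))" ..
  qed
qed

subsection \<open>Superposition of Fourier modes\<close>

lemma norm_diag_coeff_le_1:
  assumes "quantum_eigensection X rv d chi N M u z" and v: "v \<in> verts X"
  shows "cmod (diag_coeff v w N u) \<le> 1"
proof -
  interpret quantum_eigensection X rv d chi N M u z by fact
  have "cmod (diag_coeff v w N u) \<le> Re (cinner N (u v) (u v))"
    unfolding diag_coeff_def by (rule cinner_bound[OF weyl_isometric[OF N] u_coords[OF v]])
  also have "\<dots> \<le> (\<Sum>v\<in>verts X. Re (cinner N (u v) (u v)))"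
    using v by (intro member_le_sum) (auto simp: cinner_self sum_nonneg)
  also have "\<dots> = 1" using unit by (metis Re_sum one_complex.sel(1))
  finally show ?thesis .
qed

text \<open>
  All coefficients have modulus at most \<open>1\<close>, so the tail of the summable family \<open>a v\<close> contributes little
  for every single section, and finitely many frequencies remain.
\<close>

lemma superposition_variance:
  fixes a :: "'v \<Rightarrow> int ^ ('n + 'n) \<Rightarrow> complex"
  assumes biv: "BIV X rv b chi" and b: "b \<in> verts X" and erg: "ERG X rv b chi"
    and a: "\<And>v. v \<in> verts X \<Longrightarrow> (\<lambda>w. cmod (a v w)) summable_on UNIV"
  shows "negligible_variance (\<lambda>N u. (\<Sum>v\<in>verts X. \<Sum>\<^sub>\<infinity>w. a v w * diag_coeff v w N u)
     - 1 / of_nat (card (verts X)) * (\<Sum>v\<in>verts X. a v 0))"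
    (is "negligible_variance (\<lambda>N u. ?S N u - ?m)")
proof (rule negligible_varianceI_approx)
  fix \<epsilon> :: real assume \<epsilon>: "\<epsilon> > 0"
  let ?V = "card (verts X)"
  have V: "?V > 0" using b by (auto simp: card_gt_0_iff)
  \<comment> \<open>The tails contribute at most \<open>?V * \<delta>\<close> for each of at most \<open>?V * N ^ n\<close> sections.\<close>
  define \<delta> where "\<delta> = min 1 (\<epsilon> / (2 * real ?V ^ 3))"
  have \<delta>: "\<delta> > 0" "\<delta> \<le> 1" using \<epsilon> V by (auto simp: \<delta>_def)
  have \<delta>2: "(real ?V * \<delta>)\<^sup>2 * real ?V \<le> \<epsilon>"
  proof -
    have "(real ?V * \<delta>)\<^sup>2 * real ?V = real ?V ^ 3 * (\<delta> * \<delta>)" by (simp add: power2_eq_square power3_eq_cube)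
    also have "\<dots> \<le> real ?V ^ 3 * (1 * (\<epsilon> / (2 * real ?V ^ 3)))"
      using \<delta> \<epsilon> by (intro mult_left_mono mult_mono) (auto simp: \<delta>_def)
    also have "\<dots> \<le> \<epsilon>" using V \<epsilon> by simp
    finally show ?thesis .
  qed
  have "\<exists>F. finite F \<and> 0 \<in> F \<and> (\<Sum>\<^sub>\<infinity>w\<in>-F. cmod (a v w)) \<le> \<delta>" if v: "v \<in> verts X" for v
  proof -
    obtain F where F: "finite F" "dist (\<Sum>w\<in>F. cmod (a v w)) (\<Sum>\<^sub>\<infinity>w. cmod (a v w)) \<le> \<delta>"
      using infsum_finite_approximation[OF a[OF v] \<delta>(1)] by auto
    let ?F = "insert 0 F"
    have fin: "finite ?F" using F by simp
    have "(\<Sum>\<^sub>\<infinity>w. cmod (a v w)) = (\<Sum>\<^sub>\<infinity>w\<in>?F \<union> - ?F. cmod (a v w))" by simp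
    also have "\<dots> = (\<Sum>\<^sub>\<infinity>w\<in>?F. cmod (a v w)) + (\<Sum>\<^sub>\<infinity>w\<in>- ?F. cmod (a v w))"
      by (rule infsum_Un_disjoint) (use a[OF v] fin in \<open>auto intro: summable_on_subset_banach\<close>)
    also have "(\<Sum>\<^sub>\<infinity>w\<in>?F. cmod (a v w)) = (\<Sum>w\<in>?F. cmod (a v w))" using fin by (rule infsum_finite)
    finally have "(\<Sum>\<^sub>\<infinity>w\<in>- ?F. cmod (a v w)) = (\<Sum>\<^sub>\<infinity>w. cmod (a v w)) - (\<Sum>w\<in>?F. cmod (a v w))" by simp
    also have "\<dots> \<le> (\<Sum>\<^sub>\<infinity>w. cmod (a v w)) - (\<Sum>w\<in>F. cmod (a v w))"
      using F fin by (intro diff_left_mono sum_mono2) auto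
    also have "\<dots> \<le> \<delta>" using F(2) by (simp add: dist_real_def)
    finally show ?thesis using fin by blast
  qed
  then obtain F where F: "\<And>v. v \<in> verts X \<Longrightarrow> finite (F v)" "\<And>v. v \<in> verts X \<Longrightarrow> 0 \<in> F v"
    "\<And>v. v \<in> verts X \<Longrightarrow> (\<Sum>\<^sub>\<infinity>w\<in>-F v. cmod (a v w)) \<le> \<delta>" by metis
  let ?Z = "\<lambda>N u. \<Sum>v\<in>verts X. \<Sum>\<^sub>\<infinity>w\<in>-F v. a v w * diag_coeff v w N u"
  have "(\<Sum>i\<in>I. (cmod (?Z N (u i)))\<^sup>2) \<le> \<epsilon> * real N ^ CARD('n)" if u: "eigensystem N M I u" for N M I u
  proof -
    have "cmod (?Z N (u i)) \<le> real ?V * \<delta>" if i: "i \<in> I" for i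
    proof -
      obtain \<mu> where qe: "quantum_eigensection X rv d chi N M (u i) \<mu>" using u i unfolding eigensystem_def by blast
      have "cmod (?Z N (u i)) \<le> (\<Sum>v\<in>verts X. cmod (\<Sum>\<^sub>\<infinity>w\<in>-F v. a v w * diag_coeff v w N (u i)))" by (rule norm_sum)
      also have "\<dots> \<le> (\<Sum>v\<in>verts X. \<delta>)"
      proof (rule sum_mono)
        fix v assume v: "v \<in> verts X"
        have s: "(\<lambda>w. cmod (a v w)) summable_on - F v" using a[OF v] by (rule summable_on_subset_banach) auto
        have le: "cmod (a v w * diag_coeff v w N (u i)) \<le> cmod (a v w)" for w
          using norm_diag_coeff_le_1[OF qe v, of w] by (simp add: norm_mult mult_left_le)
        have "(\<lambda>w. cmod (a v w * diag_coeff v w N (u i))) summable_on - F v"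
          by (rule summable_on_comparison_test[OF s]) (use le in auto)
        hence "cmod (\<Sum>\<^sub>\<infinity>w\<in>-F v. a v w * diag_coeff v w N (u i)) \<le> (\<Sum>\<^sub>\<infinity>w\<in>-F v. cmod (a v w))"
          by (intro norm_infsum_le[OF has_sum_infsum[OF abs_summable_summable] has_sum_infsum[OF s]]) (use le in auto)
        also note F(3)[OF v]
        finally show "cmod (\<Sum>\<^sub>\<infinity>w\<in>-F v. a v w * diag_coeff v w N (u i)) \<le> \<delta>" .
      qed
      finally show ?thesis by simp
    qed
    hence "(\<Sum>i\<in>I. (cmod (?Z N (u i)))\<^sup>2) \<le> (\<Sum>i\<in>I. (real ?V * \<delta>)\<^sup>2)"
      by (intro sum_mono power_mono) auto
    also have "\<dots> = real (card I) * (real ?V * \<delta>)\<^sup>2" by simp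
    also have "\<dots> \<le> real (?V * N ^ CARD('n)) * (real ?V * \<delta>)\<^sup>2"
      using u by (intro mult_right_mono of_nat_mono) (auto simp: eigensystem_def)
    also have "\<dots> = ((real ?V * \<delta>)\<^sup>2 * real ?V) * real N ^ CARD('n)" by simp
    also have "\<dots> \<le> \<epsilon> * real N ^ CARD('n)" using \<delta>2 by (intro mult_right_mono) auto
    finally show ?thesis .
  qed
  hence 1: "variance_bound (\<lambda>N M u. ?Z N u) \<epsilon>" unfolding variance_bound_def by blast
  have "negligible_variance (\<lambda>N u. \<Sum>v\<in>verts X. (\<Sum>w\<in>F v - {0}. a v w * diag_coeff v w N u)
     + a v 0 * (diag_coeff v 0 N u - 1 / of_nat ?V))"
    using F(1) by (intro negligible_variance_sum negligible_variance_add negligible_variance_cmult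
        frequency_variance[OF biv b erg] zero_frequency_variance[OF biv b] finite_verts) auto
  hence "negligible_variance (\<lambda>N u. ?S N u - ?m - ?Z N u)"
  proof (rule negligible_variance_cong)
    fix N M u \<mu> assume qe: "quantum_eigensection X rv d chi N M u \<mu>"
    have "(\<Sum>\<^sub>\<infinity>w. a v w * diag_coeff v w N u) - a v 0 / of_nat ?V - (\<Sum>\<^sub>\<infinity>w\<in>-F v. a v w * diag_coeff v w N u)
      = (\<Sum>w\<in>F v - {0}. a v w * diag_coeff v w N u) + a v 0 * (diag_coeff v 0 N u - 1 / of_nat ?V)" if v: "v \<in> verts X" for v
    proof -
      have le: "cmod (a v w * diag_coeff v w N u) \<le> cmod (a v w)" for w
        using norm_diag_coeff_le_1[OF qe v, of w] by (simp add: norm_mult mult_left_le)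
      have "(\<lambda>w. cmod (a v w * diag_coeff v w N u)) summable_on UNIV"
        by (rule summable_on_comparison_test[OF a[OF v]]) (use le in auto)
      hence s: "(\<lambda>w. a v w * diag_coeff v w N u) summable_on UNIV" by (rule abs_summable_summable)
      have "(\<Sum>\<^sub>\<infinity>w. a v w * diag_coeff v w N u) = (\<Sum>\<^sub>\<infinity>w\<in>F v \<union> - F v. a v w * diag_coeff v w N u)" by simp
      also have "\<dots> = (\<Sum>\<^sub>\<infinity>w\<in>F v. a v w * diag_coeff v w N u) + (\<Sum>\<^sub>\<infinity>w\<in>- F v. a v w * diag_coeff v w N u)"
        by (rule infsum_Un_disjoint) (use s F(1)[OF v] in \<open>auto intro: summable_on_subset_banach\<close>)
      also have "(\<Sum>\<^sub>\<infinity>w\<in>F v. a v w * diag_coeff v w N u) = (\<Sum>w\<in>F v. a v w * diag_coeff v w N u)"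
        using F(1)[OF v] by (rule infsum_finite)
      also have "\<dots> = a v 0 * diag_coeff v 0 N u + (\<Sum>w\<in>F v - {0}. a v w * diag_coeff v w N u)"
        by (rule sum.remove[OF F(1)[OF v] F(2)[OF v]])
      finally show ?thesis by (simp add: algebra_simps)
    qed
    hence "(\<Sum>v\<in>verts X. (\<Sum>w\<in>F v - {0}. a v w * diag_coeff v w N u) + a v 0 * (diag_coeff v 0 N u - 1 / of_nat ?V))
      = (\<Sum>v\<in>verts X. (\<Sum>\<^sub>\<infinity>w. a v w * diag_coeff v w N u) - a v 0 / of_nat ?V - (\<Sum>\<^sub>\<infinity>w\<in>-F v. a v w * diag_coeff v w N u))"
      by simp
    thus "?S N u - ?m - ?Z N u = (\<Sum>v\<in>verts X. (\<Sum>w\<in>F v - {0}. a v w * diag_coeff v w N u)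
     + a v 0 * (diag_coeff v 0 N u - 1 / of_nat ?V))"
      by (simp add: sum_subtractf sum_distrib_left)
  qed
  with 1 show "\<exists>Z. variance_bound (\<lambda>N M u. Z N u) \<epsilon> \<and> negligible_variance (\<lambda>N u. ?S N u - ?m - Z N u)"
    by (intro exI[of _ ?Z] conjI)
qed

end

section \<open>Test functions\<close>

text \<open>
  As for \<open>smooth_fun_coinduct\<close>: a family that is closed under derivatives and whose members decrease
  rapidly consists of Schwartz functions.
\<close>

lemma schwartz_coinduct:
  assumes "f \<in> S" "\<And>f x. f \<in> S \<Longrightarrow> f differentiable (at x)"
    "\<And>f b. f \<in> S \<Longrightarrow> b \<in> Basis \<Longrightarrow> dir_deriv b f \<in> S"
    "\<And>f k. f \<in> S \<Longrightarrow> bounded (range (\<lambda>x. (1 + norm x) ^ k * cmod (f x)))"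
  shows "f \<in> schwartz"
  using smooth_fun_coinduct[of f S] iter_deriv_in_closed_set[of f S] assms
  unfolding schwartz_def by blast

lemma schwartz_smooth: "\<phi> \<in> schwartz \<Longrightarrow> smooth_fun \<phi>"
  by (simp add: schwartz_def)

lemma schwartz_bounded: "\<phi> \<in> schwartz \<Longrightarrow> bounded (range (\<lambda>x. (1 + norm x) ^ k * cmod (\<phi> x)))"
proof -
  assume "\<phi> \<in> schwartz"
  hence "set bs \<subseteq> Basis \<Longrightarrow> bounded (range (\<lambda>x. (1 + norm x) ^ k * cmod (iter_deriv bs \<phi> x)))" for bs
    by (simp add: schwartz_def)
  from this[of "[]"] show ?thesis by simp
qed

lemma schwartz_dir_deriv: "\<phi> \<in> schwartz \<Longrightarrow> b \<in> Basis \<Longrightarrow> dir_deriv b \<phi> \<in> schwartz"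
proof -
  assume f: "\<phi> \<in> schwartz" and b: "b \<in> Basis"
  have e: "dir_deriv b \<phi> = iter_deriv [b] \<phi>" by (simp add: dir_deriv_def)
  have "bounded (range (\<lambda>x. (1 + norm x) ^ k * cmod (iter_deriv bs (dir_deriv b \<phi>) x)))" if "set bs \<subseteq> Basis" for k bs
  proof -
    have "set (bs @ [b]) \<subseteq> Basis" using that b by simp
    thus ?thesis using f unfolding e iter_deriv_append[symmetric] schwartz_def by blast
  qed
  thus ?thesis using smooth_fun_dir_deriv[OF schwartz_smooth[OF f] b] unfolding schwartz_def by blast
qed

lemma bounded_rangeI:
  fixes f :: "'a \<Rightarrow> real" assumes "\<And>x. 0 \<le> f x" "\<And>x. f x \<le> B" shows "bounded (range f)"
  unfolding bounded_iff using assms by (intro exI[of _ B]) auto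

lemma bounded_range_upper:
  fixes f :: "'a \<Rightarrow> real" assumes "bounded (range f)" shows "\<exists>B. \<forall>x. f x \<le> B"
proof -
  from assms obtain B where "\<And>x. \<bar>f x\<bar> \<le> B" by (auto simp: bounded_iff)
  thus ?thesis by (meson abs_le_iff)
qed

lemma schwartz_add:
  fixes \<phi> :: "'a::euclidean_space \<Rightarrow> complex"
  assumes "\<phi> \<in> schwartz" "\<psi> \<in> schwartz" shows "(\<lambda>x. \<phi> x + \<psi> x) \<in> schwartz"
proof (rule schwartz_coinduct[of _ "{\<lambda>x. f x + g x |f g. f \<in> schwartz \<and> g \<in> schwartz}"])
  fix h :: "'a \<Rightarrow> complex" assume "h \<in> {\<lambda>x. f x + g x |f g. f \<in> schwartz \<and> g \<in> schwartz}"
  then obtain f g where h: "h = (\<lambda>x. f x + g x)" and fg: "f \<in> schwartz" "g \<in> schwartz" by blast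
  show "h differentiable (at x)" for x
    unfolding h by (intro derivative_intros smooth_fun_differentiable schwartz_smooth fg)
  show "dir_deriv b h \<in> {\<lambda>x. f x + g x |f g. f \<in> schwartz \<and> g \<in> schwartz}" if "b \<in> Basis" for b
    unfolding h dir_deriv_add[OF schwartz_smooth[OF fg(1)] schwartz_smooth[OF fg(2)]]
    using schwartz_dir_deriv fg that by blast
  fix k
  obtain A where A: "\<And>x. (1 + norm x) ^ k * cmod (f x) \<le> A" using bounded_range_upper[OF schwartz_bounded[OF fg(1), of k]] by blast
  obtain B where B: "\<And>x. (1 + norm x) ^ k * cmod (g x) \<le> B" using bounded_range_upper[OF schwartz_bounded[OF fg(2), of k]] by blast
  show "bounded (range (\<lambda>x. (1 + norm x) ^ k * cmod (h x)))"
  proof (rule bounded_rangeI)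
    fix x
    have "(1 + norm x) ^ k * cmod (h x) \<le> (1 + norm x) ^ k * (cmod (f x) + cmod (g x))"
      unfolding h by (intro mult_left_mono norm_triangle_ineq) auto
    also have "\<dots> \<le> A + B" using A[of x] B[of x] by (simp add: ring_distribs)
    finally show "(1 + norm x) ^ k * cmod (h x) \<le> A + B" .
  qed auto
qed (use assms in blast)

lemma schwartz_cmult:
  fixes \<phi> :: "'a::euclidean_space \<Rightarrow> complex"
  assumes "\<phi> \<in> schwartz" shows "(\<lambda>x. c * \<phi> x) \<in> schwartz"
proof (rule schwartz_coinduct[of _ "{\<lambda>x. c * f x |f. f \<in> schwartz}"])
  fix h :: "'a \<Rightarrow> complex" assume "h \<in> {\<lambda>x. c * f x |f. f \<in> schwartz}"
  then obtain f where h: "h = (\<lambda>x. c * f x)" and f: "f \<in> schwartz" by blast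
  show "h differentiable (at x)" for x
    unfolding h by (intro derivative_intros smooth_fun_differentiable schwartz_smooth f)
  show "dir_deriv b h \<in> {\<lambda>x. c * f x |f. f \<in> schwartz}" if "b \<in> Basis" for b
    unfolding h dir_deriv_cmult[OF schwartz_smooth[OF f]] using schwartz_dir_deriv f that by blast
  fix k
  obtain A where A: "\<And>x. (1 + norm x) ^ k * cmod (f x) \<le> A" using bounded_range_upper[OF schwartz_bounded[OF f, of k]] by blast
  show "bounded (range (\<lambda>x. (1 + norm x) ^ k * cmod (h x)))"
  proof (rule bounded_rangeI)
    fix x
    show "(1 + norm x) ^ k * cmod (h x) \<le> cmod c * A"
      using mult_left_mono[OF A[of x], of "cmod c"] by (simp add: h norm_mult mult_ac)
  qed auto
qed (use assms in blast)

lemma schwartz_cis: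
  fixes \<phi> :: "'a::euclidean_space \<Rightarrow> complex"
  assumes "\<phi> \<in> schwartz" shows "(\<lambda>x. cis (c \<bullet> x + s) * \<phi> x) \<in> schwartz"
proof (rule schwartz_coinduct[of _ "{\<lambda>x. cis (c \<bullet> x + s) * f x |f. f \<in> schwartz}"])
  fix h :: "'a \<Rightarrow> complex" assume "h \<in> {\<lambda>x. cis (c \<bullet> x + s) * f x |f. f \<in> schwartz}"
  then obtain f where h: "h = (\<lambda>x. cis (c \<bullet> x + s) * f x)" and f: "f \<in> schwartz" by blast
  show "h differentiable (at x)" for x
    unfolding h using smooth_fun_differentiable[OF smooth_fun_cis[OF schwartz_smooth[OF f]]] .
  show "dir_deriv b h \<in> {\<lambda>x. cis (c \<bullet> x + s) * f x |f. f \<in> schwartz}" if b: "b \<in> Basis" for b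
  proof -
    have "(\<lambda>x. dir_deriv b f x + \<i> * of_real (c \<bullet> b) * f x) \<in> schwartz"
      by (intro schwartz_add schwartz_cmult schwartz_dir_deriv f b)
    thus ?thesis unfolding h dir_deriv_cis[OF schwartz_smooth[OF f]]
      by (auto intro!: exI[of _ "\<lambda>x. dir_deriv b f x + \<i> * of_real (c \<bullet> b) * f x"])
  qed
  show "bounded (range (\<lambda>x. (1 + norm x) ^ k * cmod (h x)))" for k
    using schwartz_bounded[OF f, of k] by (simp add: h norm_mult)
qed (use assms in blast)

lemma schwartz_translate:
  fixes \<phi> :: "'a::euclidean_space \<Rightarrow> complex"
  assumes "\<phi> \<in> schwartz" shows "(\<lambda>x. \<phi> (x - \<eta>)) \<in> schwartz"
proof (rule schwartz_coinduct[of _ "{\<lambda>x. f (x - \<eta>) |f. f \<in> schwartz}"])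
  fix h :: "'a \<Rightarrow> complex" assume "h \<in> {\<lambda>x. f (x - \<eta>) |f. f \<in> schwartz}"
  then obtain f where h: "h = (\<lambda>x. f (x - \<eta>))" and f: "f \<in> schwartz" by blast
  have D: "(h has_derivative (\<lambda>d. frechet_derivative f (at (x - \<eta>)) d)) (at x)" for x
    unfolding h
    by (rule has_derivative_compose[OF _ smooth_fun_has_derivative[OF schwartz_smooth[OF f]]])
       (auto intro!: derivative_eq_intros)
  show "h differentiable (at x)" for x using D by (rule differentiableI)
  show "dir_deriv b h \<in> {\<lambda>x. f (x - \<eta>) |f. f \<in> schwartz}" if b: "b \<in> Basis" for b
  proof -
    have "dir_deriv b h = (\<lambda>x. dir_deriv b f (x - \<eta>))"
      by (subst dir_deriv_eqI[OF D]) (simp add: dir_deriv_def)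
    thus ?thesis using schwartz_dir_deriv[OF f b] by blast
  qed
  fix k
  obtain A where A: "\<And>x. (1 + norm x) ^ k * cmod (f x) \<le> A" using bounded_range_upper[OF schwartz_bounded[OF f, of k]] by blast
  show "bounded (range (\<lambda>x. (1 + norm x) ^ k * cmod (h x)))"
  proof (rule bounded_rangeI)
    fix x
    have "1 + norm x \<le> (1 + norm \<eta>) * (1 + norm (x - \<eta>))"
      using norm_triangle_ineq[of "x - \<eta>" \<eta>] by (simp add: algebra_simps)
         (smt (verit) mult_nonneg_nonneg norm_ge_zero)
    hence "(1 + norm x) ^ k * cmod (h x) \<le> ((1 + norm \<eta>) * (1 + norm (x - \<eta>))) ^ k * cmod (h x)"
      by (intro mult_right_mono power_mono) auto
    also have "\<dots> = (1 + norm \<eta>) ^ k * ((1 + norm (x - \<eta>)) ^ k * cmod (f (x - \<eta>)))"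
      by (simp add: h power_mult_distrib)
    also have "\<dots> \<le> (1 + norm \<eta>) ^ k * A" by (intro mult_left_mono A) auto
    finally show "(1 + norm x) ^ k * cmod (h x) \<le> (1 + norm \<eta>) ^ k * A" .
  qed auto
qed (use assms in blast)

lemma schwartz_modulated_translate_iff:
  "(\<lambda>x. cis (c \<bullet> x + s) * \<phi> (x - \<eta>)) \<in> schwartz \<longleftrightarrow> \<phi> \<in> schwartz"
proof
  assume "\<phi> \<in> schwartz" thus "(\<lambda>x. cis (c \<bullet> x + s) * \<phi> (x - \<eta>)) \<in> schwartz"
    by (intro schwartz_cis schwartz_translate)
next
  assume "(\<lambda>x. cis (c \<bullet> x + s) * \<phi> (x - \<eta>)) \<in> schwartz"
  hence "(\<lambda>x. cis ((-c) \<bullet> x + (- s)) * (cis (c \<bullet> x + s) * \<phi> (x - \<eta>))) \<in> schwartz" by (rule schwartz_cis)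
  moreover have "cis ((-c) \<bullet> x + (- s)) * (cis (c \<bullet> x + s) * \<phi> (x - \<eta>)) = \<phi> (x - \<eta>)" for x
    unfolding mult.assoc[symmetric] cis_mult by simp
  ultimately have "(\<lambda>x. \<phi> (x - \<eta>)) \<in> schwartz" by (simp only:)
  from schwartz_translate[OF this, of "- \<eta>"] show "\<phi> \<in> schwartz" by simp
qed

subsection \<open>The Gaussian\<close>

definition gaussian :: "'a::euclidean_space \<Rightarrow> complex" where
  "gaussian x = of_real (exp (- (x \<bullet> x)))"

text \<open>
  Polynomial multiples of the Gaussian: the smallest family to which \<open>schwartz_coinduct\<close> applies.
\<close>

inductive_set hermite_functions :: "('a::euclidean_space \<Rightarrow> complex) set" where
  "gaussian \<in> hermite_functions"
| "f \<in> hermite_functions \<Longrightarrow> g \<in> hermite_functions \<Longrightarrow> (\<lambda>x. f x + g x) \<in> hermite_functions"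
| "f \<in> hermite_functions \<Longrightarrow> (\<lambda>x. c * f x) \<in> hermite_functions"
| "f \<in> hermite_functions \<Longrightarrow> (\<lambda>x. of_real (x \<bullet> b) * f x) \<in> hermite_functions"

lemma hermite_functions_derivative:
  "f \<in> hermite_functions \<Longrightarrow> \<exists>D. \<forall>x. (f has_derivative D x) (at x) \<and> (\<forall>b. (\<lambda>x. D x b) \<in> hermite_functions)"
proof (induction rule: hermite_functions.induct)
  case 1
  have "(gaussian has_derivative (\<lambda>h. (- 2) * (of_real (x \<bullet> h) * gaussian x))) (at x)" for x :: 'a
    unfolding gaussian_def by (auto intro!: derivative_eq_intros simp: inner_commute algebra_simps)
  moreover have "(\<lambda>x. (- 2) * (of_real (x \<bullet> b) * gaussian x)) \<in> hermite_functions" for b :: 'a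
    by (intro hermite_functions.intros)
  ultimately show ?case by (intro exI[of _ "\<lambda>x h. (- 2) * (of_real (x \<bullet> h) * gaussian x)"]) blast
next
  case (2 f g)
  then obtain D D' where "\<And>x. (f has_derivative D x) (at x)" "\<And>b. (\<lambda>x. D x b) \<in> hermite_functions"
    "\<And>x. (g has_derivative D' x) (at x)" "\<And>b. (\<lambda>x. D' x b) \<in> hermite_functions" by metis
  thus ?case by (intro exI[of _ "\<lambda>x h. D x h + D' x h"]) (auto intro!: derivative_intros hermite_functions.intros)
next
  case (3 f c)
  then obtain D where "\<And>x. (f has_derivative D x) (at x)" "\<And>b. (\<lambda>x. D x b) \<in> hermite_functions" by metis
  thus ?case by (intro exI[of _ "\<lambda>x h. c * D x h"]) (auto intro!: derivative_intros hermite_functions.intros)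
next
  case (4 f b)
  then obtain D where D: "\<And>x. (f has_derivative D x) (at x)" "\<And>b. (\<lambda>x. D x b) \<in> hermite_functions" by metis
  show ?case
  proof (intro exI[of _ "\<lambda>x h. of_real (x \<bullet> b) * D x h + of_real (h \<bullet> b) * f x"] allI conjI)
    show "((\<lambda>x. of_real (x \<bullet> b) * f x) has_derivative (\<lambda>h. of_real (x \<bullet> b) * D x h + of_real (h \<bullet> b) * f x)) (at x)" for x
      by (auto intro!: derivative_eq_intros D(1))
    show "(\<lambda>x. of_real (x \<bullet> b) * D x h + of_real (h \<bullet> b) * f x) \<in> hermite_functions" for h
      by (intro hermite_functions.intros D 4)
  qed
qed

text \<open>
  Compare the power with \<open>exp (1 + r)\<close> by means of the inequality \<open>(1 + x / k) ^ k \<le> exp x\<close>.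
\<close>

lemma gaussian_decay: "(1 + r) ^ k * exp (- r\<^sup>2) \<le> real k ^ k * exp 2" if r: "r \<ge> 0" for r :: real
proof (cases "k = 0")
  case True
  have "- r\<^sup>2 \<le> 2" using zero_le_power2[of r] by linarith
  thus ?thesis using True by simp
next
  case False
  have "((1 + r) / real k) ^ k \<le> (1 + (1 + r) / real k) ^ k" using r by (intro power_mono) auto
  also have "\<dots> \<le> exp (1 + r)" using exp_ge_one_plus_x_over_n_power_n[of k "1 + r"] False r by simp
  finally have "(1 + r) ^ k \<le> real k ^ k * exp (1 + r)" using False by (simp add: power_divide field_simps)
  hence "(1 + r) ^ k * exp (- r\<^sup>2) \<le> real k ^ k * exp (1 + r) * exp (- r\<^sup>2)" by (rule mult_right_mono) simp
  also have "\<dots> = real k ^ k * exp (1 + r - r\<^sup>2)" by (simp add: exp_add[symmetric] mult.assoc)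
  also have "\<dots> \<le> real k ^ k * exp 2"
  proof -
    have "0 \<le> (r - 1 / 2)\<^sup>2" by simp
    hence "1 + r - r\<^sup>2 \<le> 2" by (simp add: power2_eq_square field_simps)
    thus ?thesis by (intro mult_left_mono) auto
  qed
  finally show ?thesis .
qed

lemma hermite_functions_bounded:
  "f \<in> hermite_functions \<Longrightarrow> bounded (range (\<lambda>x. (1 + norm x) ^ k * cmod (f x)))"
proof (induction arbitrary: k rule: hermite_functions.induct)
  case 1
  show ?case
    by (rule bounded_rangeI[of _ "real k ^ k * exp 2"])
       (use gaussian_decay in \<open>auto simp: gaussian_def power2_norm_eq_inner[symmetric]\<close>)
next
  case (2 f g)
  obtain A where A: "\<And>x. (1 + norm x) ^ k * cmod (f x) \<le> A" using bounded_range_upper[OF 2(3)[of k]] by blast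
  obtain B where B: "\<And>x. (1 + norm x) ^ k * cmod (g x) \<le> B" using bounded_range_upper[OF 2(4)[of k]] by blast
  show ?case
  proof (rule bounded_rangeI)
    fix x
    have "(1 + norm x) ^ k * cmod (f x + g x) \<le> (1 + norm x) ^ k * (cmod (f x) + cmod (g x))"
      by (intro mult_left_mono norm_triangle_ineq) auto
    also have "\<dots> \<le> A + B" using A[of x] B[of x] by (simp add: ring_distribs)
    finally show "(1 + norm x) ^ k * cmod (f x + g x) \<le> A + B" .
  qed auto
next
  case (3 f c)
  obtain A where A: "\<And>x. (1 + norm x) ^ k * cmod (f x) \<le> A" using bounded_range_upper[OF 3(2)[of k]] by blast
  show ?case
  proof (rule bounded_rangeI)
    show "(1 + norm x) ^ k * cmod (c * f x) \<le> cmod c * A" for x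
      using mult_left_mono[OF A[of x], of "cmod c"] by (simp add: norm_mult mult_ac)
  qed auto
next
  case (4 f b)
  obtain A where A: "\<And>x. (1 + norm x) ^ Suc k * cmod (f x) \<le> A" using bounded_range_upper[OF 4(2)[of "Suc k"]] by blast
  show ?case
  proof (rule bounded_rangeI)
    fix x
    have "\<bar>x \<bullet> b\<bar> \<le> norm b * (1 + norm x)"
      using Cauchy_Schwarz_ineq2[of x b] by (simp add: algebra_simps) (smt (verit) norm_ge_zero)
    hence "(1 + norm x) ^ k * cmod (of_real (x \<bullet> b) * f x) \<le> (1 + norm x) ^ k * ((norm b * (1 + norm x)) * cmod (f x))"
      unfolding norm_mult norm_of_real by (intro mult_left_mono mult_right_mono) auto
    also have "\<dots> = norm b * ((1 + norm x) ^ Suc k * cmod (f x))" by (simp add: mult_ac)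
    also have "\<dots> \<le> norm b * A" by (intro mult_left_mono A) auto
    finally show "(1 + norm x) ^ k * cmod (of_real (x \<bullet> b) * f x) \<le> norm b * A" .
  qed auto
qed

lemma gaussian_schwartz: "gaussian \<in> schwartz"
proof (rule schwartz_coinduct[OF hermite_functions.intros(1)])
  fix f :: "'a \<Rightarrow> complex" assume f: "f \<in> hermite_functions"
  then obtain D where D: "\<And>x. (f has_derivative D x) (at x)" "\<And>b. (\<lambda>x. D x b) \<in> hermite_functions"
    using hermite_functions_derivative by metis
  show "f differentiable (at x)" for x using D(1) by (rule differentiableI)
  show "dir_deriv b f \<in> hermite_functions" for b unfolding dir_deriv_eqI[OF D(1)] by (rule D(2))
  show "bounded (range (\<lambda>x. (1 + norm x) ^ k * cmod (f x)))" for k by (rule hermite_functions_bounded[OF f])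
qed

section \<open>The distributions \<open>e\<^sub>j\<close>\<close>

definition lattice_point :: "nat \<Rightarrow> int ^ 'n \<Rightarrow> int ^ 'n \<Rightarrow> real ^ 'n" where
  "lattice_point N j k = (\<chi> i. (real N * of_int (k $ i) + of_int (j $ i)) / real N)"

definition lattice_weight :: "nat \<Rightarrow> int ^ 'n \<Rightarrow> int ^ 'n::finite \<Rightarrow> real" where
  "lattice_weight N j k = (\<Prod>i\<in>UNIV. 1 / (1 + \<bar>of_int (k $ i) + of_int (j $ i) / real N\<bar>)\<^sup>2)"

lemma lattice_weight_summable:
  fixes j :: "int ^ 'n::finite"
  assumes N: "N > 0" and j: "j \<in> Z_mod N"
  shows "(\<lambda>k. lattice_weight N j k) summable_on UNIV"
  unfolding lattice_weight_def
proof (rule summable_on_prod_int_vec)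
  fix i
  have "0 \<le> j $ i" "j $ i < int N" using j by (auto simp: Z_mod_def)
  hence "0 \<le> of_int (j $ i) / real N" "of_int (j $ i) / real N \<le> 1" using N by (auto simp: field_simps)
  thus "(\<lambda>k. 1 / (1 + \<bar>of_int k + of_int (j $ i) / real N\<bar>)\<^sup>2) summable_on UNIV"
    by (rule summable_on_int_inverse_square)
qed auto

lemma schwartz_seminorm_bound:
  assumes "\<phi> \<in> schwartz" shows "(1 + norm x) ^ k * cmod (\<phi> x) \<le> schwartz_seminorm k [] \<phi>"
  unfolding schwartz_seminorm_def iter_deriv.simps
  by (rule cSUP_upper) (auto intro: bounded_imp_bdd_above schwartz_bounded[OF assms])

text \<open>
  The power \<open>2 n\<close> of \<open>1 + norm x\<close> dominates the product of the \<open>(1 + \<bar>x\<^sub>i\<bar>)\<^sup>2\<close>, which makes the bound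
  summable over the lattice and gives the continuity estimate for \<open>e\<^sub>j\<close>.
\<close>

lemma schwartz_lattice_bound:
  fixes \<phi> :: "real ^ 'n::finite \<Rightarrow> complex"
  assumes N: "N > 0" and \<phi>: "\<phi> \<in> schwartz"
  shows "cmod (\<phi> (lattice_point N j k)) \<le> schwartz_seminorm (2 * CARD('n)) [] \<phi> * lattice_weight N j k"
proof -
  let ?x = "lattice_point N j k"
  have "(\<Prod>i\<in>UNIV. (1 + \<bar>?x $ i\<bar>)\<^sup>2) \<le> (\<Prod>i\<in>(UNIV :: 'n set). (1 + norm ?x)\<^sup>2)"
    by (intro prod_mono) (auto intro!: power_mono component_le_norm_cart)
  also have "\<dots> = (1 + norm ?x) ^ (2 * CARD('n))" by (simp add: power_mult)
  finally have "(\<Prod>i\<in>UNIV. (1 + \<bar>?x $ i\<bar>)\<^sup>2) * cmod (\<phi> ?x) \<le> (1 + norm ?x) ^ (2 * CARD('n)) * cmod (\<phi> ?x)"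
    by (rule mult_right_mono) simp
  also have "\<dots> \<le> schwartz_seminorm (2 * CARD('n)) [] \<phi>" by (rule schwartz_seminorm_bound[OF \<phi>])
  finally have 1: "(\<Prod>i\<in>UNIV. (1 + \<bar>?x $ i\<bar>)\<^sup>2) * cmod (\<phi> ?x) \<le> schwartz_seminorm (2 * CARD('n)) [] \<phi>" .
  have "lattice_weight N j k = 1 / (\<Prod>i\<in>UNIV. (1 + \<bar>?x $ i\<bar>)\<^sup>2)"
    using N by (simp add: lattice_weight_def lattice_point_def prod_dividef add_divide_distrib)
  moreover have "(\<Prod>i\<in>UNIV. (1 + \<bar>?x $ i\<bar>)\<^sup>2) > 0" by (intro prod_pos) auto
  ultimately show ?thesis using 1 by (simp add: field_simps)
qed

lemma schwartz_lattice_summable: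
  assumes N: "N > 0" and j: "j \<in> Z_mod N" and \<phi>: "\<phi> \<in> schwartz"
  shows "(\<lambda>k. cmod (\<phi> (lattice_point N j k))) summable_on UNIV"
  by (rule summable_on_comparison_test[OF summable_on_cmult_right[OF lattice_weight_summable[OF N j]]])
     (use schwartz_lattice_bound[OF N \<phi>] in auto)

lemma e_basis_schwartz:
  fixes \<phi> :: "real ^ 'n::finite \<Rightarrow> complex"
  shows "\<phi> \<in> schwartz \<Longrightarrow> e_basis N j \<phi> = of_real (real N powr (- real CARD('n) / 2)) * (\<Sum>\<^sub>\<infinity>k. \<phi> (lattice_point N j k))"
  by (simp add: e_basis_def lattice_point_def)

lemma e_basis_not_schwartz: "\<phi> \<notin> schwartz \<Longrightarrow> e_basis N j \<phi> = 0"
  by (simp add: e_basis_def)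

lemma e_basis_red:
  fixes j :: "int ^ 'n::finite"
  assumes N: "N > 0" shows "e_basis N (red N j) = e_basis N j"
proof
  fix \<phi> :: "real ^ 'n \<Rightarrow> complex"
  obtain m where m: "j = red N j + (\<chi> i. int N * m i)" using red_decompose by blast
  have "lattice_point N j k = lattice_point N (red N j) (k + (\<chi> i. m i))" for k
    by (subst m) (simp add: lattice_point_def vec_eq_iff algebra_simps)
  hence "(\<Sum>\<^sub>\<infinity>k. \<phi> (lattice_point N j k)) = (\<Sum>\<^sub>\<infinity>k. \<phi> (lattice_point N (red N j) (k + (\<chi> i. m i))))" by simp
  also have "\<dots> = (\<Sum>\<^sub>\<infinity>k. \<phi> (lattice_point N (red N j) k))"
    by (rule infsum_reindex_bij_betw) (rule bij_betw_byWitness[of _ "\<lambda>k. k - (\<chi> i. m i)"], auto)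
  finally show "e_basis N (red N j) \<phi> = e_basis N j \<phi>"
    by (cases "\<phi> \<in> schwartz") (simp_all add: e_basis_schwartz e_basis_not_schwartz)
qed

definition lattice_state :: "nat \<Rightarrow> (int ^ 'n::finite \<Rightarrow> complex) \<Rightarrow> 'n distr" where
  "lattice_state N c = (\<lambda>\<phi>. \<Sum>j\<in>Z_mod N. c j * e_basis N j \<phi>)"

lemma lattice_state_tempered:
  fixes c :: "int ^ 'n::finite \<Rightarrow> complex"
  assumes N: "N > 0" shows "lattice_state N c \<in> tempered"
  unfolding tempered_def mem_Collect_eq
proof (intro conjI allI impI ballI)
  show "lattice_state N c \<phi> = 0" if "\<phi> \<notin> schwartz" for \<phi>
    using that by (simp add: lattice_state_def e_basis_not_schwartz)
next
  fix \<phi> \<psi> :: "real ^ 'n \<Rightarrow> complex" assume \<phi>: "\<phi> \<in> schwartz" "\<psi> \<in> schwartz"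
  have "e_basis N j (\<lambda>x. \<phi> x + \<psi> x) = e_basis N j \<phi> + e_basis N j \<psi>" if "j \<in> Z_mod N" for j :: "int ^ 'n"
    unfolding e_basis_schwartz[OF \<phi>(1)] e_basis_schwartz[OF \<phi>(2)] e_basis_schwartz[OF schwartz_add[OF \<phi>]]
    by (subst infsum_add) (auto intro: abs_summable_summable schwartz_lattice_summable[OF N that] \<phi> simp: ring_distribs)
  thus "lattice_state N c (\<lambda>x. \<phi> x + \<psi> x) = lattice_state N c \<phi> + lattice_state N c \<psi>"
    by (simp add: lattice_state_def ring_distribs sum.distrib)
next
  fix z and \<phi> :: "real ^ 'n \<Rightarrow> complex" assume \<phi>: "\<phi> \<in> schwartz"
  have "e_basis N j (\<lambda>x. z * \<phi> x) = z * e_basis N j \<phi>" for j :: "int ^ 'n"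
    unfolding e_basis_schwartz[OF \<phi>] e_basis_schwartz[OF schwartz_cmult[OF \<phi>]]
    by (simp add: infsum_cmult_right')
  thus "lattice_state N c (\<lambda>x. z * \<phi> x) = z * lattice_state N c \<phi>"
    by (simp add: lattice_state_def sum_distrib_left mult_ac)
next
  let ?m = "2 * CARD('n)" and ?r = "real N powr (- real CARD('n) / 2)"
  let ?C = "\<Sum>j\<in>Z_mod N. cmod (c j) * (?r * (\<Sum>\<^sub>\<infinity>k. lattice_weight N j k))"
  show "\<exists>C k m. \<forall>\<phi>\<in>schwartz. cmod (lattice_state N c \<phi>)
      \<le> C * (\<Sum>bs | set bs \<subseteq> Basis \<and> length bs \<le> m. schwartz_seminorm k bs \<phi>)"
  proof (rule exI[of _ ?C], rule exI[of _ ?m], rule exI[of _ 0], rule ballI)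
    fix \<phi> :: "real ^ 'n \<Rightarrow> complex" assume \<phi>: "\<phi> \<in> schwartz"
    let ?s = "schwartz_seminorm ?m [] \<phi>"
    have bs: "{bs :: (real ^ 'n) list. set bs \<subseteq> Basis \<and> length bs \<le> 0} = {[]}" by auto
    have "cmod (e_basis N j \<phi>) \<le> ?r * (\<Sum>\<^sub>\<infinity>k. lattice_weight N j k) * ?s" if j: "j \<in> Z_mod N" for j
    proof -
      have "cmod (\<Sum>\<^sub>\<infinity>k. \<phi> (lattice_point N j k)) \<le> (\<Sum>\<^sub>\<infinity>k. ?s * lattice_weight N j k)"
        using schwartz_lattice_bound[OF N \<phi>]
        by (intro norm_infsum_le[OF has_sum_infsum[OF abs_summable_summable[OF schwartz_lattice_summable[OF N j \<phi>]]]
            has_sum_infsum[OF summable_on_cmult_right[OF lattice_weight_summable[OF N j]]]]) auto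
      also have "\<dots> = ?s * (\<Sum>\<^sub>\<infinity>k. lattice_weight N j k)" by (rule infsum_cmult_right')
      finally have "?r * cmod (\<Sum>\<^sub>\<infinity>k. \<phi> (lattice_point N j k)) \<le> ?r * (?s * (\<Sum>\<^sub>\<infinity>k. lattice_weight N j k))"
        by (rule mult_left_mono) simp
      thus ?thesis unfolding e_basis_schwartz[OF \<phi>] norm_mult norm_of_real by (simp add: mult_ac)
    qed
    hence "cmod (lattice_state N c \<phi>) \<le> (\<Sum>j\<in>Z_mod N. cmod (c j) * (?r * (\<Sum>\<^sub>\<infinity>k. lattice_weight N j k) * ?s))"
      unfolding lattice_state_def
      by (intro order_trans[OF norm_sum] sum_mono) (auto simp: norm_mult intro!: mult_left_mono)
    thus "cmod (lattice_state N c \<phi>) \<le> ?C * (\<Sum>bs | set bs \<subseteq> Basis \<and> length bs \<le> 0. schwartz_seminorm ?m bs \<phi>)"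
      unfolding bs by (simp add: sum_distrib_left mult_ac)
  qed
qed

lemma of_int_vec_half: "fst_half (of_int_vec w) = of_int_vec (fst_half w)" "snd_half (of_int_vec w) = of_int_vec (snd_half w)"
  by (simp_all add: fst_half_def snd_half_def vec_eq_iff)

lemma scaleR_half: "fst_half (r *\<^sub>R x) = r *\<^sub>R fst_half x" "snd_half (r *\<^sub>R x) = r *\<^sub>R snd_half x"
  by (simp_all add: fst_half_def snd_half_def vec_eq_iff)

lemma U_op_e_basis:
  fixes w :: "int ^ ('n::finite + 'n)"
  assumes N: "N > 0"
  shows "U_op N ((1 / real N) *\<^sub>R of_int_vec w) (e_basis N j)
    = (\<lambda>\<phi>. (phase N (fst_half w) j * cis (- pi / real N * of_int (int_dot (fst_half w) (snd_half w))))
          * e_basis N (j - snd_half w) \<phi>)"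
proof
  fix \<phi> :: "real ^ 'n \<Rightarrow> complex"
  let ?y = "fst_half w" and ?\<eta> = "snd_half w"
  let ?ry = "(1 / real N) *\<^sub>R of_int_vec ?y :: real ^ 'n" and ?r\<eta> = "(1 / real N) *\<^sub>R of_int_vec ?\<eta> :: real ^ 'n"
  let ?z = "phase N ?y j * cis (- pi / real N * of_int (int_dot ?y ?\<eta>))"
  define \<psi> where "\<psi> = (\<lambda>x. cis ((?ry \<bullet> (x - ?r\<eta>)) / planck N + (?ry \<bullet> ?r\<eta>) / (2 * planck N)) * \<phi> (x - ?r\<eta>))"
  have U: "U_op N ((1 / real N) *\<^sub>R of_int_vec w) (e_basis N j) \<phi> = e_basis N j \<psi>"
    by (simp add: U_op_def Let_def scaleR_half of_int_vec_half \<psi>_def mult.assoc)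
  have \<psi>: "\<psi> = (\<lambda>x. cis (((1 / planck N) *\<^sub>R ?ry) \<bullet> x + ((?ry \<bullet> ?r\<eta>) / (2 * planck N) - (?ry \<bullet> ?r\<eta>) / planck N)) * \<phi> (x - ?r\<eta>))"
    by (simp add: \<psi>_def inner_diff_right diff_divide_distrib algebra_simps)
  have S: "\<psi> \<in> schwartz \<longleftrightarrow> \<phi> \<in> schwartz" unfolding \<psi> by (rule schwartz_modulated_translate_iff)
  have val: "\<psi> (lattice_point N j k) = ?z * \<phi> (lattice_point N (j - ?\<eta>) k)" for k
  proof -
    have p: "lattice_point N j k - ?r\<eta> = lattice_point N (j - ?\<eta>) k"
      by (simp add: lattice_point_def vec_eq_iff diff_divide_distrib add_divide_distrib)
    have lp: "lattice_point N (j - ?\<eta>) k = of_int_vec k + (1 / real N) *\<^sub>R of_int_vec (j - ?\<eta>)"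
      using N by (simp add: lattice_point_def vec_eq_iff diff_divide_distrib add_divide_distrib)
    have "(?ry \<bullet> lattice_point N (j - ?\<eta>) k) / planck N + (?ry \<bullet> ?r\<eta>) / (2 * planck N)
      = (2 * pi / real N * of_int (int_dot ?y j) + (- pi / real N * of_int (int_dot ?y ?\<eta>))) + 2 * pi * of_int (int_dot ?y k)"
      unfolding lp planck_def using N
      by (simp add: inner_add_right of_int_vec_inner int_dot_diff_right field_simps)
    hence "cis ((?ry \<bullet> lattice_point N (j - ?\<eta>) k) / planck N + (?ry \<bullet> ?r\<eta>) / (2 * planck N)) = ?z"
      by (simp only: cis_add_2pi_int) (simp add: phase_def cis_mult)
    thus ?thesis by (simp add: \<psi>_def p)
  qed
  show "U_op N ((1 / real N) *\<^sub>R of_int_vec w) (e_basis N j) \<phi> = ?z * e_basis N (j - ?\<eta>) \<phi>"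
  proof (cases "\<phi> \<in> schwartz")
    case True
    thus ?thesis unfolding U using S by (simp only: e_basis_schwartz val infsum_cmult_right') (simp only: mult_ac)
  next
    case False
    thus ?thesis unfolding U using S by (simp add: e_basis_not_schwartz)
  qed
qed

text \<open>
  The coordinate formula for \<open>U\<^bsub>w/N\<^esub>\<close>. It also covers integer translations, as those by \<open>N w\<close> in the
  scaled parameter.
\<close>

lemma U_op_lattice_state:
  fixes w :: "int ^ ('n::finite + 'n)"
  assumes N: "N > 0"
  shows "U_op N ((1 / real N) *\<^sub>R of_int_vec w) (lattice_state N c) = lattice_state N (weyl N w c)"
proof
  fix \<phi> :: "real ^ 'n \<Rightarrow> complex"
  let ?y = "fst_half w" and ?\<eta> = "snd_half w"
  let ?z = "\<lambda>j. phase N ?y j * cis (- pi / real N * of_int (int_dot ?y ?\<eta>))"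
  have "U_op N ((1 / real N) *\<^sub>R of_int_vec w) (lattice_state N c) \<phi>
    = (\<Sum>j\<in>Z_mod N. c j * U_op N ((1 / real N) *\<^sub>R of_int_vec w) (e_basis N j) \<phi>)"
    by (simp add: U_op_def Let_def lattice_state_def)
  also have "\<dots> = (\<Sum>j\<in>Z_mod N. c j * (?z j * e_basis N (red N (j - ?\<eta>)) \<phi>))"
    by (simp only: U_op_e_basis[OF N] e_basis_red[OF N])
  also have "\<dots> = (\<Sum>j\<in>Z_mod N. weyl N w c (red N (j - ?\<eta>)) * e_basis N (red N (j - ?\<eta>)) \<phi>)"
  proof (intro sum.cong refl)
    fix j :: "int ^ 'n" assume j: "j \<in> Z_mod N"
    have "phase N ?y (j - ?\<eta>) * cis (pi / real N * of_int (int_dot ?y ?\<eta>)) = ?z j"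
      by (simp add: phase_def cis_mult int_dot_diff_right algebra_simps diff_divide_distrib)
    hence "weyl N w c (red N (j - ?\<eta>)) = ?z j * c j"
      using N j by (simp add: weyl_def phase_red red_id)
    thus "c j * (?z j * e_basis N (red N (j - ?\<eta>)) \<phi>) = weyl N w c (red N (j - ?\<eta>)) * e_basis N (red N (j - ?\<eta>)) \<phi>"
      by (simp only: mult_ac)
  qed
  also have "\<dots> = lattice_state N (weyl N w c) \<phi>" unfolding lattice_state_def
    by (rule sum.reindex_bij_betw[OF bij_betw_red_diff[OF N]])
  finally show "U_op N ((1 / real N) *\<^sub>R of_int_vec w) (lattice_state N c) \<phi> = lattice_state N (weyl N w c) \<phi>" .
qed

lemma lattice_state_in_H_space:
  fixes c :: "int ^ 'n::finite \<Rightarrow> complex"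
  assumes N: "N > 0" shows "lattice_state N c \<in> H_space N"
  unfolding H_space_def mem_Collect_eq
proof (intro conjI allI lattice_state_tempered N)
  fix w :: "int ^ ('n + 'n)"
  let ?w = "int N *s w"
  let ?y = "fst_half w" and ?\<eta> = "snd_half w"
  have half: "fst_half ?w = int N *s ?y" "snd_half ?w = int N *s ?\<eta>" by (simp_all add: fst_half_def snd_half_def vec_eq_iff)
  have dot: "int_dot (int N *s a) b = int N * int_dot a b" "int_dot a (int N *s b) = int N * int_dot a b" for a b :: "int ^ 'n"
    by (simp_all add: int_dot_def sum_distrib_left mult_ac)
  let ?d = "real N * pi * (fst_half (of_int_vec w) \<bullet> snd_half (of_int_vec w))"
  have "weyl N ?w c j = cis ?d * c j" if j: "j \<in> Z_mod N" for j
  proof -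
    have "red N (j + int N *s ?\<eta>) = j" using j by (simp add: red_def Z_mod_def vec_eq_iff)
    moreover have "phase N (int N *s ?y) j = 1"
    proof -
      have "2 * pi / real N * of_int (int_dot (int N *s ?y) j) = 2 * pi * of_int (int_dot ?y j)"
        using N by (simp add: dot)
      thus ?thesis unfolding phase_def by (simp only: cis_two_pi_int)
    qed
    moreover have "pi / real N * of_int (int_dot (int N *s ?y) (int N *s ?\<eta>)) = ?d"
      using N by (simp add: dot of_int_vec_half of_int_vec_inner)
    ultimately show ?thesis using j by (simp only: weyl_def half if_True mult_1)
  qed
  hence "lattice_state N (weyl N ?w c) = (\<lambda>\<phi>. cis ?d * lattice_state N c \<phi>)"
    by (auto simp: lattice_state_def sum_distrib_left fun_eq_iff mult.assoc intro!: sum.cong)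
  moreover have "of_int_vec w = (1 / real N) *\<^sub>R of_int_vec ?w" using N by (simp add: vec_eq_iff)
  ultimately show "U_op N (of_int_vec w) (lattice_state N c) = (\<lambda>\<phi>. cis ?d * lattice_state N c \<phi>)"
    by (simp only: U_op_lattice_state[OF N])
qed

subsection \<open>Linear independence\<close>

lemma e_basis_gaussian_nonzero:
  assumes N: "N > 0" and j: "j \<in> Z_mod N" shows "e_basis N j gaussian \<noteq> 0"
proof -
  let ?g = "\<lambda>k. exp (- (lattice_point N j k \<bullet> lattice_point N j k))"
  have s: "?g summable_on UNIV"
    using schwartz_lattice_summable[OF N j gaussian_schwartz] by (simp add: gaussian_def)
  have "0 < sum ?g {0}" by simp
  also have "\<dots> \<le> infsum ?g UNIV" by (rule finite_sum_le_infsum[OF s]) auto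
  finally have "infsum ?g UNIV \<noteq> 0" by simp
  moreover have "(\<Sum>\<^sub>\<infinity>k. gaussian (lattice_point N j k)) = of_real (infsum ?g UNIV)"
    using has_sum_infsum[OF s] unfolding gaussian_def by (intro infsumI) (simp add: has_sum_of_real_iff)
  ultimately show ?thesis using N by (simp add: e_basis_schwartz[OF gaussian_schwartz])
qed

lemma int_dot_commute: "int_dot a b = int_dot b a"
  by (simp add: int_dot_def mult.commute)

lemma phase_commute: "phase N a b = phase N b a"
  by (simp add: phase_def int_dot_commute)

text \<open>
  Test against Gaussians modulated by \<open>exp (2 \<pi> i <y, x>)\<close>: the modulation multiplies the value of
  \<open>e\<^sub>k\<close> by the character \<open>phase N y k\<close>, and orthogonality of characters isolates each coefficient. The
  Gaussian itself has a positive value under every \<open>e\<^sub>k\<close>.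
\<close>

lemma lattice_state_zero_imp:
  fixes c :: "int ^ 'n::finite \<Rightarrow> complex"
  assumes N: "N > 0" and z: "lattice_state N c = (\<lambda>\<phi>. 0)" and j: "j \<in> Z_mod N"
  shows "c j = 0"
proof -
  have mod: "(\<Sum>k\<in>Z_mod N. c k * (phase N y k * e_basis N k gaussian)) = 0" for y
  proof -
    let ?\<psi> = "\<lambda>x. cis (((2 * pi) *\<^sub>R of_int_vec y) \<bullet> x + 0) * gaussian x"
    have S: "?\<psi> \<in> schwartz" by (rule schwartz_cis[OF gaussian_schwartz])
    have ev: "?\<psi> (lattice_point N k l) = phase N y k * gaussian (lattice_point N k l)" for k l
    proof -
      have "lattice_point N k l = of_int_vec l + (1 / real N) *\<^sub>R of_int_vec k"
        using N by (simp add: lattice_point_def vec_eq_iff add_divide_distrib)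
      hence "((2 * pi) *\<^sub>R of_int_vec y) \<bullet> lattice_point N k l + 0
        = 2 * pi / real N * of_int (int_dot y k) + 2 * pi * of_int (int_dot y l)"
        by (simp add: inner_add_right of_int_vec_inner ring_distribs)
      thus ?thesis by (simp only: cis_add_2pi_int phase_def)
    qed
    have "e_basis N k ?\<psi> = phase N y k * e_basis N k gaussian" for k
      unfolding e_basis_schwartz[OF S] e_basis_schwartz[OF gaussian_schwartz] ev infsum_cmult_right'
      by (rule mult.left_commute)
    moreover have "lattice_state N c ?\<psi> = 0" by (simp only: z)
    ultimately show ?thesis by (simp add: lattice_state_def)
  qed
  have "0 = (\<Sum>y\<in>Z_mod N. phase N y (- j) * (\<Sum>k\<in>Z_mod N. c k * (phase N y k * e_basis N k gaussian)))"
    by (simp add: mod)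
  also have "\<dots> = (\<Sum>k\<in>Z_mod N. c k * e_basis N k gaussian * (\<Sum>y\<in>Z_mod N. phase N (k - j) y))"
    unfolding sum_distrib_left
    by (subst sum.swap, intro sum.cong refl)
       (simp add: phase_commute[of N "_ - j"] phase_add[of N _ _ "- j", simplified] mult_ac)
  also have "\<dots> = (\<Sum>k\<in>Z_mod N. if k = j then c k * e_basis N k gaussian * of_nat (N ^ CARD('n)) else 0)"
  proof (intro sum.cong refl)
    fix k :: "int ^ 'n" assume k: "k \<in> Z_mod N"
    show "c k * e_basis N k gaussian * (\<Sum>y\<in>Z_mod N. phase N (k - j) y)
      = (if k = j then c k * e_basis N k gaussian * of_nat (N ^ CARD('n)) else 0)"
    proof (cases "k = j")
      case True
      have "(\<Sum>y\<in>Z_mod N. phase N (k - j) y) = (\<Sum>y\<in>(Z_mod N :: (int ^ 'n) set). 1)"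
        by (simp add: True phase_def)
      thus ?thesis using True by (simp add: card_Z_mod)
    next
      case False
      hence "red N (k - j) \<noteq> 0" using red_eq_iff[of N k j] red_id k j by metis
      thus ?thesis using False by (simp add: phase_sum_zero[OF N])
    qed
  qed
  also have "\<dots> = c j * e_basis N j gaussian * of_nat (N ^ CARD('n))" using j by simp
  finally show ?thesis using e_basis_gaussian_nonzero[OF N j] N by simp
qed

lemma lattice_state_add: "lattice_state N (\<lambda>j. c j + c' j) = (\<lambda>\<phi>. lattice_state N c \<phi> + lattice_state N c' \<phi>)"
  and lattice_state_cmult: "lattice_state N (\<lambda>j. z * c j) = (\<lambda>\<phi>. z * lattice_state N c \<phi>)"
  and lattice_state_diff: "lattice_state N (\<lambda>j. c j - c' j) = (\<lambda>\<phi>. lattice_state N c \<phi> - lattice_state N c' \<phi>)"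
  and lattice_state_sum: "lattice_state N (\<lambda>j. \<Sum>s\<in>S. f s j) = (\<lambda>\<phi>. \<Sum>s\<in>S. lattice_state N (f s) \<phi>)"
  by (simp_all add: lattice_state_def fun_eq_iff ring_distribs sum.distrib sum_distrib_left mult_ac sum_subtractf sum_distrib_right)
     (rule allI, rule sum.swap)

lemma lattice_state_inject:
  assumes N: "N > 0" and "c \<in> coords N" "c' \<in> coords N" "lattice_state N c = lattice_state N c'"
  shows "c = c'"
proof
  fix j
  have "lattice_state N (\<lambda>j. c j - c' j) = (\<lambda>\<phi>. 0)" using assms(4) by (simp add: lattice_state_diff)
  thus "c j = c' j" using lattice_state_zero_imp[OF N, of "\<lambda>j. c j - c' j" j] assms(2,3)
    by (cases "j \<in> Z_mod N") (auto simp: coords_def)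
qed

subsection \<open>Coordinates of quantum states\<close>

lemma H_coord_lattice_state:
  assumes N: "N > 0" and c: "c \<in> coords N"
  shows "H_coord N (lattice_state N c) = c"
  unfolding H_coord_def
proof (rule the_equality)
  show "(\<forall>j. j \<notin> Z_mod N \<longrightarrow> c j = 0) \<and> lattice_state N c = (\<lambda>\<phi>. \<Sum>j\<in>Z_mod N. c j * e_basis N j \<phi>)"
    using c by (auto simp: coords_def lattice_state_def)
next
  fix c' :: "int ^ 'a \<Rightarrow> complex"
  assume "(\<forall>j. j \<notin> Z_mod N \<longrightarrow> c' j = 0) \<and> lattice_state N c = (\<lambda>\<phi>. \<Sum>j\<in>Z_mod N. c' j * e_basis N j \<phi>)"
  hence "c' \<in> coords N" "lattice_state N c = lattice_state N c'" by (auto simp: coords_def lattice_state_def)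
  thus "c' = c" using lattice_state_inject[OF N c] by metis
qed

text \<open>
  Steinitz exchange for families instead of sets, so that no injectivity is required.
\<close>

lemma dependent_family:
  fixes f :: "'i \<Rightarrow> 'x \<Rightarrow> complex" and g :: "'j \<Rightarrow> 'x \<Rightarrow> complex"
  assumes I: "finite I" and J: "finite J" and card: "card J < card I"
    and span: "\<And>i. i \<in> I \<Longrightarrow> \<exists>a. \<forall>x. f i x = (\<Sum>j\<in>J. a j * g j x)"
  shows "\<exists>a. (\<exists>i\<in>I. a i \<noteq> 0) \<and> (\<forall>x. (\<Sum>i\<in>I. a i * f i x) = 0)"
proof -
  interpret fs: vector_space "\<lambda>(c::complex) (h :: 'x \<Rightarrow> complex) x. c * h x"
    by unfold_locales (auto simp: fun_eq_iff algebra_simps)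
  have sum_apply: "(\<Sum>s\<in>S. F s) x = (\<Sum>s\<in>S. F s x)" for S and F :: "'s \<Rightarrow> 'x \<Rightarrow> complex" and x
    by (induction S rule: infinite_finite_induct) auto
  show ?thesis
  proof (cases "inj_on f I")
    case False
    then obtain i i' where i: "i \<in> I" "i' \<in> I" "i \<noteq> i'" "f i = f i'" by (auto simp: inj_on_def)
    let ?a = "\<lambda>k. (if k = i then 1 else 0) - (if k = i' then 1 else 0) :: complex"
    have "(\<Sum>k\<in>I. ?a k * f k x) = 0" for x
    proof -
      have "(\<Sum>k\<in>I. ?a k * f k x) = (\<Sum>k\<in>I. (if k = i then f k x else 0)) - (\<Sum>k\<in>I. (if k = i' then f k x else 0))"
        unfolding sum_subtractf[symmetric] by (intro sum.cong refl) (auto split: if_splits)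
      also have "\<dots> = f i x - f i' x" using i(1,2) I by simp
      finally show ?thesis by (simp add: i(4))
    qed
    thus ?thesis using i by (intro exI[of _ ?a]) auto
  next
    case True
    have "f ` I \<subseteq> fs.span (g ` J)"
    proof
      fix h assume "h \<in> f ` I"
      then obtain i where i: "i \<in> I" "h = f i" by auto
      then obtain a where a: "\<And>x. f i x = (\<Sum>j\<in>J. a j * g j x)" using span by blast
      have "h = (\<Sum>j\<in>J. (\<lambda>x. a j * g j x))" by (auto simp: fun_eq_iff sum_apply i a)
      also have "\<dots> \<in> fs.span (g ` J)" by (intro fs.span_sum fs.span_scale fs.span_base) auto
      finally show "h \<in> fs.span (g ` J)" .
    qed
    moreover have "card (g ` J) < card (f ` I)" using card card_image_le[OF J, of g] card_image[OF True] by simp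
    ultimately have "fs.dependent (f ` I)"
      using fs.independent_span_bound[OF finite_imageI[OF J, of g], of "f ` I"] by (meson not_le)
    then obtain U where U: "\<exists>h\<in>f ` I. U h \<noteq> 0" "(\<Sum>h\<in>f ` I. (\<lambda>x. U h * h x)) = 0"
      using fs.dependent_finite[of "f ` I"] I by auto
    have "(\<Sum>i\<in>I. U (f i) * f i x) = 0" for x
    proof -
      have "(\<Sum>i\<in>I. U (f i) * f i x) = (\<Sum>h\<in>f ` I. U h * h x)" by (simp add: sum.reindex[OF True] o_def)
      also have "\<dots> = (\<Sum>h\<in>f ` I. (\<lambda>x. U h * h x)) x" by (simp add: sum_apply)
      finally show ?thesis by (simp add: U(2))
    qed
    thus ?thesis using U(1) by (intro exI[of _ "U \<circ> f"]) auto
  qed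
qed

text \<open>
  That the \<open>e\<^sub>j\<close> span the space of states is obtained by counting dimensions: the space of sections is
  spanned by \<open>card (verts X) * N ^ n\<close> eigensections, so the space of states has dimension at most \<open>N ^ n\<close>,
  the number of the independent states \<open>e\<^sub>j\<close>. A state outside their span would give one independent
  vector too many over each vertex.
\<close>

lemma H_space_spanned:
  fixes X :: "('v, 'e) pre_digraph" and u :: "nat \<Rightarrow> 'v \<Rightarrow> 'n::finite distr"
    and T :: "'n distr"
  assumes N: "N > 0" and V: "finite (verts X)" "verts X \<noteq> {}"
    and basis: "sec_orthonormal_basis X N (card (verts X) * N ^ CARD('n)) u"
    and T: "T \<in> H_space N"
  shows "\<exists>c\<in>coords N. T = lattice_state N c"
proof (rule ccontr)
  assume not: "\<not> ?thesis"
  let ?V = "verts X" and ?m = "card (verts X) * N ^ CARD('n)"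
  let ?I = "?V \<times> (insert None (Some ` (Z_mod N :: (int ^ 'n) set)))"
  \<comment> \<open>Over each vertex there are the states \<open>e\<^sub>j\<close>, and \<open>T\<close> as one more.\<close>
  define s :: "(int ^ 'n) option \<Rightarrow> 'n distr" where "s = (\<lambda>x. case x of None \<Rightarrow> T | Some j \<Rightarrow> lattice_state N (delta j))"
  define F where "F = (\<lambda>(v :: 'v, x) (v' :: 'v, \<phi>). if v' = v then s x \<phi> else 0)"
  define G where "G = (\<lambda>i (v, \<phi>). if v \<in> ?V then u i v \<phi> else 0)"
  have "card (insert None (Some ` (Z_mod N :: (int ^ 'n) set))) = Suc (N ^ CARD('n))"
    by (simp add: card_image card_Z_mod)
  hence card: "card {1..?m} < card ?I" using V by (simp add: card_cartesian_product card_gt_0_iff)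
  have zero: "(\<lambda>\<phi>. 0) \<in> H_space N"
    using lattice_state_in_H_space[OF N, of "\<lambda>_. 0"] by (simp add: lattice_state_def)
  have span: "\<exists>a. \<forall>y. F x y = (\<Sum>j\<in>{1..?m}. a j * G j y)" if x: "x \<in> ?I" for x
  proof -
    obtain v z where x': "x = (v, z)" "v \<in> ?V" using x by auto
    have "s z \<in> H_space N" by (auto simp: s_def T lattice_state_in_H_space[OF N] split: option.splits)
    hence sec: "(\<lambda>v'. if v' = v then s z else (\<lambda>\<phi>. 0)) \<in> sections X N" by (simp add: sections_def zero)
    have all: "\<forall>w\<in>sections X N. \<exists>c. \<forall>v\<in>?V. w v = (\<lambda>\<phi>. \<Sum>i = 1..?m. c i * u i v \<phi>)"
      using basis by (simp add: sec_orthonormal_basis_def)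
    have "\<exists>a. \<forall>v'\<in>?V. (if v' = v then s z else (\<lambda>\<phi>. 0)) = (\<lambda>\<phi>. \<Sum>i = 1..?m. a i * u i v' \<phi>)"
      using bspec[OF all sec] .
    then obtain a where a: "\<And>v'. v' \<in> ?V \<Longrightarrow> (if v' = v then s z else (\<lambda>\<phi>. 0)) = (\<lambda>\<phi>. \<Sum>i = 1..?m. a i * u i v' \<phi>)"
      by blast
    have "F x y = (\<Sum>j\<in>{1..?m}. a j * G j y)" for y
    proof (cases y)
      case (Pair v' \<phi>)
      show ?thesis
      proof (cases "v' \<in> ?V")
        case True
        from fun_cong[OF a[OF True], of \<phi>] show ?thesis by (auto simp: F_def G_def x' Pair True split: if_splits)
      next
        case False
        thus ?thesis using x'(2) by (auto simp: F_def G_def x'(1) Pair)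
      qed
    qed
    thus ?thesis by blast
  qed
  have fin: "finite ?I" using V(1) by simp
  from dependent_family[where f = F and g = G, OF fin finite_atLeastAtMost card span] obtain a where
    nz: "\<exists>i\<in>?I. a i \<noteq> 0" and a: "\<And>y. (\<Sum>i\<in>?I. a i * F i y) = 0" by blast
  have eq: "a (v, None) * T \<phi> + lattice_state N (\<lambda>j. a (v, Some j)) \<phi> = 0" if v: "v \<in> ?V" for v \<phi>
  proof -
    have "0 = (\<Sum>(v', z)\<in>?I. a (v', z) * (if v = v' then s z \<phi> else 0))"
      using a[of "(v, \<phi>)"] by (simp add: F_def case_prod_beta)
    also have "\<dots> = (\<Sum>(v', z)\<in>{v} \<times> insert None (Some ` (Z_mod N :: (int ^ 'n) set)). a (v', z) * s z \<phi>)"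
      using v V(1) by (intro sum.mono_neutral_cong_right) auto
    also have "\<dots> = (\<Sum>z\<in>insert None (Some ` (Z_mod N :: (int ^ 'n) set)). a (v, z) * s z \<phi>)"
      by (simp add: sum_Times)
    also have "\<dots> = a (v, None) * T \<phi> + (\<Sum>j\<in>Z_mod N. a (v, Some j) * lattice_state N (delta j) \<phi>)"
      by (simp add: sum.reindex s_def)
    also have "(\<Sum>j\<in>Z_mod N. a (v, Some j) * lattice_state N (delta j) \<phi>) = lattice_state N (\<lambda>j. a (v, Some j)) \<phi>"
      by (auto simp: lattice_state_def delta_def if_distrib[of "\<lambda>x. x * _"] cong: if_cong intro!: sum.cong)
    finally show ?thesis by simp
  qed
  have N0: "a (v, None) = 0" if v: "v \<in> ?V" for v
  proof (rule ccontr)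
    assume nz: "a (v, None) \<noteq> 0"
    let ?c = "\<lambda>j. if j \<in> Z_mod N then (- 1 / a (v, None)) * a (v, Some j) else 0"
    have "lattice_state N ?c = lattice_state N (\<lambda>j. (- 1 / a (v, None)) * a (v, Some j))"
      by (auto simp: lattice_state_def)
    also have "\<dots> = T"
    proof
      fix \<phi>
      have "lattice_state N (\<lambda>j. a (v, Some j)) \<phi> = - (a (v, None) * T \<phi>)"
        using eq[OF v, of \<phi>] by (simp add: eq_neg_iff_add_eq_0 add.commute)
      thus "lattice_state N (\<lambda>j. (- 1 / a (v, None)) * a (v, Some j)) \<phi> = T \<phi>"
        unfolding lattice_state_cmult using nz by simp
    qed
    finally have "T = lattice_state N ?c" ..
    moreover have "?c \<in> coords N" by (simp add: coords_def)
    ultimately show False using not by blast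
  qed
  have "a (v, Some j) = 0" if v: "v \<in> ?V" and j: "j \<in> Z_mod N" for v j
    by (rule lattice_state_zero_imp[OF N _ j, of "\<lambda>j. a (v, Some j)"]) (use eq[OF v] N0[OF v] in auto)
  thus False using nz N0 by auto
qed

section \<open>Quantum observables and cat maps in coordinates\<close>

lemma infsum_finite_sum:
  fixes f :: "'a \<Rightarrow> 's \<Rightarrow> complex"
  assumes "finite S" "\<And>s. s \<in> S \<Longrightarrow> (\<lambda>x. f x s) summable_on A"
  shows "(\<Sum>\<^sub>\<infinity>x\<in>A. \<Sum>s\<in>S. f x s) = (\<Sum>s\<in>S. \<Sum>\<^sub>\<infinity>x\<in>A. f x s)"
proof -
  have "((\<lambda>x. \<Sum>s\<in>S. f x s) has_sum (\<Sum>s\<in>S. \<Sum>\<^sub>\<infinity>x\<in>A. f x s)) A"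
    using assms
  proof (induction S rule: finite_induct)
    case (insert s S)
    thus ?case by (simp add: has_sum_add)
  qed simp
  thus ?thesis by (rule infsumI)
qed

lemma fourier_weyl_summable:
  assumes a: "a \<in> torus_smooth" and c: "c \<in> coords N"
  shows "(\<lambda>w. fourier_coeff a w * weyl N w c j) summable_on UNIV"
proof (rule abs_summable_summable)
  let ?C = "\<Sum>j\<in>Z_mod N. cmod (c j)"
  have "cmod (weyl N w c j) \<le> ?C" for w
  proof (cases "j \<in> Z_mod N")
    case True
    have "cmod (weyl N w c j) = cmod (c (red N (j + snd_half w)))"
      using True by (simp add: weyl_def norm_mult)
    also have "\<dots> \<le> ?C"
    proof (cases "red N (j + snd_half w) \<in> Z_mod N")
      case True thus ?thesis by (intro member_le_sum) auto
    next
      case False thus ?thesis using c by (simp add: coords_def sum_nonneg)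
    qed
    finally show ?thesis .
  qed (simp add: weyl_def sum_nonneg)
  hence "cmod (fourier_coeff a w * weyl N w c j) \<le> cmod (fourier_coeff a w) * ?C" for w
    unfolding norm_mult by (rule mult_left_mono) simp
  thus "(\<lambda>w. cmod (fourier_coeff a w * weyl N w c j)) summable_on UNIV"
    by (intro summable_on_comparison_test[OF summable_on_cmult_left[OF fourier_coeff_summable[OF a]]]) auto
qed

lemma Op_lattice_state:
  assumes N: "N > 0" and a: "a \<in> torus_smooth" and c: "c \<in> coords N"
  shows "Op N a (lattice_state N c) = lattice_state N (\<lambda>j. \<Sum>\<^sub>\<infinity>w. fourier_coeff a w * weyl N w c j)"
proof
  fix \<phi>
  have "Op N a (lattice_state N c) \<phi> = (\<Sum>\<^sub>\<infinity>w. \<Sum>j\<in>Z_mod N. fourier_coeff a w * weyl N w c j * e_basis N j \<phi>)"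
    unfolding Op_def U_op_lattice_state[OF N] by (simp add: lattice_state_def sum_distrib_left mult.assoc)
  also have "\<dots> = (\<Sum>j\<in>Z_mod N. \<Sum>\<^sub>\<infinity>w. fourier_coeff a w * weyl N w c j * e_basis N j \<phi>)"
    by (intro infsum_finite_sum finite_Z_mod summable_on_cmult_left fourier_weyl_summable a c)
  also have "\<dots> = lattice_state N (\<lambda>j. \<Sum>\<^sub>\<infinity>w. fourier_coeff a w * weyl N w c j) \<phi>"
    by (simp add: lattice_state_def infsum_cmult_left')
  finally show "Op N a (lattice_state N c) \<phi> = lattice_state N (\<lambda>j. \<Sum>\<^sub>\<infinity>w. fourier_coeff a w * weyl N w c j) \<phi>" .
qed

lemma fourier_weyl_coords: "(\<lambda>j. \<Sum>\<^sub>\<infinity>w. fourier_coeff a w * weyl N w c j) \<in> coords N"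
  by (simp add: coords_def weyl_def)

lemma Op_character:
  assumes N: "N > 0" and c: "c \<in> coords N"
  shows "Op N (character w) (lattice_state N c) = lattice_state N (weyl N w c)"
proof -
  have "(\<Sum>\<^sub>\<infinity>w'. fourier_coeff (character w) w' * weyl N w' c j) = (\<Sum>\<^sub>\<infinity>w'\<in>{w}. weyl N w c j)" for j
    by (rule infsum_cong_neutral) (auto simp: fourier_coeff_character)
  thus ?thesis by (simp add: Op_lattice_state[OF N character_smooth c])
qed

lemma H_inner_lattice_state:
  assumes "N > 0" "c \<in> coords N" "c' \<in> coords N"
  shows "H_inner N (lattice_state N c) (lattice_state N c') = cinner N c c'"
  using assms by (simp add: H_inner_def H_coord_lattice_state cinner_def)

lemma H_inner_Op:
  assumes N: "N > 0" and a: "a \<in> torus_smooth" and c: "c \<in> coords N"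
  shows "H_inner N (Op N a (lattice_state N c)) (lattice_state N c)
    = (\<Sum>\<^sub>\<infinity>w. fourier_coeff a w * cinner N (weyl N w c) c)"
proof -
  have "H_inner N (Op N a (lattice_state N c)) (lattice_state N c)
    = (\<Sum>j\<in>Z_mod N. (\<Sum>\<^sub>\<infinity>w. fourier_coeff a w * weyl N w c j) * cnj (c j))"
    unfolding Op_lattice_state[OF N a c] H_inner_lattice_state[OF N fourier_weyl_coords c] cinner_def ..
  also have "\<dots> = (\<Sum>j\<in>Z_mod N. \<Sum>\<^sub>\<infinity>w. fourier_coeff a w * weyl N w c j * cnj (c j))"
    by (simp add: infsum_cmult_left')
  also have "\<dots> = (\<Sum>\<^sub>\<infinity>w. \<Sum>j\<in>Z_mod N. fourier_coeff a w * weyl N w c j * cnj (c j))"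
    by (intro infsum_finite_sum[symmetric] finite_Z_mod summable_on_cmult_left fourier_weyl_summable a c)
  finally show ?thesis by (simp add: cinner_def sum_distrib_left mult.assoc)
qed

text \<open>
  The type argument records the dimension, since it does not occur in the type of \<open>N\<close>.
\<close>

definition lattice_states_span :: "nat \<Rightarrow> 'n::finite itself \<Rightarrow> bool" where
  "lattice_states_span N t \<longleftrightarrow> (\<forall>T \<in> (H_space N :: 'n distr set). \<exists>c\<in>coords N. T = lattice_state N c)"

locale spanned_states =
  fixes N :: nat and t :: "'n::finite itself"
  assumes N_pos: "N > 0" and span: "lattice_states_span N t"
begin

lemma spanned: "(T :: 'n distr) \<in> H_space N \<Longrightarrow> \<exists>c\<in>coords N. T = lattice_state N c"
  using span by (simp add: lattice_states_span_def)

lemma H_coord_coords: "(T :: 'n distr) \<in> H_space N \<Longrightarrow> H_coord N T \<in> coords N"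
  and lattice_state_H_coord: "(T :: 'n distr) \<in> H_space N \<Longrightarrow> lattice_state N (H_coord N T) = T"
  using spanned H_coord_lattice_state[OF N_pos] by metis+

definition coord_map :: "('n distr \<Rightarrow> 'n distr) \<Rightarrow> 'n cop" where
  "coord_map M c = H_coord N (M (lattice_state N c))"

lemma cat_map_lattice_state:
  fixes E :: "int ^ ('n + 'n) ^ ('n + 'n)"
  assumes M: "is_cat_map N E M" and c: "c \<in> coords N"
  shows "M (lattice_state N c) = lattice_state N (coord_map M c)" "coord_map M c \<in> coords N"
proof -
  have "M (lattice_state N c) \<in> H_space N"
    using M lattice_state_in_H_space[OF N_pos] unfolding is_cat_map_def H_unitary_def bij_betw_def by blast
  thus "M (lattice_state N c) = lattice_state N (coord_map M c)" "coord_map M c \<in> coords N"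
    by (simp_all add: coord_map_def lattice_state_H_coord H_coord_coords)
qed

lemma cat_map_isometric:
  fixes E :: "int ^ ('n + 'n) ^ ('n + 'n)"
  assumes M: "is_cat_map N E M"
  shows "isometric_op N (coord_map M)"
  unfolding isometric_op_def
proof (intro conjI ballI allI)
  note CM = cat_map_lattice_state[OF M]
  have H: "lattice_state N (c :: int ^ 'n \<Rightarrow> complex) \<in> H_space N" for c by (rule lattice_state_in_H_space[OF N_pos])
  have add: "\<And>S T. S \<in> H_space N \<Longrightarrow> T \<in> H_space N \<Longrightarrow> M (\<lambda>\<phi>. S \<phi> + T \<phi>) = (\<lambda>\<phi>. M S \<phi> + M T \<phi>)"
    and scal: "\<And>z T. T \<in> H_space N \<Longrightarrow> M (\<lambda>\<phi>. z * T \<phi>) = (\<lambda>\<phi>. z * M T \<phi>)"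
    and inner: "\<And>S T. S \<in> H_space N \<Longrightarrow> T \<in> H_space N \<Longrightarrow> H_inner N (M S) (M T) = H_inner N S T"
    using M unfolding is_cat_map_def H_unitary_def by blast+
  fix c c' :: "int ^ 'n \<Rightarrow> complex" assume c: "c \<in> coords N"
  show "coord_map M c \<in> coords N" by (rule CM(2)[OF c])
  show "coord_map M (\<lambda>j. z * c j) = (\<lambda>j. z * coord_map M c j)" for z
  proof (rule lattice_state_inject[OF N_pos CM(2)[OF coords_cmult[OF c]] coords_cmult[OF CM(2)[OF c]]])
    show "lattice_state N (coord_map M (\<lambda>j. z * c j)) = lattice_state N (\<lambda>j. z * coord_map M c j)"
      unfolding CM(1)[OF coords_cmult[OF c], symmetric] lattice_state_cmult scal[OF H] CM(1)[OF c] ..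
  qed
  assume c': "c' \<in> coords N"
  show "coord_map M (\<lambda>j. c j + c' j) = (\<lambda>j. coord_map M c j + coord_map M c' j)"
  proof (rule lattice_state_inject[OF N_pos CM(2)[OF coords_add[OF c c']] coords_add[OF CM(2)[OF c] CM(2)[OF c']]])
    show "lattice_state N (coord_map M (\<lambda>j. c j + c' j)) = lattice_state N (\<lambda>j. coord_map M c j + coord_map M c' j)"
      unfolding CM(1)[OF coords_add[OF c c'], symmetric] lattice_state_add add[OF H H] CM(1)[OF c] CM(1)[OF c'] ..
  qed
  show "cinner N (coord_map M c) (coord_map M c') = cinner N c c'"
    using inner[OF H H, of c c'] by (simp add: CM c c' H_inner_lattice_state[OF N_pos])
qed

text \<open>
  The conjugation property of the cat map, applied to the observable that is a single character.
\<close>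

lemma cat_map_egorov:
  fixes E :: "int ^ ('n + 'n) ^ ('n + 'n)"
  assumes M: "is_cat_map N E M" and c: "c \<in> coords N"
  shows "weyl N w (coord_map M c) = coord_map M (weyl N (w v* E) c)"
proof (rule lattice_state_inject[OF N_pos])
  note CM = cat_map_lattice_state[OF M]
  have H: "lattice_state N (c :: int ^ 'n \<Rightarrow> complex) \<in> H_space N" for c by (rule lattice_state_in_H_space[OF N_pos])
  have bij: "bij_betw M (H_space N) (H_space N)" using M unfolding is_cat_map_def H_unitary_def by blast
  have "inv_into (H_space N) M (Op N (character w) (M (lattice_state N c)))
      = Op N (character w \<circ> mat_act E) (lattice_state N c)"
    using M H character_smooth unfolding is_cat_map_def by blast
  also have "character w \<circ> mat_act E = character (w v* E)" by (simp add: fun_eq_iff character_transpose)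
  also have "Op N \<dots> (lattice_state N c) = lattice_state N (weyl N (w v* E) c)"
    by (rule Op_character[OF N_pos c])
  also have "Op N (character w) (M (lattice_state N c)) = lattice_state N (weyl N w (coord_map M c))"
    unfolding CM(1)[OF c] by (rule Op_character[OF N_pos CM(2)[OF c]])
  finally have "M (inv_into (H_space N) M (lattice_state N (weyl N w (coord_map M c))))
    = M (lattice_state N (weyl N (w v* E) c))" by simp
  moreover have "lattice_state N (weyl N w (coord_map M c)) \<in> M ` H_space N"
    using bij H by (simp add: bij_betw_def)
  hence "M (inv_into (H_space N) M (lattice_state N (weyl N w (coord_map M c)))) = lattice_state N (weyl N w (coord_map M c))"
    by (rule f_inv_into_f)
  ultimately show "lattice_state N (weyl N w (coord_map M c)) = lattice_state N (coord_map M (weyl N (w v* E) c))"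
    by (simp add: CM(1))
  show "coord_map M (weyl N (w v* E) c) \<in> coords N" by (rule CM(2)) simp
qed simp

end

lemma (in weighted_graph) cat_map_choice_quantum_graph:
  fixes M :: "'e \<Rightarrow> 'n distr \<Rightarrow> 'n distr"
  assumes sp: "spanned_states N TYPE('n)" and M: "cat_map_choice X rv chi N M"
  shows "quantum_graph X rv d chi N (\<lambda>e. spanned_states.coord_map N (M e))"
proof -
  interpret spanned_states N "TYPE('n)" by (rule sp)
  have cat: "is_cat_map N (chi e) (M e)" if "e \<in> arcs X" for e using M that by (simp add: cat_map_choice_def)
  show ?thesis
  proof unfold_locales
    show "N > 0" by (rule N_pos)
    show "isometric_op N (coord_map (M e))" if "e \<in> arcs X" for e by (rule cat_map_isometric[OF cat[OF that]])
    show "weyl N w (coord_map (M e) c) = coord_map (M e) (weyl N (w v* chi e) c)" if "e \<in> arcs X" "c \<in> coords N" for e c w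
      by (rule cat_map_egorov[OF cat[OF that(1)] that(2)])
    fix e and c :: "int ^ 'n \<Rightarrow> complex" assume e: "e \<in> arcs X" and c: "c \<in> coords N"
    note CM = cat_map_lattice_state[OF cat[OF e] c] 
    have H: "lattice_state N (c :: int ^ 'n \<Rightarrow> complex) \<in> H_space N" for c by (rule lattice_state_in_H_space[OF N_pos])
    have "M (rv e) (M e (lattice_state N c)) = inv_into (H_space N) (M e) (M e (lattice_state N c))"
      using M e H unfolding cat_map_choice_def CM(1) by blast
    also have "\<dots> = lattice_state N c"
      using cat[OF e] H unfolding is_cat_map_def H_unitary_def bij_betw_def by (auto intro: inv_into_f_f)
    finally have "M (rv e) (lattice_state N (coord_map (M e) c)) = lattice_state N c" by (simp only: CM(1))
    thus "coord_map (M (rv e)) (coord_map (M e) c) = c"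
      unfolding coord_map_def[of "M (rv e)"] by (simp add: H_coord_lattice_state[OF N_pos c])
  qed
qed

lemma (in weighted_graph) eigenbasis_eigensystem:
  fixes M :: "'e \<Rightarrow> 'n distr \<Rightarrow> 'n distr" and u :: "nat \<Rightarrow> 'v \<Rightarrow> 'n distr"
  assumes sp: "spanned_states N TYPE('n)" and M: "cat_map_choice X rv chi N M"
    and basis: "sec_orthonormal_basis X N (card (verts X) * N ^ CARD('n)) u"
    and eig: "\<And>i. i \<in> {1..card (verts X) * N ^ CARD('n)} \<Longrightarrow> eigensection X M (u i)"
  shows "eigensystem N (\<lambda>e. spanned_states.coord_map N (M e)) {1..card (verts X) * N ^ CARD('n)}
     (\<lambda>i v. H_coord N (u i v))"
proof -
  interpret spanned_states N "TYPE('n)" by (rule sp)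
  let ?I = "{1..card (verts X) * N ^ CARD('n)}" and ?M = "\<lambda>e. coord_map (M e)"
  note qg = cat_map_choice_quantum_graph[OF sp M]
  interpret quantum_graph X rv d chi N ?M by (rule qg)
  have uH: "u i v \<in> H_space N" if "i \<in> ?I" "v \<in> verts X" for i v
    using basis that unfolding sec_orthonormal_basis_def sections_def by blast
  have orth: "(\<Sum>v\<in>verts X. cinner N (H_coord N (u i v)) (H_coord N (u j v))) = (if i = j then 1 else 0)"
    if "i \<in> ?I" "j \<in> ?I" for i j
    using basis that unfolding sec_orthonormal_basis_def sec_inner_def H_inner_def cinner_def by blast
  have "\<exists>\<mu>. quantum_eigensection X rv d chi N ?M (\<lambda>v. H_coord N (u i v)) \<mu>" if i: "i \<in> ?I" for i
  proof -
    obtain \<mu> where \<mu>: "\<And>v. v \<in> verts X \<Longrightarrow> laplacian X M (u i) v = (\<lambda>\<phi>. \<mu> * u i v \<phi>)"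
      using eig[OF i] unfolding eigensection_def by blast
    have "quantum_eigensection X rv d chi N ?M (\<lambda>v. H_coord N (u i v)) \<mu>"
    proof unfold_locales
      show "H_coord N (u i v) \<in> coords N" if "v \<in> verts X" for v by (rule H_coord_coords[OF uH[OF i that]])
      show "(\<Sum>v\<in>verts X. cinner N (H_coord N (u i v)) (H_coord N (u i v))) = 1" using orth[OF i i] by simp
      fix v assume v: "v \<in> verts X"
      let ?c = "\<lambda>e. H_coord N (u i (head X e))"
      have c: "?c e \<in> coords N" if "e \<in> out_arcs X v" for e
        using that by (intro H_coord_coords uH[OF i]) auto
      show "(\<lambda>j. \<Sum>e\<in>out_arcs X v. ?M e (?c e) j) = (\<lambda>j. \<mu> * H_coord N (u i v) j)"
      proof (rule lattice_state_inject[OF N_pos])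
        have "(\<lambda>j. \<Sum>e\<in>out_arcs X v. 1 * ?M e (?c e) j) \<in> coords N"
          using c by (intro coords_sum isometric_opD(1)[OF M_isometric]) auto
        thus "(\<lambda>j. \<Sum>e\<in>out_arcs X v. ?M e (?c e) j) \<in> coords N" by simp
        show "(\<lambda>j. \<mu> * H_coord N (u i v) j) \<in> coords N" by (intro coords_cmult H_coord_coords uH i v)
        have "lattice_state N (\<lambda>j. \<Sum>e\<in>out_arcs X v. ?M e (?c e) j) = (\<lambda>\<phi>. \<Sum>e\<in>out_arcs X v. M e (u i (head X e)) \<phi>)"
          unfolding lattice_state_sum
        proof (intro ext sum.cong refl)
          fix \<phi> e assume e: "e \<in> out_arcs X v"
          hence "is_cat_map N (chi e) (M e)" using M by (simp add: cat_map_choice_def)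
          from cat_map_lattice_state(1)[OF this c[OF e]]
          show "lattice_state N (?M e (?c e)) \<phi> = M e (u i (head X e)) \<phi>"
            using e by (simp add: lattice_state_H_coord uH[OF i])
        qed
        also have "\<dots> = (\<lambda>\<phi>. \<mu> * u i v \<phi>)" using \<mu>[OF v] by (simp add: laplacian_def)
        also have "\<dots> = lattice_state N (\<lambda>j. \<mu> * H_coord N (u i v) j)"
          by (simp add: lattice_state_cmult lattice_state_H_coord uH[OF i v])
        finally show "lattice_state N (\<lambda>j. \<Sum>e\<in>out_arcs X v. ?M e (?c e) j) = lattice_state N (\<lambda>j. \<mu> * H_coord N (u i v) j)" .
      qed
    qed
    thus ?thesis by blast
  qed
  thus ?thesis unfolding eigensystem_def using qg orth by auto
qed

section \<open>Quantum ergodicity\<close>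

theorem theorem1p2:
  fixes X :: "('v, 'e) pre_digraph" and rv :: "'e \<Rightarrow> 'e" and d :: nat and b :: 'v
    and chi :: "'e \<Rightarrow> int ^ ('n::finite + 'n) ^ ('n + 'n)"
    and M :: "nat \<Rightarrow> 'e \<Rightarrow> 'n distr \<Rightarrow> 'n distr"
    and u :: "nat \<Rightarrow> nat \<Rightarrow> 'v \<Rightarrow> 'n distr"
    and f :: "'v \<Rightarrow> real ^ ('n + 'n) \<Rightarrow> complex"
  assumes "regular_graph X rv d"
    and "symplectic_weights X rv chi"
    and "\<And>N. even N \<Longrightarrow> 0 < N \<Longrightarrow> cat_map_choice X rv chi N (M N)"
    and "\<And>N. even N \<Longrightarrow> 0 < N \<Longrightarrow>
      sec_orthonormal_basis X N (card (verts X) * N ^ CARD('n)) (u N)"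
    and "\<And>N i. even N \<Longrightarrow> 0 < N \<Longrightarrow> i \<in> {1..card (verts X) * N ^ CARD('n)} \<Longrightarrow>
      eigensection X (M N) (u N i)"
    and "b \<in> verts X"
    and "BIV X rv b chi"
    and "ERG X rv b chi"
    and "\<And>v. v \<in> verts X \<Longrightarrow> f v \<in> torus_smooth"
  shows "((\<lambda>N. 1 / real (card (verts X) * N ^ CARD('n)) *
            (\<Sum>i = 1..card (verts X) * N ^ CARD('n).
               (cmod (sec_inner X N (Op_sec N f (u N i)) (u N i)
                 - 1 / of_nat (card (verts X)) * (\<Sum>v\<in>verts X. torus_integral (f v))))\<^sup>2))
          \<longlongrightarrow> 0) (inf sequentially (principal {N. even N}))"
proof -
  interpret weighted_graph X rv d chi
    using assms(1,2) by (intro weighted_graph.intro regular_bidirected.intro regular_bidirected_axioms.intro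
        weighted_graph_axioms.intro) (auto simp: regular_graph_def)
  have V: "card (verts X) > 0" using assms(6) by (auto simp: card_gt_0_iff)
  let ?I = "\<lambda>N. {1..card (verts X) * N ^ CARD('n)}"
  let ?x = "\<lambda>N i. sec_inner X N (Op_sec N f (u N i)) (u N i)
                 - 1 / of_nat (card (verts X)) * (\<Sum>v\<in>verts X. torus_integral (f v))"
  let ?Z = "\<lambda>N u. (\<Sum>v\<in>verts X. \<Sum>\<^sub>\<infinity>w. fourier_coeff (f v) w * diag_coeff v w N u)
     - 1 / of_nat (card (verts X)) * (\<Sum>v\<in>verts X. fourier_coeff (f v) 0)"
  have Z: "negligible_variance ?Z"
    by (rule superposition_variance[OF assms(7,6,8)]) (rule fourier_coeff_summable[OF assms(9)])
  have sp: "spanned_states N TYPE('n)" if N: "even N" "0 < N" for N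
    using H_space_spanned[OF N(2) finite_verts _ assms(4)[OF N]] assms(6) N(2) by unfold_locales (auto simp: lattice_states_span_def)
  have x: "?x N i = ?Z N (\<lambda>v. H_coord N (u N i v))" if N: "even N" "0 < N" and i: "i \<in> ?I N" for N i
  proof -
    interpret spanned_states N "TYPE('n)" by (rule sp[OF N])
    have "H_inner N (Op N (f v) (u N i v)) (u N i v) = (\<Sum>\<^sub>\<infinity>w. fourier_coeff (f v) w * diag_coeff v w N (\<lambda>v. H_coord N (u N i v)))"
      if v: "v \<in> verts X" for v
    proof -
      have H: "u N i v \<in> H_space N" using assms(4)[OF N] i v unfolding sec_orthonormal_basis_def sections_def by blast
      show ?thesis using H_inner_Op[OF N_pos assms(9)[OF v] H_coord_coords[OF H]]
        by (simp add: lattice_state_H_coord[OF H] diag_coeff_def)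
    qed
    thus ?thesis by (simp add: sec_inner_def Op_sec_def fourier_coeff_zero)
  qed
  show ?thesis
    unfolding tendsto_iff eventually_inf_principal
  proof (intro allI impI)
    fix \<epsilon> :: real assume \<epsilon>: "\<epsilon> > 0"
    obtain N0 where N0: "\<And>N M I u. N \<ge> N0 \<Longrightarrow> eigensystem N M I u \<Longrightarrow>
       (\<Sum>i\<in>I. (cmod (?Z N (u i)))\<^sup>2) \<le> \<epsilon> / 2 * real N ^ CARD('n)"
      using Z half_gt_zero[OF \<epsilon>] unfolding negligible_variance_def variance_bound_def by blast
    have bound: "dist (1 / real (card (verts X) * N ^ CARD('n)) * (\<Sum>i\<in>?I N. (cmod (?x N i))\<^sup>2)) 0 < \<epsilon>"
      if N: "N \<ge> max 1 N0" "even N" for N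
    proof -
      have N': "0 < N" "N \<ge> N0" using N by auto
      define D where "D = real (card (verts X) * N ^ CARD('n))"
      define S where "S = (\<Sum>i\<in>?I N. (cmod (?x N i))\<^sup>2)"
      have D: "D > 0" using V N' by (simp add: D_def)
      have "S = (\<Sum>i\<in>?I N. (cmod (?Z N (\<lambda>v. H_coord N (u N i v))))\<^sup>2)"
        unfolding S_def by (intro sum.cong refl) (simp only: x[OF N(2) N'(1)])
      also have "\<dots> \<le> \<epsilon> / 2 * real N ^ CARD('n)"
        by (rule N0[OF N'(2) eigenbasis_eigensystem[OF sp[OF N(2) N'(1)] assms(3)[OF N(2) N'(1)] assms(4)[OF N(2) N'(1)]
            assms(5)[OF N(2) N'(1)]]])
      also have "\<dots> \<le> \<epsilon> / 2 * D"
      proof (rule mult_left_mono)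
        have "1 * real N ^ CARD('n) \<le> real (card (verts X)) * real N ^ CARD('n)"
          using V by (intro mult_right_mono) auto
        thus "real N ^ CARD('n) \<le> D" by (simp add: D_def)
      qed (use \<epsilon> in simp)
      finally have "1 / D * S \<le> \<epsilon> / 2" using D by (simp add: field_simps)
      moreover have "0 \<le> S" unfolding S_def by (intro sum_nonneg) simp
      hence "0 \<le> 1 / D * S" using D by simp
      hence "dist (1 / D * S) 0 = 1 / D * S" by (simp only: dist_real_def diff_0_right abs_of_nonneg)
      ultimately have "dist (1 / D * S) 0 < \<epsilon>" using \<epsilon> by linarith
      thus ?thesis by (simp only: D_def S_def)
    qed
    show "\<forall>\<^sub>F N in sequentially. N \<in> {N. even N} \<longrightarrow>
        dist (1 / real (card (verts X) * N ^ CARD('n)) * (\<Sum>i\<in>?I N. (cmod (?x N i))\<^sup>2)) 0 < \<epsilon>"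
      unfolding eventually_sequentially using bound by (intro exI[of _ "max 1 N0"]) blast
  qed
qed

end
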